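(* Let $N,M\ge2$. If $K\in\{1,\dots,N\}^a$ and $L=(l_j)_{j=1}^b\in\{1,\dots,M\}^b$, then, up to unitary equivalence, $$P_N(K)\otimes_\varphi P_M(L)=\begin{cases}\displaystyle\bigoplus_{i=1}^{\gcd(a,b)}P_{NM}(K*L^{(i)})&(1\le a,b<\infty),\\[2ex]\displaystyle\bigoplus_{i=1}^{b}P_{NM}(K*L^{(i)})&(a=\infty,\ 1\le b<\infty),\\[2ex]\displaystyle\bigoplus_{i\in\mathbf Z}P_{NM}(K*L^{(i)})&(a=b=\infty),\end{cases}$$ where $L^{(i)}:=(l_i,\dots,l_b,l_1,\dots,l_{i-1})$ when $b<\infty$, and, when $b=\infty$, $L^{(i)}:=(l_j')_{j=1}^\infty$ with $l_j':=l_{j+i}$ if $j+i\ge1$ and $l_j':=1$ if $j+i\le0$.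
   Context: For $N\ge2$, $\mathcal O_N$ is the Cuntz algebra: the universal C$^*$-algebra generated by $s_1,\dots,s_N$ (the canonical generators) with $s_i^*s_j=\delta_{ij}I$ and $\sum_{i=1}^N s_is_i^*=I$. All representations are unital $*$-representations on Hilbert spaces. For $N,M\ge2$ let $t_1,\dots,t_N$, $r_1,\dots,r_M$, $s_1,\dots,s_{NM}$ be the canonical generators of $\mathcal O_N,\mathcal O_M,\mathcal O_{NM}$. The unital $*$-embedding $\varphi_{N,M}:\mathcal O_{NM}\to\mathcal O_N\otimes\mathcal O_M$ is defined by $\varphi_{N,M}(s_{M(i-1)+j})=t_i\otimes r_j$ ($i=1,\dots,N$, $j=1,\dots,M$), and $\pi_1\otimes_\varphi\pi_2:=(\pi_1\otimes\pi_2)\circ\varphi_{N,M}$ for representations $\pi_1$ of $\mathcal O_N$ and $\pi_2$ of $\mathcal O_M$; it is a representation of $\mathcal O_{NM}$. Up to unitary equivalence it depends only on the unitary equivalence classes of $\pi_1,\pi_2$. Classes $P_N(J)$: for $J=(j_1,\dots,j_k)\in\{1,\dots,N\}^k$, $k\ge1$, put $s_J=s_{j_1}\cdots s_{j_k}$; a representation $(\mathcal H,\pi)$ of $\mathcal O_N$ is $P_N(J)$ if there is a unit cyclic vector $\Omega\in\mathcal H$ such that $\pi(s_J)\Omega=\Omega$ and $\{\pi(s_{j_l}\cdots s_{j_k})\Omega\}_{l=1}^k$ is an orthonormal family. For $J=(j_n)_{n\in\mathbf N}\in\{1,\dots,N\}^\infty$ (infinite sequences), $(\mathcal H,\pi)$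 is $P_N(J)$ if there is a unit cyclic vector $\Omega\in\mathcal H$ such that $\{\pi(s_{j_1}\cdots s_{j_n})^*\Omega:n\in\mathbf N\}$ is an orthonormal family (indexed by $n$). It is known that for each $J$, $P_N(J)$ exists and is unique up to unitary equivalence, so $P_N(J)$ also denotes any such representation; $P_N(K)\otimes_\varphi P_M(L)$ denotes $\pi_1\otimes_\varphi\pi_2$ with $\pi_1$ being $P_N(K)$ and $\pi_2$ being $P_M(L)$. Products of multiindices: for $K=(k_i)_{i=1}^a\in\{1,\dots,N\}^a$ and $L=(l_i)_{i=1}^a\in\{1,\dots,M\}^a$ of the same length $1\le a\le\infty$, $K\cdot L:=(M(k_i-1)+l_i)_{i=1}^a\in\{1,\dots,NM\}^a$. For $K$ of length $a$ and $L$ of length $b$: if $a,b<\infty$, put $C=\mathrm{lcm}(a,b)$ and $K*L:=K^{C/a}\cdot L^{C/b}$, where $J^m$ is the $m$-fold concatenation of $J$; if $a=\infty$, $b<\infty$, $K*L:=K\cdot L^\infty$, where $L^\infty$ is the infinite periodic repetition of $L$; if $a=b=\infty$, $K*L:=K\cdot L$. *)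

theory Defs
  imports "HOL-Analysis.Analysis"
begin

subsection \<open>Hilbert spaces and C*-algebras\<close>

class scaleC =
  fixes scaleC :: "complex \<Rightarrow> 'a \<Rightarrow> 'a"  (infixr "*\<^sub>C" 75)

class cbanach = banach + scaleC +
  assumes scaleC_add_right: "c *\<^sub>C (x + y) = c *\<^sub>C x + c *\<^sub>C y"
    and scaleC_add_left: "(c + d) *\<^sub>C x = c *\<^sub>C x + d *\<^sub>C x"
    and scaleC_scaleC: "c *\<^sub>C d *\<^sub>C x = (c * d) *\<^sub>C x"
    and scaleC_of_real: "complex_of_real r *\<^sub>C x = r *\<^sub>R x"
    and norm_scaleC: "norm (c *\<^sub>C x) = cmod c * norm x"

text \<open>The inner product is linear in its second argument.\<close>

class chilbert_space = cbanach +
  fixes cinner :: "'a \<Rightarrow> 'a \<Rightarrow> complex"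
  assumes cinner_commute: "cinner x y = cnj (cinner y x)"
    and cinner_add_right: "cinner x (y + z) = cinner x y + cinner x z"
    and cinner_scaleC_right: "cinner x (c *\<^sub>C y) = c * cinner x y"
    and cinner_self: "cinner x x = complex_of_real ((norm x)\<^sup>2)"

class cstar_algebra = cbanach + real_normed_algebra +
  fixes star :: "'a \<Rightarrow> 'a"
  assumes mult_scaleC_left: "(c *\<^sub>C a) * b = c *\<^sub>C (a * b)"
    and mult_scaleC_right: "a * (c *\<^sub>C b) = c *\<^sub>C (a * b)"
    and star_star: "star (star a) = a"
    and star_add: "star (a + b) = star a + star b"
    and star_scaleC: "star (c *\<^sub>C a) = cnj c *\<^sub>C star a"
    and star_mult: "star (a * b) = star b * star a"
    and cstar_identity: "norm (star a * a) = (norm a)\<^sup>2"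

lemma scaleC_one: "1 *\<^sub>C x = (x :: 'a::cbanach)"
  using scaleC_of_real[of 1 x] by simp

lemma scaleC_zero_left: "0 *\<^sub>C x = (0 :: 'a::cbanach)"
  using scaleC_of_real[of 0 x] by simp

lemma scaleC_zero_right: "c *\<^sub>C 0 = (0 :: 'a::cbanach)"
  using scaleC_add_right[of c "0::'a" 0] by simp

lemma scaleC_minus_right: "c *\<^sub>C (- x) = - (c *\<^sub>C (x :: 'a::cbanach))"
  using scaleC_add_right[of c x "- x"] by (simp add: scaleC_zero_right minus_unique)

lemma scaleC_diff_right: "c *\<^sub>C (x - y) = c *\<^sub>C x - c *\<^sub>C (y :: 'a::cbanach)"
  using scaleC_add_right[of c x "- y"] by (simp add: scaleC_minus_right)

lemma scaleC_scaleR_commute: "c *\<^sub>C (r *\<^sub>R x) = r *\<^sub>R (c *\<^sub>C (x :: 'a::cbanach))"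
  by (simp flip: scaleC_of_real add: scaleC_scaleC mult.commute)

lemma bounded_linear_scaleC: "bounded_linear (\<lambda>x :: 'a::cbanach. c *\<^sub>C x)"
  by (rule bounded_linear_intro[where K = "cmod c"])
     (simp_all add: scaleC_add_right scaleC_scaleR_commute norm_scaleC mult.commute)


lemma cinner_add_left: "cinner (x + y) z = cinner x z + cinner y (z :: 'h::chilbert_space)"
  by (metis cinner_add_right cinner_commute complex_cnj_add)

lemma cinner_scaleC_left: "cinner (c *\<^sub>C x) y = cnj c * cinner x (y :: 'h::chilbert_space)"
  by (metis cinner_scaleC_right cinner_commute complex_cnj_mult)

lemma cinner_scaleR_right: "cinner x (r *\<^sub>R y) = of_real r * cinner x (y :: 'h::chilbert_space)"
  by (simp flip: scaleC_of_real add: cinner_scaleC_right)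

lemma cinner_scaleR_left: "cinner (r *\<^sub>R x) y = of_real r * cinner x (y :: 'h::chilbert_space)"
  by (simp flip: scaleC_of_real add: cinner_scaleC_left)

lemma cinner_minus_right: "cinner x (- y) = - cinner x (y :: 'h::chilbert_space)"
  using cinner_scaleR_right[of x "- 1" y] by simp

lemma cinner_minus_left: "cinner (- x) y = - cinner x (y :: 'h::chilbert_space)"
  using cinner_scaleR_left[of "- 1" x y] by simp

lemma cinner_diff_right: "cinner x (y - z) = cinner x y - cinner x (z :: 'h::chilbert_space)"
  using cinner_add_right[of x y "- z"] by (simp add: cinner_minus_right)

lemma cinner_diff_left: "cinner (x - y) z = cinner x z - cinner y (z :: 'h::chilbert_space)"
  using cinner_add_left[of x "- y" z] by (simp add: cinner_minus_left)

lemma cinner_zero_right: "cinner x (0 :: 'h::chilbert_space) = 0"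
  using cinner_scaleR_right[of x 0 0] by simp

lemma cinner_zero_left: "cinner 0 (x :: 'h::chilbert_space) = 0"
  using cinner_scaleR_left[of 0 0 x] by simp

lemma norm_add_sq: "(norm (x + y :: 'h::chilbert_space))\<^sup>2 = (norm x)\<^sup>2 + (norm y)\<^sup>2 + 2 * Re (cinner x y)"
proof -
  have "complex_of_real ((norm (x + y))\<^sup>2) = cinner x x + cinner x y + (cinner y x + cinner y y)"
    unfolding cinner_self[symmetric] by (simp add: cinner_add_left cinner_add_right)
  then have "Re (complex_of_real ((norm (x + y))\<^sup>2)) =
      Re (cinner x x) + Re (cinner x y) + (Re (cinner y x) + Re (cinner y y))"
    by simp
  moreover have "Re (cinner y x) = Re (cinner x y)"
    by (subst cinner_commute) simp
  ultimately show ?thesis by (simp add: cinner_self)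
qed

lemma cinner_Cauchy_Schwarz: "cmod (cinner x y) \<le> norm x * norm (y :: 'h::chilbert_space)"
proof (cases "x = 0")
  case True
  then show ?thesis by (simp add: cinner_zero_left)
next
  case False
  define n where "n = norm x"
  have n: "n > 0" using False by (simp add: n_def)
  define c where "c = - cinner x y / of_real (n\<^sup>2)"
  have "0 \<le> (norm (c *\<^sub>C x + y))\<^sup>2" by simp
  also have "\<dots> = (cmod c * n)\<^sup>2 + (norm y)\<^sup>2 + 2 * Re (cnj c * cinner x y)"
    by (simp add: norm_add_sq norm_scaleC cinner_scaleC_left n_def)
  also have "cnj c * cinner x y = - of_real ((cmod (cinner x y))\<^sup>2 / n\<^sup>2)"
    by (simp add: c_def complex_norm_square mult.commute del: of_real_power)
  also have "cmod c * n = cmod (cinner x y) / n"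
    using n by (simp add: c_def norm_divide norm_mult power2_eq_square)
  finally have "0 \<le> (norm y)\<^sup>2 - (cmod (cinner x y))\<^sup>2 / n\<^sup>2"
    by (simp add: power_divide)
  then have "(cmod (cinner x y))\<^sup>2 \<le> (n * norm y)\<^sup>2"
    using n by (simp add: field_simps power_mult_distrib)
  then show ?thesis using n n_def power2_le_imp_le by fastforce
qed

lemma bounded_linear_cinner_right: "bounded_linear (cinner (x :: 'h::chilbert_space))"
  by (rule bounded_linear_intro[where K = "norm x"])
     (simp_all add: cinner_add_right cinner_scaleR_right scaleR_conv_of_real
       mult.commute[of _ "norm x"] cinner_Cauchy_Schwarz)

lemma bounded_linear_cinner_left: "bounded_linear (\<lambda>x. cinner x (y :: 'h::chilbert_space))"
  by (rule bounded_linear_intro[where K = "norm y"])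
     (simp_all add: cinner_add_left cinner_scaleR_left scaleR_conv_of_real cinner_Cauchy_Schwarz)

lemma cinner_eqI: "(\<And>z. cinner z x = cinner z y) \<Longrightarrow> x = (y :: 'h::chilbert_space)"
  using cinner_self[of "x - y"] by (simp add: cinner_diff_right)

lemma cinner_eqI_left: "(\<And>z. cinner x z = cinner y z) \<Longrightarrow> x = (y :: 'h::chilbert_space)"
  using cinner_self[of "x - y"] by (simp add: cinner_diff_left)

definition csubspace :: "'a::cbanach set \<Rightarrow> bool" where
  "csubspace V \<longleftrightarrow> 0 \<in> V \<and> (\<forall>x\<in>V. \<forall>y\<in>V. x + y \<in> V) \<and> (\<forall>c. \<forall>x\<in>V. c *\<^sub>C x \<in> V)"

lemma riesz_subspace:
  fixes f :: "'h::chilbert_space \<Rightarrow> complex"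
  assumes S: "csubspace S" "closed S"
    and f: "bounded_linear f" "\<And>c x. f (c *\<^sub>C x) = c * f x"
  shows "\<exists>r\<in>S. \<forall>y\<in>S. f y = cinner r y"
proof -
  interpret f: bounded_linear f by fact
  obtain B where B: "B > 0" "\<And>x. cmod (f x) \<le> norm x * B"
    using f.pos_bounded by blast
  have S0: "0 \<in> S" and Sadd: "\<And>x y. x \<in> S \<Longrightarrow> y \<in> S \<Longrightarrow> x + y \<in> S"
    and SC: "\<And>c x. x \<in> S \<Longrightarrow> c *\<^sub>C x \<in> S"
    using S by (auto simp: csubspace_def)
  have SR: "r *\<^sub>R x \<in> S" if "x \<in> S" for r x
    using SC[OF that, of "of_real r"] by (simp add: scaleC_of_real)
  define J where "J y = (norm y)\<^sup>2 - 2 * Re (f y)" for y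
  have lb: "J y \<ge> - B\<^sup>2" for y
  proof -
    have "Re (f y) \<le> norm y * B"
      using B(2)[of y] complex_Re_le_cmod[of "f y"] by linarith
    moreover have "(norm y - B)\<^sup>2 \<ge> 0" by simp
    ultimately show ?thesis by (simp add: J_def power2_diff)
  qed
  have bdd: "bdd_below (J ` S)" using lb by (auto intro!: bdd_belowI)
  define m where "m = Inf (J ` S)"
  have m: "m \<le> J y" if "y \<in> S" for y
    unfolding m_def using bdd that by (intro cInf_lower) auto
  have "\<exists>y\<in>S. J y < m + 1 / real (Suc n)" for n
  proof -
    have "m < m + 1 / real (Suc n)" by simp
    then show ?thesis
      using cInf_lessD[of "J ` S" "m + 1 / real (Suc n)"] S0 unfolding m_def by blast
  qed
  then obtain Y where Y: "\<And>n. Y n \<in> S" "\<And>n. J (Y n) < m + 1 / real (Suc n)"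
    by metis
  have par: "(norm (y - z))\<^sup>2 = 2 * J y + 2 * J z - 4 * J ((1/2) *\<^sub>R (y + z))" for y z :: 'h
  proof -
    have 1: "(norm (y - z))\<^sup>2 = (norm y)\<^sup>2 + (norm z)\<^sup>2 - 2 * Re (cinner y z)"
      using norm_add_sq[of y "- z"] by (simp add: cinner_minus_right)
    have 2: "(norm ((1/2) *\<^sub>R (y + z)))\<^sup>2 = (1/4) * ((norm y)\<^sup>2 + (norm z)\<^sup>2 + 2 * Re (cinner y z))"
      by (simp add: power_divide norm_add_sq)
    show ?thesis
      unfolding J_def 2 1 by (simp add: f.scaleR f.add algebra_simps)
  qed
  have dY: "(norm (Y j - Y k))\<^sup>2 < 2 * (1 / real (Suc j)) + 2 * (1 / real (Suc k))" for j k
  proof -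
    have "m \<le> J ((1/2) *\<^sub>R (Y j + Y k))"
      by (intro m SR Sadd Y)
    then show ?thesis
      unfolding par using Y(2)[of j] Y(2)[of k] by linarith
  qed
  have "Cauchy Y"
  proof (rule CauchyI)
    fix e :: real assume e: "e > 0"
    obtain n where n: "n > 0" "inverse (real n) < e\<^sup>2 / 4"
      using ex_inverse_of_nat_less[of "e\<^sup>2 / 4"] e by auto
    show "\<exists>M. \<forall>j\<ge>M. \<forall>k\<ge>M. norm (Y j - Y k) < e"
    proof (intro exI allI impI)
      fix j k assume jk: "j \<ge> n" "k \<ge> n"
      have "1 / real (Suc i) < e\<^sup>2 / 4" if "i \<ge> n" for i
      proof -
        have "1 / real (Suc i) \<le> inverse (real n)"
          using that n by (simp add: field_simps)
        then show ?thesis using n by linarith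
      qed
      from this[OF jk(1)] this[OF jk(2)] have "(norm (Y j - Y k))\<^sup>2 < e\<^sup>2"
        using dY[of j k] by linarith
      then show "norm (Y j - Y k) < e"
        using e by (simp add: power2_less_imp_less)
    qed
  qed
  then obtain r where r: "Y \<longlonglongrightarrow> r"
    using Cauchy_convergent convergent_def by blast
  have rS: "r \<in> S"
    using S(2) Y(1) r closed_sequentially by blast
  have "(\<lambda>n. J (Y n)) \<longlonglongrightarrow> J r"
    unfolding J_def by (intro tendsto_intros f.tendsto r)
  moreover have "(\<lambda>n. m + 1 / real (Suc n)) \<longlonglongrightarrow> m + 0"
    by (intro tendsto_intros LIMSEQ_inverse_real_of_nat[unfolded inverse_eq_divide])
  ultimately have Jr: "J r \<le> m"
    using Y(2) by (intro LIMSEQ_le[of "\<lambda>n. J (Y n)" _ "\<lambda>n. m + 1 / real (Suc n)"]) (auto intro: less_imp_le)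
  have Req: "Re (f y) = Re (cinner r y)" if y: "y \<in> S" for y
  proof -
    define d where "d = 2 * (Re (cinner r y) - Re (f y))"
    have quad: "0 \<le> t * d + t\<^sup>2 * (norm y)\<^sup>2" for t
    proof -
      have "J r \<le> J (r + t *\<^sub>R y)"
        using Jr m[OF Sadd[OF rS SR[OF y, of t]]] by linarith
      also have "\<dots> = J r + (t * d + t\<^sup>2 * (norm y)\<^sup>2)"
        unfolding J_def d_def norm_add_sq
        by (simp add: f.add f.scaleR cinner_scaleR_right power_mult_distrib algebra_simps)
      finally show ?thesis by simp
    qed
    define q where "q = (norm y)\<^sup>2 + 1"
    have q: "q > 0" by (simp add: q_def add_nonneg_pos)
    have "0 \<le> - (d / q) * d + (- (d / q))\<^sup>2 * (norm y)\<^sup>2" by (rule quad)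
    also have "\<dots> \<le> - (d / q) * d + (- (d / q))\<^sup>2 * q - (d / q)\<^sup>2"
      by (simp add: q_def algebra_simps)
    also have "\<dots> = - (d / q)\<^sup>2"
      using q by (simp add: field_simps power2_eq_square)
    finally have "d = 0" using q by simp
    then show ?thesis by (simp add: d_def)
  qed
  have "f y = cinner r y" if y: "y \<in> S" for y
  proof (rule complex_eqI)
    show "Re (f y) = Re (cinner r y)" by (rule Req[OF y])
    have "Re (f (\<i> *\<^sub>C y)) = Re (cinner r (\<i> *\<^sub>C y))" by (rule Req[OF SC[OF y]])
    then show "Im (f y) = Im (cinner r y)"
      by (simp add: f(2) cinner_scaleC_right)
  qed
  then show ?thesis using rS by blast
qed


subsection \<open>Bounded operators on a Hilbert space\<close>

typedef (overloaded) ('h::chilbert_space) bop =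
    "{T :: 'h \<Rightarrow>\<^sub>L 'h. \<forall>c x. blinfun_apply T (c *\<^sub>C x) = c *\<^sub>C blinfun_apply T x}"
  by (rule exI[of _ 0]) (simp add: scaleC_zero_right)

setup_lifting type_definition_bop

lift_definition app :: "'h::chilbert_space bop \<Rightarrow> 'h \<Rightarrow> 'h" is blinfun_apply .

lemma bounded_linear_app: "bounded_linear (app T)"
  by transfer (rule blinfun.bounded_linear_right)

lemma app_scaleC: "app T (c *\<^sub>C x) = c *\<^sub>C app T x"
  by transfer simp

lemma app_add: "app T (x + y) = app T x + app T y"
  by (rule linear_add[OF bounded_linear.linear[OF bounded_linear_app]])

lemma app_eqI: "(\<And>x. app S x = app T x) \<Longrightarrow> S = T"
  by transfer (rule blinfun_eqI)

lemma ex_adjoint: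
  fixes T :: "'h::chilbert_space bop"
  shows "\<exists>T'. \<forall>x y. cinner (app T' x) y = cinner x (app T y)"
proof -
  interpret T: bounded_linear "app T" by (rule bounded_linear_app)
  have "\<exists>r. \<forall>y. cinner x (app T y) = cinner r y" for x
    using riesz_subspace[of UNIV "\<lambda>y. cinner x (app T y)"]
      bounded_linear_compose[OF bounded_linear_cinner_right T.bounded_linear_axioms]
    by (simp add: csubspace_def app_scaleC cinner_scaleC_right)
  then obtain R where R: "\<And>x y. cinner x (app T y) = cinner (R x) y" by metis
  obtain B where B: "B > 0" "\<And>x. norm (app T x) \<le> norm x * B"
    using T.pos_bounded by blast
  have bl: "bounded_linear R"
  proof (rule bounded_linear_intro[where K = B])
    show "R (x + y) = R x + R y" for x y
      by (rule cinner_eqI_left) (simp add: cinner_add_left flip: R)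
    show "R (r *\<^sub>R x) = r *\<^sub>R R x" for r x
      by (rule cinner_eqI_left) (simp add: cinner_scaleR_left flip: R)
    show "norm (R x) \<le> norm x * B" for x
    proof (cases "R x = 0")
      case True
      then show ?thesis using B by simp
    next
      case False
      have "(norm (R x))\<^sup>2 = cmod (cinner (R x) (R x))"
        by (simp add: cinner_self norm_power)
      also have "\<dots> = cmod (cinner x (app T (R x)))" by (simp flip: R)
      also have "\<dots> \<le> norm x * norm (app T (R x))" by (rule cinner_Cauchy_Schwarz)
      also have "\<dots> \<le> norm x * (norm (R x) * B)" by (intro mult_left_mono B) simp
      finally show ?thesis using False by (simp add: power2_eq_square)
    qed
  qed
  have RC: "R (c *\<^sub>C x) = c *\<^sub>C R x" for c x
    by (rule cinner_eqI_left) (simp add: cinner_scaleC_left flip: R)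
  define T' where "T' = Abs_bop (Blinfun R)"
  have "app T' x = R x" for x
    unfolding T'_def app.rep_eq
    by (subst Abs_bop_inverse) (simp_all add: bounded_linear_Blinfun_apply[OF bl] RC)
  then show ?thesis using R by metis
qed

instantiation bop :: (chilbert_space) real_normed_vector
begin

lift_definition zero_bop :: "'a bop" is 0
  by (simp add: scaleC_zero_right)

lift_definition plus_bop :: "'a bop \<Rightarrow> 'a bop \<Rightarrow> 'a bop" is "(+)"
  by (simp add: blinfun.add_left scaleC_add_right)

lift_definition minus_bop :: "'a bop \<Rightarrow> 'a bop \<Rightarrow> 'a bop" is "(-)"
  by (simp add: blinfun.diff_left scaleC_diff_right)

lift_definition uminus_bop :: "'a bop \<Rightarrow> 'a bop" is uminus
  by (simp add: blinfun.minus_left scaleC_minus_right)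

lift_definition scaleR_bop :: "real \<Rightarrow> 'a bop \<Rightarrow> 'a bop" is scaleR
  by (simp add: blinfun.scaleR_left scaleC_scaleR_commute)

lift_definition norm_bop :: "'a bop \<Rightarrow> real" is norm .

definition dist_bop :: "'a bop \<Rightarrow> 'a bop \<Rightarrow> real" where
  "dist_bop S T = norm (S - T)"

definition sgn_bop :: "'a bop \<Rightarrow> 'a bop" where
  "sgn_bop T = scaleR (inverse (norm T)) T"

definition uniformity_bop :: "('a bop \<times> 'a bop) filter" where
  "uniformity_bop = (INF e\<in>{0<..}. principal {(x, y). dist x y < e})"

definition open_bop :: "'a bop set \<Rightarrow> bool" where
  "open_bop U = (\<forall>x\<in>U. \<forall>\<^sub>F (x', y) in uniformity. x' = x \<longrightarrow> y \<in> U)"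

lemma app_plus_op: "app (S + T) x = app S x + app T x" for S T :: "'a bop"
  by transfer (simp add: blinfun.add_left)

lemma app_scaleR_op: "app (r *\<^sub>R T) x = r *\<^sub>R app T x" for T :: "'a bop"
  by transfer (simp add: blinfun.scaleR_left)

lemma norm_app: "norm (app T x) \<le> norm T * norm x" for T :: "'a bop"
  by transfer (rule norm_blinfun)

lemma norm_bop_bound:
  "0 \<le> B \<Longrightarrow> (\<And>x. norm (app T x) \<le> B * norm x) \<Longrightarrow> norm T \<le> B" for T :: "'a bop"
  by transfer (rule norm_blinfun_bound)

instance
proof
  fix a b c :: "'a bop" and r s :: real
  show "a + b + c = a + (b + c)" by transfer simp
  show "a + b = b + a" by transfer simp
  show "0 + a = a" by transfer simp
  show "- a + a = 0" by transfer simp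
  show "a - b = a + - b" by transfer simp
  show "r *\<^sub>R (a + b) = r *\<^sub>R a + r *\<^sub>R b" by transfer (rule scaleR_add_right)
  show "(r + s) *\<^sub>R a = r *\<^sub>R a + s *\<^sub>R a" by transfer (rule scaleR_add_left)
  show "r *\<^sub>R s *\<^sub>R a = (r * s) *\<^sub>R a" by transfer simp
  show "1 *\<^sub>R a = a" by transfer simp
  show "dist a b = norm (a - b)" by (rule dist_bop_def)
  show "sgn a = scaleR (inverse (norm a)) a" by (rule sgn_bop_def)
  show "uniformity = (INF e\<in>{0<..}. principal {(x, y :: 'a bop). dist x y < e})"
    by (rule uniformity_bop_def)
  show "open U = (\<forall>x\<in>U. \<forall>\<^sub>F (x', y) in uniformity. x' = x \<longrightarrow> y \<in> U)" for U :: "'a bop set"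
    by (rule open_bop_def)
  show "(norm a = 0) = (a = 0)" by transfer simp
  show "norm (a + b) \<le> norm a + norm b" by transfer (rule norm_triangle_ineq)
  show "norm (r *\<^sub>R a) = \<bar>r\<bar> * norm a" by transfer simp
qed

end

instantiation bop :: (chilbert_space) cbanach
begin

definition scaleC_bop :: "complex \<Rightarrow> 'a bop \<Rightarrow> 'a bop" where
  "scaleC_bop c T = Abs_bop (Blinfun (\<lambda>x. c *\<^sub>C app T x))"

lemma app_scaleC_op: "app (c *\<^sub>C T) x = c *\<^sub>C app T x" for T :: "'a bop"
proof -
  have bl: "bounded_linear (\<lambda>x. c *\<^sub>C app T x)"
    by (rule bounded_linear_compose[OF bounded_linear_scaleC bounded_linear_app])
  show ?thesis
    unfolding scaleC_bop_def
    by (subst (1) app.rep_eq, subst Abs_bop_inverse)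
       (simp_all add: bounded_linear_Blinfun_apply[OF bl] app_scaleC scaleC_scaleC mult.commute)
qed

instance
proof
  fix a b :: "'a bop" and r :: real and z w :: complex
  show "z *\<^sub>C (a + b) = z *\<^sub>C a + z *\<^sub>C b"
    by (rule app_eqI) (simp add: app_scaleC_op app_plus_op scaleC_add_right)
  show "(z + w) *\<^sub>C a = z *\<^sub>C a + w *\<^sub>C a"
    by (rule app_eqI) (simp add: app_scaleC_op app_plus_op scaleC_add_left)
  show "z *\<^sub>C w *\<^sub>C a = (z * w) *\<^sub>C a"
    by (rule app_eqI) (simp add: app_scaleC_op scaleC_scaleC)
  show "complex_of_real r *\<^sub>C a = r *\<^sub>R a"
    by (rule app_eqI) (simp add: app_scaleC_op app_scaleR_op scaleC_of_real)
  have le: "norm (z *\<^sub>C a) \<le> cmod z * norm a" for z and a :: "'a bop"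
  proof (rule norm_bop_bound)
    show "0 \<le> cmod z * norm a" by (transfer fixing: z) simp
    show "norm (app (z *\<^sub>C a) x) \<le> cmod z * norm a * norm x" for x
      by (simp add: app_scaleC_op norm_scaleC mult.assoc mult_left_mono norm_app)
  qed
  show "norm (z *\<^sub>C a) = cmod z * norm a"
  proof (cases "z = 0")
    case True
    have "0 \<le> norm (z *\<^sub>C a)" by (simp add: norm_bop.rep_eq)
    then show ?thesis using le[of z a] True by simp
  next
    case False
    have "a = inverse z *\<^sub>C z *\<^sub>C a"
      by (rule app_eqI) (simp add: app_scaleC_op scaleC_scaleC scaleC_one False)
    then have "norm a \<le> inverse (cmod z) * norm (z *\<^sub>C a)"
      using le[of "inverse z" "z *\<^sub>C a"] by (simp add: norm_inverse)
    then have "cmod z * norm a \<le> norm (z *\<^sub>C a)"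
      using False by (simp add: field_simps)
    then show ?thesis using le[of z a] by simp
  qed
next
  fix X :: "nat \<Rightarrow> 'a bop"
  assume X: "Cauchy X"
  have dist_Rep: "dist (Rep_bop S) (Rep_bop T) = dist S T" for S T :: "'a bop"
    unfolding dist_norm dist_bop_def by transfer simp
  from X have "Cauchy (\<lambda>n. Rep_bop (X n))"
    by (simp add: Cauchy_def dist_Rep)
  then obtain L where L: "(\<lambda>n. Rep_bop (X n)) \<longlonglongrightarrow> L"
    using Cauchy_convergent convergent_def by blast
  have lim: "(\<lambda>n. blinfun_apply (Rep_bop (X n)) x) \<longlonglongrightarrow> blinfun_apply L x" for x
    by (intro tendsto_intros L)
  have "blinfun_apply L (c *\<^sub>C x) = c *\<^sub>C blinfun_apply L x" for c x
  proof (rule LIMSEQ_unique[OF lim])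
    have "(\<lambda>n. c *\<^sub>C blinfun_apply (Rep_bop (X n)) x) \<longlonglongrightarrow> c *\<^sub>C blinfun_apply L x"
      by (rule bounded_linear.tendsto[OF bounded_linear_scaleC lim])
    then show "(\<lambda>n. blinfun_apply (Rep_bop (X n)) (c *\<^sub>C x)) \<longlonglongrightarrow> c *\<^sub>C blinfun_apply L x"
      by (simp add: app_scaleC flip: app.rep_eq)
  qed
  then obtain T where T: "Rep_bop T = L"
    using Abs_bop_inverse[of L] by auto
  have "X \<longlonglongrightarrow> T"
    using L unfolding lim_sequentially T[symmetric] dist_Rep .
  then show "convergent X" by (auto simp: convergent_def)
qed

end

instantiation bop :: (chilbert_space) cstar_algebra
begin

lift_definition times_bop :: "'a bop \<Rightarrow> 'a bop \<Rightarrow> 'a bop" is "(o\<^sub>L)"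
  by simp

definition star_bop :: "'a bop \<Rightarrow> 'a bop" where
  "star_bop T = (THE T'. \<forall>x y. cinner (app T' x) y = cinner x (app T y))"

lemma app_times_op: "app (S * T) x = app S (app T x)" for S T :: "'a bop"
  by transfer simp

lemma cinner_star_left: "cinner (app (star T) x) y = cinner x (app T y)" for T :: "'a bop"
proof -
  obtain T' where T': "\<forall>x y. cinner (app T' x) y = cinner x (app T y)"
    using ex_adjoint by blast
  have "\<forall>x y. cinner (app (star T) x) y = cinner x (app T y)"
    unfolding star_bop_def
    by (rule theI[where a = T']) (use T' in blast, metis T' app_eqI cinner_eqI_left)
  then show ?thesis by blast
qed

lemma cinner_star_right: "cinner x (app (star T) y) = cinner (app T x) y" for T :: "'a bop"
  by (metis cinner_commute cinner_star_left)

instance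
proof
  fix a b c :: "'a bop" and r :: real and z :: complex
  show "a * b * c = a * (b * c)" by (rule app_eqI) (simp add: app_times_op)
  show "(a + b) * c = a * c + b * c" by (rule app_eqI) (simp add: app_times_op app_plus_op)
  show "a * (b + c) = a * b + a * c"
    by (rule app_eqI) (simp add: app_times_op app_plus_op app_add)
  show "r *\<^sub>R a * b = r *\<^sub>R (a * b)" by (rule app_eqI) (simp add: app_times_op app_scaleR_op)
  show "a * r *\<^sub>R b = r *\<^sub>R (a * b)"
    by (rule app_eqI) (simp add: app_times_op app_scaleR_op
          linear_scale[OF bounded_linear.linear[OF bounded_linear_app]])
  show mult: "norm (a * b) \<le> norm a * norm b" for a b :: "'a bop"
    by transfer (rule norm_blinfun_compose)
  show "z *\<^sub>C a * b = z *\<^sub>C (a * b)" by (rule app_eqI) (simp add: app_times_op app_scaleC_op)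
  show "a * z *\<^sub>C b = z *\<^sub>C (a * b)"
    by (rule app_eqI) (simp add: app_times_op app_scaleC_op app_scaleC)
  show ss: "star (star a) = a" for a :: "'a bop"
    by (rule app_eqI, rule cinner_eqI_left) (simp add: cinner_star_left cinner_star_right)
  show "star (a + b) = star a + star b"
    by (rule app_eqI, rule cinner_eqI_left)
       (simp add: cinner_star_left app_plus_op cinner_add_left cinner_add_right)
  show "star (z *\<^sub>C a) = cnj z *\<^sub>C star a"
    by (rule app_eqI, rule cinner_eqI_left)
       (simp add: cinner_star_left app_scaleC_op cinner_scaleC_left cinner_scaleC_right)
  show "star (a * b) = star b * star a"
    by (rule app_eqI, rule cinner_eqI_left) (simp add: cinner_star_left app_times_op)
  have sq: "(norm a)\<^sup>2 \<le> norm (star a * a)" for a :: "'a bop"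
  proof -
    have "norm a \<le> sqrt (norm (star a * a))"
    proof (rule norm_bop_bound)
      fix x
      have "(norm (app a x))\<^sup>2 = cmod (cinner (app a x) (app a x))"
        by (simp add: cinner_self norm_power)
      also have "\<dots> = cmod (cinner x (app (star a * a) x))"
        by (simp add: app_times_op cinner_star_right)
      also have "\<dots> \<le> norm x * norm (app (star a * a) x)" by (rule cinner_Cauchy_Schwarz)
      also have "\<dots> \<le> norm x * (norm (star a * a) * norm x)"
        by (intro mult_left_mono norm_app) simp
      also have "\<dots> = (sqrt (norm (star a * a)) * norm x)\<^sup>2"
        by (simp add: power_mult_distrib) (simp add: power2_eq_square)
      finally show "norm (app a x) \<le> sqrt (norm (star a * a)) * norm x"
        by (rule power2_le_imp_le) simp
    qed simp
    then have "(norm a)\<^sup>2 \<le> (sqrt (norm (star a * a)))\<^sup>2" by (intro power_mono) auto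
    then show ?thesis by simp
  qed
  have star_le: "norm a \<le> norm (star a)" for a :: "'a bop"
  proof (cases "a = 0")
    case False
    have "norm a * norm a \<le> norm (star a) * norm a"
      using order_trans[OF sq[of a] mult[of "star a" a]] by (simp add: power2_eq_square)
    then show ?thesis using False by simp
  qed simp
  have "norm (star a) \<le> norm a" using star_le[of "star a"] by (simp add: ss)
  then have "norm (star a * a) \<le> norm a * norm a"
    using mult[of "star a" a] mult_right_mono[of "norm (star a)" "norm a" "norm a"] by simp
  then show "norm (star a * a) = (norm a)\<^sup>2"
    using sq[of a] by (simp add: power2_eq_square)
qed

end

lift_definition id_op :: "'h::chilbert_space bop" is id_blinfun
  by simp


subsection \<open>Bounded fields: the C*-product of copies of a C*-algebra\<close>

typedef (overloaded) ('x, 'a::cstar_algebra) bfield = "{f :: 'x \<Rightarrow> 'a. bounded (range f)}"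
  morphisms at_pt Abs_bfield
  by (rule exI[of _ "\<lambda>_. 0"]) (auto simp: bounded_iff)

setup_lifting type_definition_bfield

lemma bfield_bound:
  assumes "bounded (range f)"
  obtains B where "B \<ge> 0" "\<And>x. norm (f x) \<le> B"
  using assms by (metis bounded_pos less_imp_le rangeI)

instantiation bfield :: (type, cstar_algebra) real_normed_vector
begin

lift_definition zero_bfield :: "('a, 'b) bfield" is "\<lambda>_. 0"
  by (auto simp: bounded_iff)

lift_definition plus_bfield :: "('a, 'b) bfield \<Rightarrow> ('a, 'b) bfield \<Rightarrow> ('a, 'b) bfield"
  is "\<lambda>f g x. f x + g x"
  by (rule bounded_plus_comp)

lift_definition minus_bfield :: "('a, 'b) bfield \<Rightarrow> ('a, 'b) bfield \<Rightarrow> ('a, 'b) bfield"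
  is "\<lambda>f g x. f x - g x"
  by (rule bounded_minus_comp)

lift_definition uminus_bfield :: "('a, 'b) bfield \<Rightarrow> ('a, 'b) bfield"
  is "\<lambda>f x. - f x"
  by (auto simp: bounded_iff)

lift_definition scaleR_bfield :: "real \<Rightarrow> ('a, 'b) bfield \<Rightarrow> ('a, 'b) bfield"
  is "\<lambda>r f x. r *\<^sub>R f x"
  by (rule bounded_scaleR_comp)

lift_definition norm_bfield :: "('a, 'b) bfield \<Rightarrow> real" is "\<lambda>f. SUP x. norm (f x)" .

definition dist_bfield :: "('a, 'b) bfield \<Rightarrow> ('a, 'b) bfield \<Rightarrow> real" where
  "dist_bfield f g = norm (f - g)"

definition sgn_bfield :: "('a, 'b) bfield \<Rightarrow> ('a, 'b) bfield" where
  "sgn_bfield f = scaleR (inverse (norm f)) f"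

definition uniformity_bfield :: "(('a, 'b) bfield \<times> ('a, 'b) bfield) filter" where
  "uniformity_bfield = (INF e\<in>{0<..}. principal {(x, y). dist x y < e})"

definition open_bfield :: "('a, 'b) bfield set \<Rightarrow> bool" where
  "open_bfield U = (\<forall>x\<in>U. \<forall>\<^sub>F (x', y) in uniformity. x' = x \<longrightarrow> y \<in> U)"

lemma norm_at_pt: "norm (at_pt f x) \<le> norm f" for f :: "('a, 'b) bfield"
proof (transfer fixing: x)
  fix f :: "'a \<Rightarrow> 'b" assume "bounded (range f)"
  then obtain B where "\<And>x. norm (f x) \<le> B" by (metis bfield_bound)
  then show "norm (f x) \<le> (SUP x. norm (f x))"
    by (intro cSUP_upper bdd_aboveI2[where M = B]) auto
qed

lemma norm_bfield_bound: "(\<And>x. norm (at_pt f x) \<le> B) \<Longrightarrow> norm f \<le> B" for f :: "('a, 'b) bfield"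
  by transfer (rule cSUP_least, auto)

instance
proof
  fix a b c :: "('a, 'b) bfield" and r s :: real
  show "a + b + c = a + (b + c)" by transfer (simp add: add.assoc)
  show "a + b = b + a" by transfer (simp add: add.commute)
  show "0 + a = a" by transfer simp
  show "- a + a = 0" by transfer simp
  show "a - b = a + - b" by transfer simp
  show "r *\<^sub>R (a + b) = r *\<^sub>R a + r *\<^sub>R b" by transfer (simp add: scaleR_add_right)
  show "(r + s) *\<^sub>R a = r *\<^sub>R a + s *\<^sub>R a" by transfer (simp add: scaleR_add_left)
  show "r *\<^sub>R s *\<^sub>R a = (r * s) *\<^sub>R a" by transfer simp
  show "1 *\<^sub>R a = a" by transfer simp
  show "dist a b = norm (a - b)" by (rule dist_bfield_def)
  show "sgn a = scaleR (inverse (norm a)) a" by (rule sgn_bfield_def)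
  show "uniformity = (INF e\<in>{0<..}. principal {(x, y :: ('a, 'b) bfield). dist x y < e})"
    by (rule uniformity_bfield_def)
  show "open U = (\<forall>x\<in>U. \<forall>\<^sub>F (x', y) in uniformity. x' = x \<longrightarrow> y \<in> U)"
    for U :: "('a, 'b) bfield set"
    by (rule open_bfield_def)
  have nonneg: "0 \<le> norm a" for a :: "('a, 'b) bfield"
    using norm_ge_zero norm_at_pt order_trans by blast
  show "(norm a = 0) = (a = 0)"
  proof
    assume "norm a = 0"
    then have "at_pt a x = 0" for x using norm_at_pt[of a x] by simp
    then show "a = 0" by (transfer, auto)
  next
    assume "a = 0"
    moreover have "norm (0 :: ('a, 'b) bfield) = 0" by transfer simp
    ultimately show "norm a = 0" by simp
  qed
  show "norm (a + b) \<le> norm a + norm b"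
    by (rule norm_bfield_bound)
       (metis (mono_tags) add_mono norm_at_pt norm_triangle_le plus_bfield.rep_eq)
  show "norm (r *\<^sub>R a) = \<bar>r\<bar> * norm a"
  proof (rule antisym)
    show "norm (r *\<^sub>R a) \<le> \<bar>r\<bar> * norm a"
      by (rule norm_bfield_bound)
         (simp add: scaleR_bfield.rep_eq mult_left_mono norm_at_pt)
    show "\<bar>r\<bar> * norm a \<le> norm (r *\<^sub>R a)"
    proof (cases "r = 0")
      case False
      have "norm a \<le> norm (r *\<^sub>R a) / \<bar>r\<bar>"
      proof (rule norm_bfield_bound)
        fix x
        have "\<bar>r\<bar> * norm (at_pt a x) \<le> norm (r *\<^sub>R a)"
          using norm_at_pt[of "r *\<^sub>R a" x] by (simp add: scaleR_bfield.rep_eq)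
        then show "norm (at_pt a x) \<le> norm (r *\<^sub>R a) / \<bar>r\<bar>"
          using False by (simp add: field_simps)
      qed
      then show ?thesis using False by (simp add: field_simps)
    qed (simp add: nonneg)
  qed
qed

end

instantiation bfield :: (type, cstar_algebra) cbanach
begin

lift_definition scaleC_bfield :: "complex \<Rightarrow> ('a, 'b) bfield \<Rightarrow> ('a, 'b) bfield"
  is "\<lambda>c f x. c *\<^sub>C f x"
proof -
  fix c :: complex and f :: "'a \<Rightarrow> 'b" assume "bounded (range f)"
  from bounded_linear_image[OF this bounded_linear_scaleC[of c]]
  show "bounded (range (\<lambda>x. c *\<^sub>C f x))" by (simp add: image_image)
qed

instance
proof
  fix a b :: "('a, 'b) bfield" and r :: real and z w :: complex
  show nC: "norm (z *\<^sub>C a) = cmod z * norm a"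
  proof (rule antisym)
    show "norm (z *\<^sub>C a) \<le> cmod z * norm a"
      by (rule norm_bfield_bound)
         (simp add: scaleC_bfield.rep_eq norm_scaleC mult_left_mono norm_at_pt)
    show "cmod z * norm a \<le> norm (z *\<^sub>C a)"
    proof (cases "z = 0")
      case False
      have "norm a \<le> norm (z *\<^sub>C a) / cmod z"
      proof (rule norm_bfield_bound)
        fix x
        have "cmod z * norm (at_pt a x) \<le> norm (z *\<^sub>C a)"
          using norm_at_pt[of "z *\<^sub>C a" x] by (simp add: scaleC_bfield.rep_eq norm_scaleC)
        then show "norm (at_pt a x) \<le> norm (z *\<^sub>C a) / cmod z"
          using False by (simp add: field_simps)
      qed
      then show ?thesis using False by (simp add: field_simps)
    qed simp
  qed
  show "complex_of_real r *\<^sub>C a = r *\<^sub>R a"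
    by transfer (simp add: scaleC_of_real)
  show "z *\<^sub>C (a + b) = z *\<^sub>C a + z *\<^sub>C b" by transfer (simp add: scaleC_add_right)
  show "(z + w) *\<^sub>C a = z *\<^sub>C a + w *\<^sub>C a" by transfer (simp add: scaleC_add_left)
  show "z *\<^sub>C w *\<^sub>C a = (z * w) *\<^sub>C a" by transfer (simp add: scaleC_scaleC)
next
  fix X :: "nat \<Rightarrow> ('a, 'b) bfield"
  assume X: "Cauchy X"
  have le: "dist (at_pt f x) (at_pt g x) \<le> dist f g" for f g :: "('a, 'b) bfield" and x
    using norm_at_pt[of "f - g" x] by (simp add: dist_norm dist_bfield_def minus_bfield.rep_eq)
  have "Cauchy (\<lambda>n. at_pt (X n) x)" for x
    using X le unfolding Cauchy_def by (meson le_less_trans)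
  then have "\<exists>l. (\<lambda>n. at_pt (X n) x) \<longlonglongrightarrow> l" for x
    using Cauchy_convergent convergent_def by blast
  then obtain L where L: "\<And>x. (\<lambda>n. at_pt (X n) x) \<longlonglongrightarrow> L x" by metis
  have unif: "\<exists>M. \<forall>m\<ge>M. \<forall>x. norm (at_pt (X m) x - L x) \<le> e" if e: "e > 0" for e
  proof -
    obtain M where M: "\<And>m n. m \<ge> M \<Longrightarrow> n \<ge> M \<Longrightarrow> dist (X m) (X n) < e"
      using X e unfolding Cauchy_def by blast
    have "norm (at_pt (X m) x - L x) \<le> e" if m: "m \<ge> M" for m x
    proof (rule LIMSEQ_le_const2)
      show "(\<lambda>n. norm (at_pt (X m) x - at_pt (X n) x)) \<longlonglongrightarrow> norm (at_pt (X m) x - L x)"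
        by (intro tendsto_intros L)
      show "\<exists>N. \<forall>n\<ge>N. norm (at_pt (X m) x - at_pt (X n) x) \<le> e"
        using M[OF m] le[of "X m" x] unfolding dist_norm
        by (intro exI[of _ M]) (metis (no_types) dist_norm le less_le_not_le order_trans)
    qed
    then show ?thesis by blast
  qed
  obtain M where M: "\<forall>x. norm (at_pt (X M) x - L x) \<le> 1" using unif[of 1] by auto
  have "norm (L x) \<le> norm (X M) + 1" for x
    using M[rule_format, of x] norm_at_pt[of "X M" x]
      norm_triangle_ineq2[of "L x" "at_pt (X M) x"] by (simp add: norm_minus_commute)
  then have "bounded (range L)" by (auto simp: bounded_iff)
  then obtain f where f: "at_pt f = L" using Abs_bfield_inverse[of L] by auto
  have "X \<longlonglongrightarrow> f"
  proof (rule metric_LIMSEQ_I)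
    fix e :: real assume e: "e > 0"
    obtain M where M: "\<forall>m\<ge>M. \<forall>x. norm (at_pt (X m) x - L x) \<le> e / 2"
      using unif[of "e / 2"] e by auto
    have "dist (X m) f < e" if "m \<ge> M" for m
    proof -
      have "norm (X m - f) \<le> e / 2"
        by (rule norm_bfield_bound) (use M that in \<open>simp add: minus_bfield.rep_eq f\<close>)
      then show ?thesis using e by (simp add: dist_bfield_def)
    qed
    then show "\<exists>M. \<forall>m\<ge>M. dist (X m) f < e" by blast
  qed
  then show "convergent X" by (auto simp: convergent_def)
qed

end

lemma norm_star: "norm (star a) = norm (a :: 'a::cstar_algebra)"
proof -
  have le: "norm a \<le> norm (star a)" for a :: 'a
  proof (cases "a = 0")
    case False
    have "norm a * norm a \<le> norm (star a) * norm a"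
      using norm_mult_ineq[of "star a" a] by (simp add: cstar_identity power2_eq_square)
    then show ?thesis using False by simp
  qed simp
  show ?thesis using le[of a] le[of "star a"] by (simp add: star_star)
qed

instantiation bfield :: (type, cstar_algebra) cstar_algebra
begin

lift_definition times_bfield :: "('a, 'b) bfield \<Rightarrow> ('a, 'b) bfield \<Rightarrow> ('a, 'b) bfield"
  is "\<lambda>f g x. f x * g x"
proof -
  fix f g :: "'a \<Rightarrow> 'b" assume "bounded (range f)" "bounded (range g)"
  then obtain B C where "B \<ge> 0" "C \<ge> 0" "\<And>x. norm (f x) \<le> B" "\<And>x. norm (g x) \<le> C"
    by (metis bfield_bound)
  then have "norm (f x * g x) \<le> B * C" for x
    using norm_mult_ineq[of "f x" "g x"] by (meson mult_mono norm_ge_zero order_trans)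
  then show "bounded (range (\<lambda>x. f x * g x))" by (auto simp: bounded_iff)
qed

lift_definition star_bfield :: "('a, 'b) bfield \<Rightarrow> ('a, 'b) bfield" is "\<lambda>f x. star (f x)"
  by (simp add: bounded_iff norm_star)

instance
proof
  fix a b c :: "('a, 'b) bfield" and r :: real and z :: complex
  show "a * b * c = a * (b * c)" by transfer (simp add: mult.assoc)
  show "(a + b) * c = a * c + b * c" by transfer (simp add: distrib_right)
  show "a * (b + c) = a * b + a * c" by transfer (simp add: distrib_left)
  show "r *\<^sub>R a * b = r *\<^sub>R (a * b)" by transfer simp
  show "a * r *\<^sub>R b = r *\<^sub>R (a * b)" by transfer simp
  show mult: "norm (a * b) \<le> norm a * norm b" for a b :: "('a, 'b) bfield"
    by (rule norm_bfield_bound)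
       (metis (mono_tags) mult_mono norm_at_pt norm_ge_zero norm_mult_ineq order_trans times_bfield.rep_eq)
  show "z *\<^sub>C a * b = z *\<^sub>C (a * b)" by transfer (simp add: mult_scaleC_left)
  show "a * z *\<^sub>C b = z *\<^sub>C (a * b)" by transfer (simp add: mult_scaleC_right)
  show "star (star a) = a" by transfer (simp add: star_star)
  show "star (a + b) = star a + star b" by transfer (simp add: star_add)
  show "star (z *\<^sub>C a) = cnj z *\<^sub>C star a" by transfer (simp add: star_scaleC)
  show "star (a * b) = star b * star a" by transfer (simp add: star_mult)
  show "norm (star a * a) = (norm a)\<^sup>2"
  proof (rule antisym)
    have "norm (star a) \<le> norm a"
      by (rule norm_bfield_bound) (simp add: star_bfield.rep_eq norm_star norm_at_pt)
    then show "norm (star a * a) \<le> (norm a)\<^sup>2"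
      using mult[of "star a" a] mult_right_mono[of "norm (star a)" "norm a" "norm a"]
      by (simp add: power2_eq_square)
    have "norm a \<le> sqrt (norm (star a * a))"
    proof (rule norm_bfield_bound)
      fix x
      have "(norm (at_pt a x))\<^sup>2 \<le> norm (star a * a)"
        using norm_at_pt[of "star a * a" x]
        by (simp add: times_bfield.rep_eq star_bfield.rep_eq cstar_identity)
      then show "norm (at_pt a x) \<le> sqrt (norm (star a * a))" by (rule real_le_rsqrt)
    qed
    then have "(norm a)\<^sup>2 \<le> (sqrt (norm (star a * a)))\<^sup>2" by (intro power_mono) auto
    then show "(norm a)\<^sup>2 \<le> norm (star a * a)" by simp
  qed
qed

end


subsection \<open>Hilbert space direct sums\<close>

instantiation complex :: chilbert_space
begin

definition scaleC_complex :: "complex \<Rightarrow> complex \<Rightarrow> complex" where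
  "scaleC_complex c x = c * x"

definition cinner_complex :: "complex \<Rightarrow> complex \<Rightarrow> complex" where
  "cinner_complex x y = cnj x * y"

instance
proof
  fix x y z c d :: complex and r :: real
  show "cinner x x = complex_of_real ((norm x)\<^sup>2)"
    by (simp add: cinner_complex_def complex_norm_square mult.commute del: of_real_power)
qed (simp_all add: scaleC_complex_def cinner_complex_def algebra_simps scaleR_conv_of_real norm_mult)

end

typedef (overloaded) ('i, 'h::chilbert_space) hsum =
    "{f :: 'i \<Rightarrow> 'h. (\<lambda>i. (norm (f i))\<^sup>2) summable_on UNIV}"
  morphisms coord Abs_hsum
  by (rule exI[of _ "\<lambda>_. 0"]) simp

setup_lifting type_definition_hsum

lemma l2_scale:
  fixes f :: "'i \<Rightarrow> 'h::real_normed_vector"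
  assumes "(\<lambda>i. (norm (f i))\<^sup>2) summable_on UNIV" "\<And>i. norm (g i) = B * norm (f i)"
  shows "(\<lambda>i. (norm (g i))\<^sup>2) summable_on UNIV"
  using summable_on_cmult_right[OF assms(1), of "B\<^sup>2"] by (simp add: assms(2) power_mult_distrib)

lemma l2_add:
  fixes f g :: "'i \<Rightarrow> 'h::real_normed_vector"
  assumes "(\<lambda>i. (norm (f i))\<^sup>2) summable_on UNIV" "(\<lambda>i. (norm (g i))\<^sup>2) summable_on UNIV"
  shows "(\<lambda>i. (norm (f i + g i))\<^sup>2) summable_on UNIV"
proof (rule summable_on_comparison_test)
  show "(\<lambda>i. 2 * (norm (f i))\<^sup>2 + 2 * (norm (g i))\<^sup>2) summable_on UNIV"
    by (intro summable_on_add summable_on_cmult_right assms)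
  fix i
  have "(norm (f i + g i))\<^sup>2 \<le> (norm (f i) + norm (g i))\<^sup>2"
    by (intro power_mono norm_triangle_ineq) simp
  also have "\<dots> \<le> 2 * (norm (f i))\<^sup>2 + 2 * (norm (g i))\<^sup>2"
    using sum_squares_bound[of "norm (f i)" "norm (g i)"] by (simp add: power2_sum)
  finally show "(norm (f i + g i))\<^sup>2 \<le> 2 * (norm (f i))\<^sup>2 + 2 * (norm (g i))\<^sup>2" .
qed simp

lemma l2_finite_bound:
  fixes f :: "'i \<Rightarrow> 'h::real_normed_vector"
  assumes "\<And>F. finite F \<Longrightarrow> L2_set (\<lambda>i. norm (f i)) F \<le> B"
  shows "(\<lambda>i. (norm (f i))\<^sup>2) summable_on UNIV"
    and "sqrt (\<Sum>\<^sub>\<infinity>i. (norm (f i))\<^sup>2) \<le> B"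
proof -
  have B: "B \<ge> 0" using assms[of "{}"] by simp
  have fin: "(\<Sum>i\<in>F. (norm (f i))\<^sup>2) \<le> B\<^sup>2" if "finite F" for F
    using assms[OF that] B unfolding L2_set_def by (meson real_sqrt_le_iff sqrt_le_D)
  show *: "(\<lambda>i. (norm (f i))\<^sup>2) summable_on UNIV"
    by (rule nonneg_bdd_above_summable_on) (auto intro!: bdd_aboveI2[where M = "B\<^sup>2"] fin)
  have "(\<Sum>\<^sub>\<infinity>i. (norm (f i))\<^sup>2) \<le> B\<^sup>2"
    by (rule infsum_le_finite_sums[OF *]) (rule fin)
  then show "sqrt (\<Sum>\<^sub>\<infinity>i. (norm (f i))\<^sup>2) \<le> B"
    using B by (simp add: real_le_lsqrt)
qed

instantiation hsum :: (type, chilbert_space) real_normed_vector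
begin

lift_definition zero_hsum :: "('a, 'b) hsum" is "\<lambda>_. 0"
  by simp

lift_definition plus_hsum :: "('a, 'b) hsum \<Rightarrow> ('a, 'b) hsum \<Rightarrow> ('a, 'b) hsum"
  is "\<lambda>f g i. f i + g i"
  by (rule l2_add)

lift_definition uminus_hsum :: "('a, 'b) hsum \<Rightarrow> ('a, 'b) hsum" is "\<lambda>f i. - f i"
  by simp

definition minus_hsum :: "('a, 'b) hsum \<Rightarrow> ('a, 'b) hsum \<Rightarrow> ('a, 'b) hsum" where
  "minus_hsum f g = f + - g"

lift_definition scaleR_hsum :: "real \<Rightarrow> ('a, 'b) hsum \<Rightarrow> ('a, 'b) hsum" is "\<lambda>r f i. r *\<^sub>R f i"
  by (erule l2_scale) (rule norm_scaleR)

lift_definition norm_hsum :: "('a, 'b) hsum \<Rightarrow> real" is "\<lambda>f. sqrt (\<Sum>\<^sub>\<infinity>i. (norm (f i))\<^sup>2)" .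

definition dist_hsum :: "('a, 'b) hsum \<Rightarrow> ('a, 'b) hsum \<Rightarrow> real" where
  "dist_hsum f g = norm (f - g)"

definition sgn_hsum :: "('a, 'b) hsum \<Rightarrow> ('a, 'b) hsum" where
  "sgn_hsum f = scaleR (inverse (norm f)) f"

definition uniformity_hsum :: "(('a, 'b) hsum \<times> ('a, 'b) hsum) filter" where
  "uniformity_hsum = (INF e\<in>{0<..}. principal {(x, y). dist x y < e})"

definition open_hsum :: "('a, 'b) hsum set \<Rightarrow> bool" where
  "open_hsum U = (\<forall>x\<in>U. \<forall>\<^sub>F (x', y) in uniformity. x' = x \<longrightarrow> y \<in> U)"

lemma coord_minus: "coord (f - g) i = coord f i - coord g i" for f g :: "('a, 'b) hsum"
  by (simp add: minus_hsum_def plus_hsum.rep_eq uminus_hsum.rep_eq)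

lemma L2_set_coord_le: "finite F \<Longrightarrow> L2_set (\<lambda>i. norm (coord f i)) F \<le> norm f"
  for f :: "('a, 'b) hsum"
proof (transfer fixing: F)
  fix f :: "'a \<Rightarrow> 'b"
  assume "finite F" "(\<lambda>i. (norm (f i))\<^sup>2) summable_on UNIV"
  then have "(\<Sum>i\<in>F. (norm (f i))\<^sup>2) \<le> (\<Sum>\<^sub>\<infinity>i. (norm (f i))\<^sup>2)"
    by (intro finite_sum_le_infsum) auto
  then show "L2_set (\<lambda>i. norm (f i)) F \<le> sqrt (\<Sum>\<^sub>\<infinity>i. (norm (f i))\<^sup>2)"
    unfolding L2_set_def by simp
qed

lemma norm_coord_le: "norm (coord f i) \<le> norm f" for f :: "('a, 'b) hsum"
  using L2_set_coord_le[of "{i}" f] by simp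

lemma norm_hsum_bound:
  "(\<And>F. finite F \<Longrightarrow> L2_set (\<lambda>i. norm (coord f i)) F \<le> B) \<Longrightarrow> norm f \<le> B" for f :: "('a, 'b) hsum"
  unfolding norm_hsum.rep_eq by (rule l2_finite_bound(2))

instance
proof
  fix a b c :: "('a, 'b) hsum" and r s :: real
  show "a + b + c = a + (b + c)" by transfer (simp add: add.assoc)
  show "a + b = b + a" by transfer (simp add: add.commute)
  show "0 + a = a" by transfer simp
  show "- a + a = 0" by transfer simp
  show "a - b = a + - b" by (rule minus_hsum_def)
  show "r *\<^sub>R (a + b) = r *\<^sub>R a + r *\<^sub>R b" by transfer (simp add: scaleR_add_right)
  show "(r + s) *\<^sub>R a = r *\<^sub>R a + s *\<^sub>R a" by transfer (simp add: scaleR_add_left)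
  show "r *\<^sub>R s *\<^sub>R a = (r * s) *\<^sub>R a" by transfer simp
  show "1 *\<^sub>R a = a" by transfer simp
  show "dist a b = norm (a - b)" by (rule dist_hsum_def)
  show "sgn a = scaleR (inverse (norm a)) a" by (rule sgn_hsum_def)
  show "uniformity = (INF e\<in>{0<..}. principal {(x, y :: ('a, 'b) hsum). dist x y < e})"
    by (rule uniformity_hsum_def)
  show "open U = (\<forall>x\<in>U. \<forall>\<^sub>F (x', y) in uniformity. x' = x \<longrightarrow> y \<in> U)"
    for U :: "('a, 'b) hsum set"
    by (rule open_hsum_def)
  show "(norm a = 0) = (a = 0)"
  proof
    assume "norm a = 0"
    then have "coord a i = 0" for i using norm_coord_le[of a i] by simp
    then show "a = 0" by (transfer, auto)
  next
    assume "a = 0"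
    moreover have "norm (0 :: ('a, 'b) hsum) = 0" by transfer simp
    ultimately show "norm a = 0" by simp
  qed
  show "norm (a + b) \<le> norm a + norm b"
  proof (rule norm_hsum_bound)
    fix F :: "'a set" assume F: "finite F"
    have "L2_set (\<lambda>i. norm (coord (a + b) i)) F \<le>
        L2_set (\<lambda>i. norm (coord a i) + norm (coord b i)) F"
      by (intro L2_set_mono) (simp_all add: plus_hsum.rep_eq norm_triangle_ineq)
    also have "\<dots> \<le> L2_set (\<lambda>i. norm (coord a i)) F + L2_set (\<lambda>i. norm (coord b i)) F"
      by (rule L2_set_triangle_ineq)
    also have "\<dots> \<le> norm a + norm b" by (intro add_mono L2_set_coord_le F)
    finally show "L2_set (\<lambda>i. norm (coord (a + b) i)) F \<le> norm a + norm b" .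
  qed
  show "norm (r *\<^sub>R a) = \<bar>r\<bar> * norm a"
    by (simp add: norm_hsum.rep_eq scaleR_hsum.rep_eq power_mult_distrib infsum_cmult_right'
        real_sqrt_mult)
qed

end

lemma l2_cinner_summable:
  fixes f g :: "'i \<Rightarrow> 'h::chilbert_space"
  assumes "(\<lambda>i. (norm (f i))\<^sup>2) summable_on UNIV" "(\<lambda>i. (norm (g i))\<^sup>2) summable_on UNIV"
  shows "(\<lambda>i. cinner (f i) (g i)) summable_on UNIV"
proof (rule abs_summable_summable, rule summable_on_comparison_test)
  show "(\<lambda>i. (norm (f i))\<^sup>2 + (norm (g i))\<^sup>2) summable_on UNIV"
    by (intro summable_on_add assms)
  fix i
  have "norm (f i) * norm (g i) \<le> (norm (f i))\<^sup>2 + (norm (g i))\<^sup>2"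
    using sum_squares_bound[of "norm (f i)" "norm (g i)"]
      mult_nonneg_nonneg[of "norm (f i)" "norm (g i)"] by (simp del: mult_nonneg_nonneg)
  then show "norm (cinner (f i) (g i)) \<le> (norm (f i))\<^sup>2 + (norm (g i))\<^sup>2"
    using cinner_Cauchy_Schwarz order_trans by blast
qed simp

instantiation hsum :: (type, chilbert_space) chilbert_space
begin

lift_definition scaleC_hsum :: "complex \<Rightarrow> ('a, 'b) hsum \<Rightarrow> ('a, 'b) hsum" is "\<lambda>c f i. c *\<^sub>C f i"
  by (erule l2_scale) (rule norm_scaleC)

lift_definition cinner_hsum :: "('a, 'b) hsum \<Rightarrow> ('a, 'b) hsum \<Rightarrow> complex"
  is "\<lambda>f g. \<Sum>\<^sub>\<infinity>i. cinner (f i) (g i)" .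

instance
proof
  fix a b c :: "('a, 'b) hsum" and r :: real and z w :: complex
  show "z *\<^sub>C (a + b) = z *\<^sub>C a + z *\<^sub>C b" by transfer (simp add: scaleC_add_right)
  show "(z + w) *\<^sub>C a = z *\<^sub>C a + w *\<^sub>C a" by transfer (simp add: scaleC_add_left)
  show "z *\<^sub>C w *\<^sub>C a = (z * w) *\<^sub>C a" by transfer (simp add: scaleC_scaleC)
  show "complex_of_real r *\<^sub>C a = r *\<^sub>R a" by transfer (simp add: scaleC_of_real)
  show "norm (z *\<^sub>C a) = cmod z * norm a"
    by (simp add: norm_hsum.rep_eq scaleC_hsum.rep_eq norm_scaleC power_mult_distrib
        infsum_cmult_right' real_sqrt_mult)
  show "cinner a b = cnj (cinner b a)"
    by transfer (simp flip: infsum_cnj cinner_commute)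
  show "cinner a (b + c) = cinner a b + cinner a c"
    by transfer (simp add: cinner_add_right infsum_add l2_cinner_summable)
  show "cinner a (z *\<^sub>C b) = z * cinner a b"
    by transfer (simp add: cinner_scaleC_right infsum_cmult_right')
  show "cinner a a = complex_of_real ((norm a)\<^sup>2)"
  proof transfer
    fix f :: "'a \<Rightarrow> 'b" assume "(\<lambda>i. (norm (f i))\<^sup>2) summable_on UNIV"
    then have "((\<lambda>i. complex_of_real ((norm (f i))\<^sup>2)) has_sum
        complex_of_real (\<Sum>\<^sub>\<infinity>i. (norm (f i))\<^sup>2)) UNIV"
      by (intro has_sum_bounded_linear[OF bounded_linear_of_real] has_sum_infsum)
    then show "(\<Sum>\<^sub>\<infinity>i. cinner (f i) (f i)) =
        complex_of_real ((sqrt (\<Sum>\<^sub>\<infinity>i. (norm (f i))\<^sup>2))\<^sup>2)"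
      by (simp add: cinner_self infsum_nonneg infsumI del: of_real_power)
  qed
next
  fix X :: "nat \<Rightarrow> ('a, 'b) hsum"
  assume X: "Cauchy X"
  have le: "dist (coord f i) (coord g i) \<le> dist f g" for f g :: "('a, 'b) hsum" and i
    using norm_coord_le[of "f - g" i] by (simp add: dist_norm coord_minus)
  have "Cauchy (\<lambda>n. coord (X n) i)" for i
    using X le unfolding Cauchy_def by (meson le_less_trans)
  then have "\<exists>l. (\<lambda>n. coord (X n) i) \<longlonglongrightarrow> l" for i
    using Cauchy_convergent convergent_def by blast
  then obtain L where L: "\<And>i. (\<lambda>n. coord (X n) i) \<longlonglongrightarrow> L i" by metis
  have unif: "\<exists>M. \<forall>m\<ge>M. \<forall>F. finite F \<longrightarrow> L2_set (\<lambda>i. norm (coord (X m) i - L i)) F \<le> e"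
    if e: "e > 0" for e
  proof -
    obtain M where M: "\<And>m n. m \<ge> M \<Longrightarrow> n \<ge> M \<Longrightarrow> dist (X m) (X n) < e"
      using X e unfolding Cauchy_def by blast
    have "L2_set (\<lambda>i. norm (coord (X m) i - L i)) F \<le> e" if m: "m \<ge> M" and F: "finite F" for m F
    proof (rule LIMSEQ_le_const2)
      show "(\<lambda>n. L2_set (\<lambda>i. norm (coord (X m) i - coord (X n) i)) F)
          \<longlonglongrightarrow> L2_set (\<lambda>i. norm (coord (X m) i - L i)) F"
        unfolding L2_set_def by (intro tendsto_intros L)
      have "L2_set (\<lambda>i. norm (coord (X m) i - coord (X n) i)) F \<le> e" if "n \<ge> M" for n
        using L2_set_coord_le[OF F, of "X m - X n"] M[OF m that]
        by (simp add: coord_minus dist_norm)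
      then show "\<exists>N. \<forall>n\<ge>N. L2_set (\<lambda>i. norm (coord (X m) i - coord (X n) i)) F \<le> e"
        by blast
    qed
    then show ?thesis by blast
  qed
  obtain M where M: "\<And>F. finite F \<Longrightarrow> L2_set (\<lambda>i. norm (coord (X M) i - L i)) F \<le> 1"
    using unif[of 1] by auto
  have "(\<lambda>i. (norm (coord (X M) i - L i))\<^sup>2) summable_on UNIV"
    by (rule l2_finite_bound(1)[OF M])
  then have "(\<lambda>i. (norm (L i - coord (X M) i))\<^sup>2) summable_on UNIV"
    by (simp add: norm_minus_commute)
  moreover have "(\<lambda>i. (norm (coord (X M) i))\<^sup>2) summable_on UNIV"
    using coord[of "X M"] by simp
  ultimately have "(\<lambda>i. (norm (L i - coord (X M) i + coord (X M) i))\<^sup>2) summable_on UNIV"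
    by (rule l2_add)
  then obtain f where f: "coord f = L" using Abs_hsum_inverse[of L] by auto
  have "X \<longlonglongrightarrow> f"
  proof (rule metric_LIMSEQ_I)
    fix e :: real assume e: "e > 0"
    obtain M where M: "\<And>m F. m \<ge> M \<Longrightarrow> finite F \<Longrightarrow> L2_set (\<lambda>i. norm (coord (X m) i - L i)) F \<le> e / 2"
      using unif[of "e / 2"] e by auto
    have "dist (X m) f < e" if "m \<ge> M" for m
    proof -
      have "norm (X m - f) \<le> e / 2"
        by (rule norm_hsum_bound) (use M that in \<open>simp add: coord_minus f\<close>)
      then show ?thesis using e by (simp add: dist_norm)
    qed
    then show "\<exists>M. \<forall>m\<ge>M. dist (X m) f < e" by blast
  qed
  then show "convergent X" by (auto simp: convergent_def)
qed

end


subsection \<open>Subalgebras, homomorphisms and representations\<close>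

definition cstar_subalgebra :: "'a::cstar_algebra set \<Rightarrow> bool" where
  "cstar_subalgebra A \<longleftrightarrow> csubspace A \<and> closed A \<and>
     (\<forall>a\<in>A. \<forall>b\<in>A. a * b \<in> A) \<and> (\<forall>a\<in>A. star a \<in> A)"

definition cstar_generated :: "'a::cstar_algebra set \<Rightarrow> 'a set" where
  "cstar_generated X = \<Inter> {A. cstar_subalgebra A \<and> X \<subseteq> A}"

text \<open>The unit of a subalgebra; it may differ from a unit of the ambient algebra.\<close>

definition alg_unit :: "'a::cstar_algebra set \<Rightarrow> 'a" where
  "alg_unit A = (THE e. e \<in> A \<and> (\<forall>a\<in>A. e * a = a \<and> a * e = a))"

definition unital_star_hom ::
    "'a::cstar_algebra set \<Rightarrow> 'b::cstar_algebra set \<Rightarrow> ('a \<Rightarrow> 'b) \<Rightarrow> bool" where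
  "unital_star_hom A B f \<longleftrightarrow>
     (\<forall>a\<in>A. f a \<in> B) \<and>
     (\<forall>a\<in>A. \<forall>b\<in>A. f (a + b) = f a + f b) \<and>
     (\<forall>c. \<forall>a\<in>A. f (c *\<^sub>C a) = c *\<^sub>C f a) \<and>
     (\<forall>a\<in>A. \<forall>b\<in>A. f (a * b) = f a * f b) \<and>
     (\<forall>a\<in>A. f (star a) = star (f a)) \<and>
     f (alg_unit A) = alg_unit B"

text \<open>
  A Hilbert space is a closed subspace \<open>H\<close> of a type of class \<open>chilbert_space\<close>
  (possibly the whole type). The bounded operators on \<open>H\<close> are identified, via extension by zero on
  the orthogonal complement of \<open>H\<close>, with the operators on the type that map into \<open>H\<close> and vanish
  on that complement; the unit of this algebra is the orthogonal projection onto \<open>H\<close>.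
\<close>

definition bounded_ops :: "'h::chilbert_space set \<Rightarrow> 'h bop set" where
  "bounded_ops H =
     {T. (\<forall>x. app T x \<in> H) \<and> (\<forall>x. (\<forall>y\<in>H. cinner y x = 0) \<longrightarrow> app T x = 0)}"

definition representation ::
    "'a::cstar_algebra set \<Rightarrow> 'h::chilbert_space set \<Rightarrow> ('a \<Rightarrow> 'h bop) \<Rightarrow> bool" where
  "representation A H \<pi> \<longleftrightarrow> csubspace H \<and> closed H \<and> unital_star_hom A (bounded_ops H) \<pi>"

definition unitarily_equivalent ::
    "'a::cstar_algebra set \<Rightarrow> 'h::chilbert_space set \<Rightarrow> ('a \<Rightarrow> 'h bop) \<Rightarrow>
     'k::chilbert_space set \<Rightarrow> ('a \<Rightarrow> 'k bop) \<Rightarrow> bool" where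
  "unitarily_equivalent A H \<pi> H' \<pi>' \<longleftrightarrow> (\<exists>U. U ` H = H' \<and>
     (\<forall>x\<in>H. \<forall>y\<in>H. U (x + y) = U x + U y) \<and>
     (\<forall>c. \<forall>x\<in>H. U (c *\<^sub>C x) = c *\<^sub>C U x) \<and>
     (\<forall>x\<in>H. \<forall>y\<in>H. cinner (U x) (U y) = cinner x y) \<and>
     (\<forall>a\<in>A. \<forall>x\<in>H. U (app (\<pi> a) x) = app (\<pi>' a) (U x)))"

definition dsum_space :: "'i set \<Rightarrow> ('i \<Rightarrow> 'h::chilbert_space set) \<Rightarrow> ('i, 'h) hsum set" where
  "dsum_space I H = {f. (\<forall>i\<in>I. coord f i \<in> H i) \<and> (\<forall>i. i \<notin> I \<longrightarrow> coord f i = 0)}"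

definition dsum_rep ::
    "'i set \<Rightarrow> ('i \<Rightarrow> 'a \<Rightarrow> 'h::chilbert_space bop) \<Rightarrow> 'a \<Rightarrow> ('i, 'h) hsum bop" where
  "dsum_rep I \<rho> a = (THE C. \<forall>f i. coord (app C f) i = (if i \<in> I then app (\<rho> i a) (coord f i) else 0))"


subsection \<open>Tensor products\<close>

definition closed_cspan :: "'a::cbanach set \<Rightarrow> 'a set" where
  "closed_cspan X = \<Inter> {V. csubspace V \<and> closed V \<and> X \<subseteq> V}"

text \<open>\<open>T\<close> together with the map \<open>t\<close> of simple tensors is a Hilbert space tensor product of \<open>H\<^sub>1\<close> and \<open>H\<^sub>2\<close>;
  it is determined up to a unique unitary that respects simple tensors.\<close>

definition hilbert_tensor ::
    "'h::chilbert_space set \<Rightarrow> 'k::chilbert_space set \<Rightarrow> 't::chilbert_space set \<Rightarrow>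
     ('h \<Rightarrow> 'k \<Rightarrow> 't) \<Rightarrow> bool" where
  "hilbert_tensor H\<^sub>1 H\<^sub>2 T t \<longleftrightarrow>
     (\<forall>x\<in>H\<^sub>1. \<forall>x'\<in>H\<^sub>1. \<forall>y\<in>H\<^sub>2. t (x + x') y = t x y + t x' y) \<and>
     (\<forall>x\<in>H\<^sub>1. \<forall>y\<in>H\<^sub>2. \<forall>y'\<in>H\<^sub>2. t x (y + y') = t x y + t x y') \<and>
     (\<forall>c. \<forall>x\<in>H\<^sub>1. \<forall>y\<in>H\<^sub>2. t (c *\<^sub>C x) y = c *\<^sub>C t x y \<and> t x (c *\<^sub>C y) = c *\<^sub>C t x y) \<and>
     (\<forall>x\<in>H\<^sub>1. \<forall>x'\<in>H\<^sub>1. \<forall>y\<in>H\<^sub>2. \<forall>y'\<in>H\<^sub>2. cinner (t x y) (t x' y') = cinner x x' * cinner y y') \<and>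
     T = closed_cspan {t x y | x y. x \<in> H\<^sub>1 \<and> y \<in> H\<^sub>2}"

type_synonym 'i ell2 = "('i, complex) hsum"

lift_definition ell2_tensor :: "'i ell2 \<Rightarrow> 'j ell2 \<Rightarrow> ('i \<times> 'j) ell2"
  is "\<lambda>f g (i, j). f i * g j"
proof -
  fix f :: "'i \<Rightarrow> complex" and g :: "'j \<Rightarrow> complex"
  assume f: "(\<lambda>i. (cmod (f i))\<^sup>2) summable_on UNIV" and g: "(\<lambda>j. (cmod (g j))\<^sup>2) summable_on UNIV"
  have "(\<lambda>(i, j). (cmod (f i))\<^sup>2 * (cmod (g j))\<^sup>2) summable_on UNIV \<times> UNIV"
    by (rule summable_on_SigmaI[where g = "\<lambda>i. (cmod (f i))\<^sup>2 * (\<Sum>\<^sub>\<infinity>j. (cmod (g j))\<^sup>2)"])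
       (auto intro!: has_sum_cmult_right has_sum_infsum g summable_on_cmult_left f)
  then show "(\<lambda>p. (cmod (case p of (i, j) \<Rightarrow> f i * g j))\<^sup>2) summable_on UNIV"
    by (simp add: case_prod_unfold norm_mult power_mult_distrib)
qed

definition op_tensor :: "'i ell2 bop \<Rightarrow> 'j ell2 bop \<Rightarrow> ('i \<times> 'j) ell2 bop" where
  "op_tensor A B = (THE C. \<forall>x y. app C (ell2_tensor x y) = ell2_tensor (app A x) (app B y))"

text \<open>
  Algebras of bounded fields \<open>X \<rightarrow> B(\<ell>\<^sup>2)\<close> act faithfully on the direct sum over \<open>X\<close>
  of copies of \<open>\<ell>\<^sup>2\<close>, so the following is the spatial tensor product of C*-algebras
  (for the nuclear algebras considered below, the only C*-tensor product).
\<close>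

definition field_tensor ::
    "('x, 'i ell2 bop) bfield \<Rightarrow> ('y, 'j ell2 bop) bfield \<Rightarrow> ('x \<times> 'y, ('i \<times> 'j) ell2 bop) bfield" where
  "field_tensor a b = Abs_bfield (\<lambda>(x, y). op_tensor (at_pt a x) (at_pt b y))"

definition cstar_tensor ::
    "('x, 'i ell2 bop) bfield set \<Rightarrow> ('y, 'j ell2 bop) bfield set \<Rightarrow>
     ('x \<times> 'y, ('i \<times> 'j) ell2 bop) bfield set" where
  "cstar_tensor A B = closed_cspan {field_tensor a b | a b. a \<in> A \<and> b \<in> B}"

text \<open>\<open>\<pi>\<close> is the representation \<open>\<pi>\<^sub>1 \<otimes> \<pi>\<^sub>2\<close> of \<open>A \<otimes> B\<close> on the tensor product \<open>(T, t)\<close> of \<open>H\<^sub>1\<close> and \<open>H\<^sub>2\<close>.\<close>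

definition tensor_rep ::
    "('x, 'i ell2 bop) bfield set \<Rightarrow> ('y, 'j ell2 bop) bfield set \<Rightarrow>
     'h::chilbert_space set \<Rightarrow> (('x, 'i ell2 bop) bfield \<Rightarrow> 'h bop) \<Rightarrow>
     'k::chilbert_space set \<Rightarrow> (('y, 'j ell2 bop) bfield \<Rightarrow> 'k bop) \<Rightarrow>
     't::chilbert_space set \<Rightarrow> ('h \<Rightarrow> 'k \<Rightarrow> 't) \<Rightarrow>
     (('x \<times> 'y, ('i \<times> 'j) ell2 bop) bfield \<Rightarrow> 't bop) \<Rightarrow> bool" where
  "tensor_rep A B H\<^sub>1 \<pi>\<^sub>1 H\<^sub>2 \<pi>\<^sub>2 T t \<pi> \<longleftrightarrow>
     hilbert_tensor H\<^sub>1 H\<^sub>2 T t \<and> representation (cstar_tensor A B) T \<pi> \<and>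
     (\<forall>a\<in>A. \<forall>b\<in>B. \<forall>x\<in>H\<^sub>1. \<forall>y\<in>H\<^sub>2.
        app (\<pi> (field_tensor a b)) (t x y) = t (app (\<pi>\<^sub>1 a) x) (app (\<pi>\<^sub>2 b) y))"


subsection \<open>Cuntz algebras\<close>

definition cuntz_family :: "nat \<Rightarrow> (nat \<Rightarrow> 'h::chilbert_space bop) \<Rightarrow> bool" where
  "cuntz_family N S \<longleftrightarrow>
     (\<forall>i\<in>{1..N}. \<forall>j\<in>{1..N}. star (S i) * S j = (if i = j then id_op else 0)) \<and>
     (\<Sum>i=1..N. S i * star (S i)) = id_op"

lemma norm_cuntz_family_le:
  assumes "cuntz_family N S" "i \<in> {1..N}"
  shows "norm (S i) \<le> 1"
proof -
  have "norm (id_op :: 'a bop) \<le> 1" by transfer (rule norm_blinfun_id_le)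
  moreover have "star (S i) * S i = id_op" using assms by (auto simp: cuntz_family_def)
  ultimately have "(norm (S i))\<^sup>2 \<le> 1" by (metis cstar_identity)
  then show ?thesis by (simp add: power_le_one_iff)
qed

text \<open>
  The universal C*-algebra generated by elements subject to the Cuntz relations, as the
  closed *-algebra generated by the tautological fields \<open>S \<mapsto> S\<^sub>i\<close> on the set of all realizations \<open>S\<close>
  of the relations; its norm is the supremum of the norms over all realizations. Realizations on
  the separable space \<open>\<ell>\<^sup>2(\<nat>)\<close> suffice: every realization on a Hilbert space is a direct sum of
  realizations on separable spaces, and these are infinite-dimensional or zero if \<open>N \<ge> 2\<close>.
  Fields are extended by zero to points that are not realizations.
\<close>

type_synonym cuntz_elem = "(nat \<Rightarrow> nat ell2 bop, nat ell2 bop) bfield"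

definition cuntz_gen :: "nat \<Rightarrow> nat \<Rightarrow> cuntz_elem" where
  "cuntz_gen N i = Abs_bfield (\<lambda>S. if cuntz_family N S \<and> i \<in> {1..N} then S i else 0)"

lemma at_pt_cuntz_gen:
  "at_pt (cuntz_gen N i) S = (if cuntz_family N S \<and> i \<in> {1..N} then S i else 0)"
proof -
  have "bounded (range (\<lambda>S :: nat \<Rightarrow> nat ell2 bop. if cuntz_family N S \<and> i \<in> {1..N} then S i else 0))"
    by (rule boundedI[of _ 1]) (auto simp: norm_cuntz_family_le)
  then show ?thesis
    unfolding cuntz_gen_def by (subst Abs_bfield_inverse) auto
qed

definition cuntz_algebra :: "nat \<Rightarrow> cuntz_elem set" where
  "cuntz_algebra N = cstar_generated (cuntz_gen N ` {1..N})"

definition cuntz_word :: "nat \<Rightarrow> nat list \<Rightarrow> cuntz_elem" where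
  "cuntz_word N J = foldr (\<lambda>j a. cuntz_gen N j * a) J (alg_unit (cuntz_algebra N))"

type_synonym cuntz_tensor_elem =
  "((nat \<Rightarrow> nat ell2 bop) \<times> (nat \<Rightarrow> nat ell2 bop), (nat \<times> nat) ell2 bop) bfield"

definition cuntz_embedding :: "nat \<Rightarrow> nat \<Rightarrow> (cuntz_elem \<Rightarrow> cuntz_tensor_elem) \<Rightarrow> bool" where
  "cuntz_embedding N M \<phi> \<longleftrightarrow>
     unital_star_hom (cuntz_algebra (N * M)) (cstar_tensor (cuntz_algebra N) (cuntz_algebra M)) \<phi> \<and>
     inj_on \<phi> (cuntz_algebra (N * M)) \<and>
     (\<forall>i\<in>{1..N}. \<forall>j\<in>{1..M}.
        \<phi> (cuntz_gen (N * M) (M * (i - 1) + j)) = field_tensor (cuntz_gen N i) (cuntz_gen M j))"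


subsection \<open>Multiindices and the classes of representations attached to them\<close>

text \<open>Infinite sequences are indexed from 1; their value at 0 is irrelevant.\<close>

datatype multiindex = FinIdx "nat list" | is_infinite: InfIdx "nat \<Rightarrow> nat"

fun multiindex_over :: "nat \<Rightarrow> multiindex \<Rightarrow> bool" where
  "multiindex_over N (FinIdx J) \<longleftrightarrow> J \<noteq> [] \<and> set J \<subseteq> {1..N}"
| "multiindex_over N (InfIdx J) \<longleftrightarrow> (\<forall>n\<ge>1. J n \<in> {1..N})"

definition orthonormal_family :: "'i set \<Rightarrow> ('i \<Rightarrow> 'h::chilbert_space) \<Rightarrow> bool" where
  "orthonormal_family I v \<longleftrightarrow> (\<forall>i\<in>I. \<forall>j\<in>I. cinner (v i) (v j) = (if i = j then 1 else 0))"

definition unit_cyclic_vector ::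
    "'a set \<Rightarrow> 'h::chilbert_space set \<Rightarrow> ('a \<Rightarrow> 'h bop) \<Rightarrow> 'h \<Rightarrow> bool" where
  "unit_cyclic_vector A H \<pi> \<Omega> \<longleftrightarrow> \<Omega> \<in> H \<and> norm \<Omega> = 1 \<and> closure {app (\<pi> a) \<Omega> | a. a \<in> A} = H"

fun is_P :: "nat \<Rightarrow> multiindex \<Rightarrow> 'h::chilbert_space set \<Rightarrow> (cuntz_elem \<Rightarrow> 'h bop) \<Rightarrow> bool" where
  "is_P N (FinIdx J) H \<pi> \<longleftrightarrow> representation (cuntz_algebra N) H \<pi> \<and>
     (\<exists>\<Omega>. unit_cyclic_vector (cuntz_algebra N) H \<pi> \<Omega> \<and>
       app (\<pi> (cuntz_word N J)) \<Omega> = \<Omega> \<and>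
       orthonormal_family {1..length J} (\<lambda>l. app (\<pi> (cuntz_word N (drop (l - 1) J))) \<Omega>))"
| "is_P N (InfIdx J) H \<pi> \<longleftrightarrow> representation (cuntz_algebra N) H \<pi> \<and>
     (\<exists>\<Omega>. unit_cyclic_vector (cuntz_algebra N) H \<pi> \<Omega> \<and>
       orthonormal_family {1..} (\<lambda>n. app (star (\<pi> (cuntz_word N (map J [1..<n+1])))) \<Omega>))"

definition list_dot :: "nat \<Rightarrow> nat list \<Rightarrow> nat list \<Rightarrow> nat list" where
  "list_dot M K L = map2 (\<lambda>k l. M * (k - 1) + l) K L"

definition seq_dot :: "nat \<Rightarrow> (nat \<Rightarrow> nat) \<Rightarrow> (nat \<Rightarrow> nat) \<Rightarrow> nat \<Rightarrow> nat" where
  "seq_dot M K L n = M * (K n - 1) + L n"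

definition list_power :: "nat list \<Rightarrow> nat \<Rightarrow> nat list" where
  "list_power J m = concat (replicate m J)"

definition periodic :: "nat list \<Rightarrow> nat \<Rightarrow> nat" where
  "periodic L n = L ! ((n - 1) mod length L)"

text \<open>\<open>K * L\<close>, which is only defined if \<open>K\<close> is infinite or \<open>L\<close> is finite.\<close>

fun multiindex_star :: "nat \<Rightarrow> multiindex \<Rightarrow> multiindex \<Rightarrow> multiindex" where
  "multiindex_star M (FinIdx K) (FinIdx L) =
     (let C = lcm (length K) (length L)
      in FinIdx (list_dot M (list_power K (C div length K)) (list_power L (C div length L))))"
| "multiindex_star M (InfIdx K) (FinIdx L) = InfIdx (seq_dot M K (periodic L))"
| "multiindex_star M (InfIdx K) (InfIdx L) = InfIdx (seq_dot M K L)"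
| "multiindex_star M (FinIdx K) (InfIdx L) = undefined"

fun multiindex_shift :: "multiindex \<Rightarrow> int \<Rightarrow> multiindex" where
  "multiindex_shift (FinIdx L) i = FinIdx (drop (nat (i - 1)) L @ take (nat (i - 1)) L)"
| "multiindex_shift (InfIdx L) i = InfIdx (\<lambda>j. if int j + i \<ge> 1 then L (nat (int j + i)) else 1)"

fun decomposition_index :: "multiindex \<Rightarrow> multiindex \<Rightarrow> int set" where
  "decomposition_index (FinIdx K) (FinIdx L) = {1..int (gcd (length K) (length L))}"
| "decomposition_index (InfIdx K) (FinIdx L) = {1..int (length L)}"
| "decomposition_index (InfIdx K) (InfIdx L) = UNIV"
| "decomposition_index (FinIdx K) (InfIdx L) = undefined"

end

theory Submission
  imports Defs "HOL-Number_Theory.Cong"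
begin

text \<open>
  In \<open>P\<^sub>N(J)\<close> the cyclic vector starts a sequence of unit vectors \<open>v\<^sub>n = s\<^bsub>J\<^sub>n\<^esub> v\<^bsub>n+1\<^esub>\<close>
  with \<open>\<langle>v\<^sub>m, v\<^sub>n\<rangle> = 1\<close> if \<open>m \<equiv> n\<close> modulo the length of \<open>J\<close> (\<open>m = n\<close> if \<open>J\<close> is infinite) and \<open>0\<close>
  otherwise. The vectors \<open>s\<^sub>I v\<^sub>n\<close> are total, and their Gram matrix is determined by \<open>J\<close>.
  For such sequences \<open>v\<close>, \<open>w\<close> of \<open>P\<^sub>N(K)\<close>, \<open>P\<^sub>M(L)\<close>, the sequence \<open>v\<^sub>n \<otimes> w\<^bsub>n+i\<^esub>\<close> in the tensor product
  belongs to the multiindex \<open>K * L\<^sup>(\<^sup>i\<^sup>)\<close>, up to the normalization of \<open>i\<close>. By the Chinese remainder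
  theorem the pairs \<open>(m, n)\<close> fall, up to common shifts and modulo the periods, into exactly as many classes as there
  are indices \<open>i\<close>; different classes are orthogonal, and together they are total. Total families with
  the same Gram matrix are related by a unitary, which intertwines since both families are permuted (up to zeros)
  in the same way by the generators and their adjoints. That this determines the representations, and
  that the direct sum is bounded, rests on the automatic contractivity of star-homomorphisms.
\<close>

subsection \<open>Closed subspaces and bounded operators\<close>

lemma csubspace_closed_cspan: "csubspace (closed_cspan X)"
  unfolding closed_cspan_def csubspace_def by blast

lemma closed_closed_cspan: "closed (closed_cspan X)"
  unfolding closed_cspan_def by (rule closed_Inter) blast

lemma closed_cspan_superset: "X \<subseteq> closed_cspan X"
  unfolding closed_cspan_def by blast

lemma closed_cspan_minimal: "csubspace V \<Longrightarrow> closed V \<Longrightarrow> X \<subseteq> V \<Longrightarrow> closed_cspan X \<subseteq> V"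
  unfolding closed_cspan_def by blast

lemma csubspace_0: "csubspace V \<Longrightarrow> 0 \<in> V"
  and csubspace_add: "csubspace V \<Longrightarrow> x \<in> V \<Longrightarrow> y \<in> V \<Longrightarrow> x + y \<in> V"
  and csubspace_scaleC: "csubspace V \<Longrightarrow> x \<in> V \<Longrightarrow> c *\<^sub>C x \<in> V"
  by (auto simp: csubspace_def)

lemma scaleC_minus_one: "(- 1) *\<^sub>C x = - (x :: 'a::cbanach)"
  using scaleC_of_real[of "- 1" x] by simp

lemma csubspace_diff: "csubspace V \<Longrightarrow> x \<in> V \<Longrightarrow> y \<in> V \<Longrightarrow> x - y \<in> V"
  using csubspace_add[of V x "- y"] csubspace_scaleC[of V y "- 1"] by (simp add: scaleC_minus_one)

lemma app_zero: "app T 0 = 0"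
  by (rule linear_0[OF bounded_linear.linear[OF bounded_linear_app]])

lemma app_diff: "app T (x - y) = app T x - app T y"
  by (rule linear_diff[OF bounded_linear.linear[OF bounded_linear_app]])

lemma app_zero_op: "app 0 x = 0"
  by transfer simp

lemma app_id_op: "app id_op x = x"
  by transfer simp

lemma cinner_eq_0_commute: "cinner x y = 0 \<longleftrightarrow> cinner y x = 0"
  using cinner_commute[of x y] by simp

lemma ex_bop:
  assumes "bounded_linear f" "\<And>c x. f (c *\<^sub>C x) = c *\<^sub>C f x"
  obtains T where "app T = f"
proof -
  have "app (Abs_bop (Blinfun f)) = f"
    unfolding app.rep_eq
    by (subst Abs_bop_inverse) (simp_all add: bounded_linear_Blinfun_apply assms)
  then show thesis by (rule that)
qed

lemma alg_unit_eqI: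
  assumes "e \<in> A" "\<And>a. a \<in> A \<Longrightarrow> e * a = a" "\<And>a. a \<in> A \<Longrightarrow> a * e = a"
  shows "alg_unit A = e"
  unfolding alg_unit_def using assms by (intro the_equality) auto

text \<open>The Riesz vector in \<open>H\<close> of the functional \<open>cinner x\<close> is the
  orthogonal projection of \<open>x\<close>.\<close>

lemma orthogonal_decomposition:
  assumes "csubspace H" "closed H"
  shows "\<exists>p\<in>H. \<forall>y\<in>H. cinner y (x - p) = 0"
proof -
  obtain p where p: "p \<in> H" "\<forall>y\<in>H. cinner x y = cinner p y"
    using riesz_subspace[OF assms bounded_linear_cinner_right[of x] cinner_scaleC_right] by blast
  have "cinner y (x - p) = 0" if "y \<in> H" for y
    using p(2) that by (simp add: cinner_eq_0_commute[of y] cinner_diff_left)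
  with p(1) show ?thesis by blast
qed

text \<open>Elements of \<open>bounded_ops H\<close> map into \<open>H\<close> and vanish on its
  orthogonal complement, so their products with \<open>E\<close> need to be compared on
  \<open>H\<close> only.\<close>

lemma alg_unit_bounded_ops_eqI:
  assumes H: "csubspace H" "closed H" and E: "E \<in> bounded_ops H" "\<And>x. x \<in> H \<Longrightarrow> app E x = x"
  shows "alg_unit (bounded_ops H) = E"
proof (rule alg_unit_eqI)
  fix T assume T: "T \<in> bounded_ops H"
  show "E * T = T"
    using T by (intro app_eqI) (auto simp: app_times_op E(2) bounded_ops_def)
  show "T * E = T"
  proof (rule app_eqI)
    fix x
    obtain p where p: "p \<in> H" "\<forall>y\<in>H. cinner y (x - p) = 0"
      using orthogonal_decomposition[OF H, of x] by blast
    then have "app E (x - p) = 0" "app T (x - p) = 0" using E(1) T by (auto simp: bounded_ops_def)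
    then show "app (T * E) x = app T x" using p(1) by (simp add: app_times_op app_diff E(2))
  qed
qed (rule E(1))

text \<open>\<open>alg_unit\<close> is a definite description, so a unit has to be exhibited. It is
  the orthogonal projection onto \<open>H\<close>, assembled from pointwise decompositions; its
  linearity follows from their uniqueness.\<close>

lemma app_alg_unit_bounded_ops:
  assumes H: "csubspace H" "closed H" and x: "x \<in> H"
  shows "app (alg_unit (bounded_ops H)) x = x"
proof -
  have "\<exists>r\<in>H. \<forall>y\<in>H. cinner y (x - r) = 0" for x
    by (rule orthogonal_decomposition[OF H])
  then obtain p where p: "\<And>x. p x \<in> H" "\<And>x y. y \<in> H \<Longrightarrow> cinner y (x - p x) = 0"
    by metis
  have p_unique: "p x = r" if r: "r \<in> H" "\<And>y. y \<in> H \<Longrightarrow> cinner y (x - r) = 0" for x r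
  proof -
    have d: "p x - r \<in> H" using H(1) p(1) r(1) by (rule csubspace_diff)
    have "cinner (p x - r) (p x - r) = cinner (p x - r) (x - r) - cinner (p x - r) (x - p x)"
      by (simp add: cinner_diff_right)
    then have "cinner (p x - r) (p x - r) = 0" by (simp add: p(2)[OF d] r(2)[OF d])
    then show ?thesis by (simp add: cinner_self)
  qed
  have pC: "p (c *\<^sub>C x) = c *\<^sub>C p x" for c x
    by (rule p_unique)
       (simp_all add: csubspace_scaleC H p cinner_scaleC_right flip: scaleC_diff_right)
  have bl: "bounded_linear p"
  proof (rule bounded_linear_intro[where K = 1])
    show "p (x + y) = p x + p y" for x y
      by (rule p_unique)
         (simp_all add: csubspace_add H p cinner_add_right add_diff_add)
    show "p (r *\<^sub>R x) = r *\<^sub>R p x" for r x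
      using pC[of "of_real r"] by (simp add: scaleC_of_real)
    show "norm (p x) \<le> norm x * 1" for x
    proof -
      have "(norm x)\<^sup>2 = (norm (p x))\<^sup>2 + (norm (x - p x))\<^sup>2"
        using norm_add_sq[of "p x" "x - p x"] by (simp add: p)
      then have "(norm (p x))\<^sup>2 \<le> (norm x)\<^sup>2" by simp
      then show ?thesis by simp
    qed
  qed
  obtain P where P: "app P = p" using ex_bop[OF bl pC] .
  have px: "p x = x" if "x \<in> H" for x by (rule p_unique) (auto simp: that cinner_zero_right)
  have "P \<in> bounded_ops H"
    by (auto intro!: p_unique p(1) simp: bounded_ops_def P csubspace_0 H)
  then have "alg_unit (bounded_ops H) = P"
    by (rule alg_unit_bounded_ops_eqI[OF H]) (simp add: P px)
  then show ?thesis by (simp add: P px x)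
qed


subsection \<open>Star-homomorphisms are contractive\<close>

lemma star_scaleR: "star (r *\<^sub>R a) = r *\<^sub>R star (a :: 'a::cstar_algebra)"
  using star_scaleC[of "of_real r" a] by (simp add: scaleC_of_real)

lemma bounded_linear_star: "bounded_linear (star :: 'a::cstar_algebra \<Rightarrow> 'a)"
  by (rule bounded_linear_intro[where K = 1]) (simp_all add: star_add star_scaleR norm_star)

text \<open>Formally \<open>1 - z\<close> is the square root of \<open>1 - h\<close>; it is found without a unit and without
  power series as the fixed point of \<open>z \<mapsto> (h + z\<^sup>2) / 2\<close>.\<close>

lemma cstar_sqrt:
  assumes A: "cstar_subalgebra A" and h: "h \<in> A" "star h = h" "norm h < 1"
  obtains z where "z \<in> A" "star z = z" "h + z * z = z + z"
proof -
  \<comment> \<open>\<open>r\<close> is the smaller root of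
    \<open>r * r - 2 * r + norm h = 0\<close>. Hence the iteration maps the ball of radius
    \<open>r\<close> into itself, and \<open>r < 1\<close> is its contraction constant
    there.\<close>
  define r where "r = 1 - sqrt (1 - norm h)"
  have r: "0 \<le> r" "r < 1" using h(3) by (auto simp: r_def)
  have rr: "norm h + r * r = 2 * r"
    using real_sqrt_mult_self[of "1 - norm h"] h(3) by (simp add: r_def algebra_simps)
  define Z where "Z = {z \<in> A. star z = z \<and> norm z \<le> r}"
  have half: "(1/2) *\<^sub>R x \<in> A" if "x \<in> A" for x
    using A that csubspace_scaleC[of A x "of_real (1/2)"]
    by (simp only: scaleC_of_real cstar_subalgebra_def)
  have "closed {z. star z = (z :: 'a)}"
    by (intro closed_Collect_eq continuous_intros linear_continuous_on bounded_linear_star)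
  moreover have "closed {z :: 'a. norm z \<le> r}"
    by (intro closed_Collect_le continuous_intros)
  moreover have "Z = A \<inter> {z. star z = z} \<inter> {z. norm z \<le> r}" by (auto simp: Z_def)
  ultimately have "closed Z" using A by (auto simp: cstar_subalgebra_def)
  have "\<exists>!z\<in>Z. (1/2) *\<^sub>R (h + z * z) = z"
  proof (rule Banach_fix)
    show "complete Z" using \<open>closed Z\<close> by (simp add: complete_eq_closed)
    show "Z \<noteq> {}"
      using A r linear_0[OF bounded_linear.linear[OF bounded_linear_star]]
      by (auto simp: Z_def cstar_subalgebra_def csubspace_def intro!: exI[of _ 0])
    show "(\<lambda>z. (1/2) *\<^sub>R (h + z * z)) ` Z \<subseteq> Z"
    proof (rule image_subsetI)
      fix z assume z: "z \<in> Z"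
      have "norm (h + z * z) \<le> norm h + norm z * norm z"
        by (meson norm_triangle_le add_left_mono norm_mult_ineq)
      also have "norm z * norm z \<le> r * r" using z r by (intro mult_mono) (auto simp: Z_def)
      finally have "norm ((1/2) *\<^sub>R (h + z * z)) \<le> r" using rr by simp
      moreover have "(1/2) *\<^sub>R (h + z * z) \<in> A"
        using A z h by (intro half csubspace_add) (auto simp: cstar_subalgebra_def Z_def)
      ultimately show "(1/2) *\<^sub>R (h + z * z) \<in> Z"
        using z h by (simp add: Z_def star_scaleR star_add star_mult del: scaleR_add_right)
    qed
    show "dist ((1/2) *\<^sub>R (h + x * x)) ((1/2) *\<^sub>R (h + y * y)) \<le> r * dist x y"
      if xy: "x \<in> Z" "y \<in> Z" for x y
    proof -
      have "norm (x * x - y * y) = norm (x * (x - y) + (x - y) * y)" by (simp add: algebra_simps)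
      also have "\<dots> \<le> norm x * norm (x - y) + norm (x - y) * norm y"
        by (meson norm_triangle_le add_mono norm_mult_ineq)
      also have "\<dots> \<le> r * norm (x - y) + norm (x - y) * r"
        using xy by (intro add_mono mult_mono) (auto simp: Z_def r)
      finally have "norm (x * x - y * y) \<le> 2 * (r * norm (x - y))" by simp
      moreover have "(1/2) *\<^sub>R (h + x * x) - (1/2) *\<^sub>R (h + y * y) = (1/2) *\<^sub>R (x * x - y * y)"
        by (simp add: algebra_simps)
      ultimately show "dist ((1/2) *\<^sub>R (h + x * x)) ((1/2) *\<^sub>R (h + y * y)) \<le> r * dist x y"
        by (simp add: dist_norm)
    qed
  qed (use r in auto)
  then obtain z where z: "z \<in> Z" and fix_z: "(1/2) *\<^sub>R (h + z * z) = z" by blast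
  have "h + z * z = 2 *\<^sub>R ((1/2) *\<^sub>R (h + z * z))" by simp
  also have "\<dots> = z + z" by (simp only: fix_z scaleR_2)
  finally show thesis using that[of z] z by (simp add: Z_def)
qed

lemma cstar_subalgebra_mult: "cstar_subalgebra A \<Longrightarrow> a \<in> A \<Longrightarrow> b \<in> A \<Longrightarrow> a * b \<in> A"
  and cstar_subalgebra_star: "cstar_subalgebra A \<Longrightarrow> a \<in> A \<Longrightarrow> star a \<in> A"
  and cstar_subalgebra_csubspace: "cstar_subalgebra A \<Longrightarrow> csubspace A"
  and cstar_subalgebra_closed: "cstar_subalgebra A \<Longrightarrow> closed A"
  by (auto simp: cstar_subalgebra_def)

lemma star_hom_in: "unital_star_hom A B f \<Longrightarrow> a \<in> A \<Longrightarrow> f a \<in> B"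
  and star_hom_add: "unital_star_hom A B f \<Longrightarrow> a \<in> A \<Longrightarrow> b \<in> A \<Longrightarrow> f (a + b) = f a + f b"
  and star_hom_scaleC: "unital_star_hom A B f \<Longrightarrow> a \<in> A \<Longrightarrow> f (c *\<^sub>C a) = c *\<^sub>C f a"
  and star_hom_mult: "unital_star_hom A B f \<Longrightarrow> a \<in> A \<Longrightarrow> b \<in> A \<Longrightarrow> f (a * b) = f a * f b"
  and star_hom_star: "unital_star_hom A B f \<Longrightarrow> a \<in> A \<Longrightarrow> f (star a) = star (f a)"
  and star_hom_unit: "unital_star_hom A B f \<Longrightarrow> f (alg_unit A) = alg_unit B"
  by (auto simp: unital_star_hom_def)

text \<open>If \<open>norm a < 1\<close>, then \<open>cstar_sqrt\<close> gives a self-adjoint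
  \<open>z\<close> with \<open>star a * a + z * z = z + z\<close>. Applying \<open>\<rho>\<close>
  and testing on \<open>x\<close>, the squared norms of \<open>app (\<rho> a) x\<close> and
  \<open>app (\<rho> z) x\<close> add up to \<open>2 * Re (cinner x (app (\<rho> z) x))\<close>,
  which is at most the sum of the squared norms of \<open>x\<close> and
  \<open>app (\<rho> z) x\<close>. Scaling gives the general case.\<close>

lemma star_hom_norm_le:
  fixes \<rho> :: "'a::cstar_algebra \<Rightarrow> 'h::chilbert_space bop"
  assumes A: "cstar_subalgebra A" and \<rho>: "unital_star_hom A B \<rho>" and a: "a \<in> A"
  shows "norm (\<rho> a) \<le> norm a"
proof -
  have contr: "norm (app (\<rho> a) x) \<le> norm x" if a: "a \<in> A" "norm a < 1" for a x
  proof -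
    have h: "star a * a \<in> A" "norm (star a * a) < 1"
      using A a by (auto simp: cstar_subalgebra_def cstar_identity power_less_one_iff)
    obtain z where z: "z \<in> A" "star z = z" "star a * a + z * z = z + z"
      using cstar_sqrt[OF A h(1) _ h(2)] by (auto simp: star_mult star_star)
    have "\<rho> (star a * a) + \<rho> (z * z) = \<rho> z + \<rho> z"
      using z(3) by (metis star_hom_add[OF \<rho>] h(1) z(1) cstar_subalgebra_mult[OF A])
    moreover have "\<rho> (star a * a) = star (\<rho> a) * \<rho> a" "\<rho> (z * z) = \<rho> z * \<rho> z" "star (\<rho> z) = \<rho> z"
      using z a by (simp_all add: star_hom_mult[OF \<rho>] cstar_subalgebra_star[OF A] flip: star_hom_star[OF \<rho>])
    ultimately have eq: "star (\<rho> a) * \<rho> a + star (\<rho> z) * \<rho> z = \<rho> z + \<rho> z" by simp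
    have "cinner x (app (star (\<rho> a) * \<rho> a + star (\<rho> z) * \<rho> z) x) =
        of_real ((norm (app (\<rho> a) x))\<^sup>2 + (norm (app (\<rho> z) x))\<^sup>2)"
      by (simp add: app_plus_op app_times_op cinner_add_right cinner_star_right cinner_self)
    also have "cinner x (app (star (\<rho> a) * \<rho> a + star (\<rho> z) * \<rho> z) x) = 2 * cinner x (app (\<rho> z) x)"
      unfolding eq by (simp add: app_plus_op cinner_add_right)
    finally have "(norm (app (\<rho> a) x))\<^sup>2 + (norm (app (\<rho> z) x))\<^sup>2 = Re (2 * cinner x (app (\<rho> z) x))"
      by simp
    also have "\<dots> \<le> 2 * (norm x * norm (app (\<rho> z) x))"
      using cinner_Cauchy_Schwarz[of x "app (\<rho> z) x"] complex_Re_le_cmod[of "cinner x (app (\<rho> z) x)"]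
      by simp
    also have "\<dots> \<le> (norm x)\<^sup>2 + (norm (app (\<rho> z) x))\<^sup>2"
      using sum_squares_bound[of "norm x" "norm (app (\<rho> z) x)"] by simp
    finally show ?thesis by (simp add: power_mono_iff)
  qed
  show ?thesis
  proof (rule dense_ge)
    \<comment> \<open>Dividing by some \<open>c > norm a\<close> makes the norm strictly less than 1
      and also covers \<open>a = 0\<close>.\<close>
    fix c assume c: "norm a < c"
    then have c0: "c > 0" using norm_ge_zero le_less_trans by blast
    define b where "b = complex_of_real (1 / c) *\<^sub>C a"
    have b: "b \<in> A" "norm b < 1"
      using A a c c0 by (auto simp: b_def cstar_subalgebra_def csubspace_def norm_scaleC norm_divide)
    have "a = complex_of_real c *\<^sub>C b" using c0 by (simp add: b_def scaleC_scaleC scaleC_one)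
    then have "\<rho> a = complex_of_real c *\<^sub>C \<rho> b" using \<rho> b by (auto simp: unital_star_hom_def)
    then show "norm (\<rho> a) \<le> c"
      using contr[OF b] c0
      by (intro norm_bop_bound) (auto simp: app_scaleC_op norm_scaleC mult_left_mono)
  qed
qed

subsection \<open>Isometries from equal Gram matrices\<close>

text \<open>Scalars act on both components at once; such relations serve as graphs of linear maps
  that need not be defined everywhere.\<close>

definition csubspace2 :: "('a::cbanach \<times> 'b::cbanach) set \<Rightarrow> bool" where
  "csubspace2 R \<longleftrightarrow> 0 \<in> R \<and> (\<forall>p\<in>R. \<forall>q\<in>R. p + q \<in> R) \<and>
     (\<forall>c. \<forall>p\<in>R. (c *\<^sub>C fst p, c *\<^sub>C snd p) \<in> R)"

definition closed_cspan2 :: "('a::cbanach \<times> 'b::cbanach) set \<Rightarrow> ('a \<times> 'b) set" where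
  "closed_cspan2 X = \<Inter> {R. csubspace2 R \<and> closed R \<and> X \<subseteq> R}"

lemma csubspace2_closed_cspan2: "csubspace2 (closed_cspan2 X)"
  unfolding closed_cspan2_def csubspace2_def by blast

lemma closed_closed_cspan2: "closed (closed_cspan2 X)"
  unfolding closed_cspan2_def by (rule closed_Inter) blast

lemma closed_cspan2_superset: "X \<subseteq> closed_cspan2 X"
  unfolding closed_cspan2_def by blast

lemma closed_cspan2_minimal: "csubspace2 R \<Longrightarrow> closed R \<Longrightarrow> X \<subseteq> R \<Longrightarrow> closed_cspan2 X \<subseteq> R"
  unfolding closed_cspan2_def by blast

text \<open>A complex subspace with this property is the graph of an isometry between its two
  projections.\<close>

definition gram_preserving :: "('a::chilbert_space \<times> 'b::chilbert_space) set \<Rightarrow> bool" where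
  "gram_preserving X \<longleftrightarrow> (\<forall>p\<in>X. \<forall>q\<in>X. cinner (fst p) (fst q) = cinner (snd p) (snd q))"

text \<open>For fixed \<open>q\<close> the condition on \<open>p\<close> cuts out a closed complex
  subspace, so it passes from \<open>X\<close> to the closed span in one argument; conjugate
  symmetry then handles the other.\<close>

lemma gram_preserving_closed_cspan2:
  assumes "gram_preserving X"
  shows "gram_preserving (closed_cspan2 X)"
proof -
  define V where "V q = {p :: 'a \<times> 'b. cinner (fst p) (fst q) = cinner (snd p) (snd q)}" for q
  have cl: "closed (V q)" for q
    unfolding V_def
    by (intro closed_Collect_eq bounded_linear.continuous_on[OF bounded_linear_cinner_left]
        continuous_intros)
  have sub: "csubspace2 (V q)" for q
    by (auto simp: V_def csubspace2_def cinner_zero_left cinner_add_left cinner_scaleC_left)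
  have V_commute: "p \<in> V q \<longleftrightarrow> q \<in> V p" for p q
    unfolding V_def using cinner_commute[of "fst p" "fst q"] cinner_commute[of "snd p" "snd q"]
    by (metis (mono_tags) complex_cnj_cnj mem_Collect_eq)
  have "closed_cspan2 X \<subseteq> V q" if "q \<in> X" for q
    using assms that by (intro closed_cspan2_minimal sub cl) (auto simp: V_def gram_preserving_def)
  then have "closed_cspan2 X \<subseteq> V q" if "q \<in> closed_cspan2 X" for q
    using V_commute that by (intro closed_cspan2_minimal sub cl) blast
  then show ?thesis by (auto simp: gram_preserving_def V_def)
qed

lemma gram_preserving_norm: "gram_preserving R \<Longrightarrow> p \<in> R \<Longrightarrow> norm (fst p) = norm (snd p)"
proof -
  assume "gram_preserving R" "p \<in> R"
  then have "cinner (fst p) (fst p) = cinner (snd p) (snd p)" by (auto simp: gram_preserving_def)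
  then have "(norm (fst p))\<^sup>2 = (norm (snd p))\<^sup>2" unfolding cinner_self of_real_eq_iff .
  then show ?thesis by simp
qed

lemma csubspace2_diff: "csubspace2 R \<Longrightarrow> p \<in> R \<Longrightarrow> q \<in> R \<Longrightarrow> p - q \<in> R"
proof -
  assume R: "csubspace2 R" and p: "p \<in> R" and q: "q \<in> R"
  then have "((- 1) *\<^sub>C fst q, (- 1) *\<^sub>C snd q) \<in> R" unfolding csubspace2_def by blast
  then have "- q \<in> R" by (simp add: scaleC_minus_one uminus_prod_def)
  then have "p + - q \<in> R" using R p unfolding csubspace2_def by blast
  then show "p - q \<in> R" by simp
qed

text \<open>If first components converge, their isometric partners form a Cauchy sequence, and the
  limit pair lies in \<open>R\<close>.\<close>

lemma closed_fst_image:
  assumes R: "csubspace2 R" "closed R" "gram_preserving R"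
  shows "closed (fst ` R)"
  unfolding closed_sequential_limits
proof (intro allI impI)
  fix u l assume "(\<forall>n. u n \<in> fst ` R) \<and> u \<longlonglongrightarrow> l"
  then have u: "\<And>n. \<exists>v. (u n, v) \<in> R" and lim: "u \<longlonglongrightarrow> l" by force+
  from u obtain v where v: "\<And>n. (u n, v n) \<in> R" by metis
  have "dist (v m) (v n) = dist (u m) (u n)" for m n
    using gram_preserving_norm[OF R(3) csubspace2_diff[OF R(1) v v], of m n] by (simp add: dist_norm)
  moreover have "Cauchy u" using lim by (rule LIMSEQ_imp_Cauchy)
  ultimately have "Cauchy v" by (simp add: Cauchy_def)
  then obtain k where "v \<longlonglongrightarrow> k" using Cauchy_convergent convergent_def by blast
  then have "(\<lambda>n. (u n, v n)) \<longlonglongrightarrow> (l, k)" using lim by (intro tendsto_Pair)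
  then have "(l, k) \<in> R" using closed_sequentially[OF R(2), of "\<lambda>n. (u n, v n)"] v by blast
  then show "l \<in> fst ` R" by force
qed

lemma csubspace2_fst_image: "csubspace2 R \<Longrightarrow> csubspace (fst ` R)"
  unfolding csubspace_def csubspace2_def
  by (auto simp: image_iff zero_prod_def plus_prod_def Ball_def Bex_def) metis+

text \<open>The Gram condition enters in the second inclusion: it makes the projection of the closed
  span closed again.\<close>

lemma fst_image_closed_cspan2:
  assumes "gram_preserving X"
  shows "fst ` closed_cspan2 X = closed_cspan (fst ` X)"
proof (rule antisym)
  let ?W = "closed_cspan (fst ` X)"
  have "closed_cspan2 X \<subseteq> fst -` ?W"
  proof (rule closed_cspan2_minimal)
    show "csubspace2 (fst -` ?W)"
      using csubspace_closed_cspan[of "fst ` X"] by (auto simp: csubspace_def csubspace2_def)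
    show "closed (fst -` ?W)"
      by (intro closed_vimage closed_closed_cspan continuous_intros)
    show "X \<subseteq> fst -` ?W" using closed_cspan_superset[of "fst ` X"] by auto
  qed
  then show "fst ` closed_cspan2 X \<subseteq> ?W" by auto
  show "?W \<subseteq> fst ` closed_cspan2 X"
    using closed_cspan2_superset[of X] assms
    by (intro closed_cspan_minimal csubspace2_fst_image closed_fst_image)
       (auto simp: csubspace2_closed_cspan2 closed_closed_cspan2 gram_preserving_closed_cspan2)
qed

text \<open>The swap is an involution, so one inclusion, proved for all \<open>X\<close> and applied
  to the swapped set, gives the other.\<close>

lemma closed_cspan2_swap: "closed_cspan2 (prod.swap ` X) = prod.swap ` closed_cspan2 X"
proof -
  have sub: "closed_cspan2 (prod.swap ` X) \<subseteq> prod.swap ` closed_cspan2 X"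
    for X :: "('c::cbanach \<times> 'd::cbanach) set"
  proof (rule closed_cspan2_minimal)
    have eq: "prod.swap ` R = prod.swap -` R" for R :: "('c \<times> 'd) set"
      by (auto simp: image_iff intro!: bexI[of _ "(_, _)"])
    show "csubspace2 (prod.swap ` closed_cspan2 X)"
      using csubspace2_closed_cspan2[of X] unfolding eq csubspace2_def
      by (auto simp: zero_prod_def) (metis add_Pair, metis fst_conv snd_conv)
    show "closed (prod.swap ` closed_cspan2 X)"
      unfolding eq by (intro closed_vimage closed_closed_cspan2 continuous_on_swap)
  qed (use closed_cspan2_superset in blast)
  from sub[of "prod.swap ` X"] have "prod.swap ` closed_cspan2 X \<subseteq> prod.swap ` prod.swap ` closed_cspan2 (prod.swap ` X)"
    by (intro image_mono) (simp add: image_image)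
  then show ?thesis using sub[of X] by (auto simp: image_image)
qed

lemma snd_image_closed_cspan2:
  assumes "gram_preserving X"
  shows "snd ` closed_cspan2 X = closed_cspan (snd ` X)"
proof -
  have "gram_preserving (prod.swap ` X)" using assms by (auto simp: gram_preserving_def)
  from fst_image_closed_cspan2[OF this] show ?thesis
    by (simp add: closed_cspan2_swap image_image)
qed


subsection \<open>Representations of the Cuntz algebra\<close>

lemma cstar_subalgebra_cuntz: "cstar_subalgebra (cuntz_algebra N)"
proof -
  have "closed (cuntz_algebra N)"
    unfolding cuntz_algebra_def cstar_generated_def
    by (rule closed_Inter) (auto simp: cstar_subalgebra_def)
  moreover have "csubspace (cuntz_algebra N)"
    unfolding cuntz_algebra_def cstar_generated_def csubspace_def
    by (auto simp: cstar_subalgebra_def csubspace_def)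
  ultimately show ?thesis
    unfolding cstar_subalgebra_def by (auto simp: cuntz_algebra_def cstar_generated_def cstar_subalgebra_def)
qed

lemmas csubspace_cuntz = cstar_subalgebra_csubspace[OF cstar_subalgebra_cuntz]
  and closed_cuntz = cstar_subalgebra_closed[OF cstar_subalgebra_cuntz]
  and cuntz_mult = cstar_subalgebra_mult[OF cstar_subalgebra_cuntz]
  and cuntz_star = cstar_subalgebra_star[OF cstar_subalgebra_cuntz]

lemma cuntz_gen_in: "l \<in> {1..N} \<Longrightarrow> cuntz_gen N l \<in> cuntz_algebra N"
  unfolding cuntz_algebra_def cstar_generated_def by blast

text \<open>The elements that have \<open>P\<close> together with their adjoints form a
  C*-subalgebra; this is why \<open>P\<close> is asked of the generators and of their
  adjoints.\<close>

lemma cuntz_induct [consumes 1, case_names gen star_gen zero add scaleC mult closed]: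
  assumes a: "a \<in> cuntz_algebra N"
    and gen: "\<And>l. l \<in> {1..N} \<Longrightarrow> P (cuntz_gen N l)"
    and star_gen: "\<And>l. l \<in> {1..N} \<Longrightarrow> P (star (cuntz_gen N l))"
    and zero: "P 0"
    and add: "\<And>a b. a \<in> cuntz_algebra N \<Longrightarrow> b \<in> cuntz_algebra N \<Longrightarrow> P a \<Longrightarrow> P b \<Longrightarrow> P (a + b)"
    and scaleC: "\<And>c a. a \<in> cuntz_algebra N \<Longrightarrow> P a \<Longrightarrow> P (c *\<^sub>C a)"
    and mult: "\<And>a b. a \<in> cuntz_algebra N \<Longrightarrow> b \<in> cuntz_algebra N \<Longrightarrow> P a \<Longrightarrow> P b \<Longrightarrow> P (a * b)"
    and closed: "closed {a \<in> cuntz_algebra N. P a}"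
  shows "P a"
proof -
  define B where "B = {a \<in> cuntz_algebra N. P a} \<inter> star -` {a \<in> cuntz_algebra N. P a}"
  have star_0: "star (0 :: cuntz_elem) = 0"
    using star_scaleC[of 0 "0 :: cuntz_elem"] by (simp add: scaleC_zero_left)
  have "cstar_subalgebra B"
    unfolding cstar_subalgebra_def
  proof (intro conjI ballI)
    show "csubspace B"
      using csubspace_cuntz[of N] zero add scaleC
      by (auto simp: B_def csubspace_def star_0 star_add star_scaleC)
    show "closed B"
      unfolding B_def
      by (intro closed_Int closed closed_vimage linear_continuous_on bounded_linear_star)
  qed (auto simp: B_def cuntz_mult mult star_mult cuntz_star star_star)
  moreover have "cuntz_gen N ` {1..N} \<subseteq> B"
    by (auto simp: B_def cuntz_gen_in gen star_gen cuntz_star)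
  ultimately have "cuntz_algebra N \<subseteq> B"
    unfolding cuntz_algebra_def cstar_generated_def by blast
  then show ?thesis using a by (auto simp: B_def)
qed

lemma at_pt_sum: "at_pt (sum f X) S = (\<Sum>i\<in>X. at_pt (f i) S)"
  by (induction X rule: infinite_finite_induct) (simp_all add: zero_bfield.rep_eq plus_bfield.rep_eq)

lemma id_op_mult: "id_op * T = T" "T * id_op = T"
  by (rule app_eqI, simp add: app_times_op app_id_op)+

text \<open>The unit is the sum \<open>e\<close> of the range projections of the generators, which
  lies in the generated algebra. As a field it is the identity at realizations and zero elsewhere,
  where the generators vanish too.\<close>

lemma cuntz_algebra_unit:
  shows alg_unit_cuntz_in: "alg_unit (cuntz_algebra N) \<in> cuntz_algebra N"
    and cuntz_gen_rel: "i \<in> {1..N} \<Longrightarrow> j \<in> {1..N} \<Longrightarrow>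
      star (cuntz_gen N i) * cuntz_gen N j = (if i = j then alg_unit (cuntz_algebra N) else 0)"
proof -
  define e where "e = (\<Sum>i=1..N. cuntz_gen N i * star (cuntz_gen N i))"
  have at_e: "at_pt e S = (if cuntz_family N S then id_op else 0)" for S
  proof (cases "cuntz_family N S")
    case True
    then have "at_pt e S = (\<Sum>i=1..N. S i * star (S i))"
      by (simp add: e_def at_pt_sum times_bfield.rep_eq star_bfield.rep_eq at_pt_cuntz_gen)
    then show ?thesis using True by (simp add: cuntz_family_def)
  qed (simp add: e_def at_pt_sum times_bfield.rep_eq star_bfield.rep_eq at_pt_cuntz_gen)
  have "(\<Sum>i\<in>X. cuntz_gen N i * star (cuntz_gen N i)) \<in> cuntz_algebra N" if "X \<subseteq> {1..N}" for X
    using that by (induction X rule: infinite_finite_induct)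
      (auto intro!: csubspace_0 csubspace_add csubspace_cuntz cuntz_mult cuntz_star cuntz_gen_in)
  then have e_in: "e \<in> cuntz_algebra N" by (simp add: e_def)
  have "star e = e"
    by (rule at_pt_inject[THEN iffD1], rule ext)
       (metis at_e id_op_mult star_bfield.rep_eq star_mult star_star mult_zero_left)
  have e_gen: "e * cuntz_gen N l = cuntz_gen N l" "cuntz_gen N l * e = cuntz_gen N l" for l
    by (rule at_pt_inject[THEN iffD1], rule ext,
        simp add: times_bfield.rep_eq at_e at_pt_cuntz_gen id_op_mult)+
  have e_unit: "e * a = a \<and> a * e = a" if "a \<in> cuntz_algebra N" for a
    using that
  proof (induction rule: cuntz_induct)
    case (star_gen l)
    then show ?case by (metis e_gen \<open>star e = e\<close> star_mult)
  next
    case closed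
    have "closed {a. e * a = a \<and> a * e = a}"
      by (intro closed_Collect_conj closed_Collect_eq continuous_intros)
    then have "closed (cuntz_algebra N \<inter> {a. e * a = a \<and> a * e = a})"
      by (intro closed_Int closed_cuntz)
    then show ?case by (simp add: Int_def)
  next
    case (mult a b)
    then show ?case by (metis mult.assoc)
  qed (auto simp: e_gen algebra_simps mult_scaleC_left mult_scaleC_right)
  then have unit: "alg_unit (cuntz_algebra N) = e"
    using e_in by (intro alg_unit_eqI) auto
  show "alg_unit (cuntz_algebra N) \<in> cuntz_algebra N" by (simp add: unit e_in)
  show "star (cuntz_gen N i) * cuntz_gen N j = (if i = j then alg_unit (cuntz_algebra N) else 0)"
    if "i \<in> {1..N}" "j \<in> {1..N}"
    by (rule at_pt_inject[THEN iffD1], rule ext)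
       (use that in \<open>auto simp: unit at_e times_bfield.rep_eq star_bfield.rep_eq at_pt_cuntz_gen
          zero_bfield.rep_eq cuntz_family_def\<close>)
qed

lemma representation_hom: "representation A H \<rho> \<Longrightarrow> unital_star_hom A (bounded_ops H) \<rho>"
  and representation_csubspace: "representation A H \<rho> \<Longrightarrow> csubspace H"
  and representation_closed: "representation A H \<rho> \<Longrightarrow> closed H"
  by (auto simp: representation_def)

lemma representation_in: "representation A H \<rho> \<Longrightarrow> a \<in> A \<Longrightarrow> app (\<rho> a) x \<in> H"
  using star_hom_in[OF representation_hom] by (force simp: bounded_ops_def)

lemma representation_unit:
  "representation A H \<rho> \<Longrightarrow> x \<in> H \<Longrightarrow> app (\<rho> (alg_unit A)) x = x"
  by (simp add: star_hom_unit[OF representation_hom] app_alg_unit_bounded_ops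
      representation_csubspace representation_closed)

text \<open>Contractivity of star-homomorphisms yields the Lipschitz constant
  \<open>norm x\<close>.\<close>

lemma representation_continuous:
  fixes \<rho> :: "'a::cstar_algebra \<Rightarrow> 'h::chilbert_space bop"
  assumes A: "cstar_subalgebra A" and \<rho>: "representation A H \<rho>"
  shows "continuous_on A (\<lambda>a. app (\<rho> a) x)"
proof (rule continuous_on_subset[OF lipschitz_on_continuous_on order_refl])
  note hom = representation_hom[OF \<rho>]
  show "(norm x)-lipschitz_on A (\<lambda>a. app (\<rho> a) x)"
  proof (rule lipschitz_onI)
    fix a b assume a: "a \<in> A" and b: "b \<in> A"
    have d: "a - b \<in> A" using A a b by (intro csubspace_diff cstar_subalgebra_csubspace)
    have "\<rho> a = \<rho> (a - b) + \<rho> b" using star_hom_add[OF hom d b] by simp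
    then have "app (\<rho> a) x - app (\<rho> b) x = app (\<rho> (a - b)) x" by (simp add: app_plus_op)
    moreover have "norm (app (\<rho> (a - b)) x) \<le> norm x * norm (a - b)"
      using norm_app[of "\<rho> (a - b)" x] mult_right_mono[OF star_hom_norm_le[OF A hom d], of "norm x"]
      by (simp add: mult.commute)
    ultimately show "dist (app (\<rho> a) x) (app (\<rho> b) x) \<le> norm x * dist a b"
      by (simp add: dist_norm)
  qed simp
qed

text \<open>The vector is taken in \<open>H\<close> because the unit of the algebra acts as the
  projection onto \<open>H\<close>.\<close>

lemma rep_star_gen_gen:
  assumes \<rho>: "representation (cuntz_algebra N) H \<rho>" and "i \<in> {1..N}" "j \<in> {1..N}" "x \<in> H"
  shows "app (star (\<rho> (cuntz_gen N i))) (app (\<rho> (cuntz_gen N j)) x) = (if i = j then x else 0)"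
proof -
  note hom = representation_hom[OF \<rho>]
  have rho0: "\<rho> 0 = 0"
    using star_hom_scaleC[OF hom alg_unit_cuntz_in, of 0] by (simp add: scaleC_zero_left)
  have "star (\<rho> (cuntz_gen N i)) * \<rho> (cuntz_gen N j) = \<rho> (star (cuntz_gen N i) * cuntz_gen N j)"
    using assms by (simp add: star_hom_mult[OF hom] star_hom_star[OF hom] cuntz_star cuntz_gen_in)
  then show ?thesis
    using assms by (auto simp: cuntz_gen_rel representation_unit rho0 app_zero_op simp flip: app_times_op)
qed

lemma rep_cinner_gen:
  assumes "representation (cuntz_algebra N) H \<rho>" "i \<in> {1..N}" "j \<in> {1..N}" "x \<in> H" "y \<in> H"
  shows "cinner (app (\<rho> (cuntz_gen N i)) x) (app (\<rho> (cuntz_gen N j)) y) = (if i = j then cinner x y else 0)"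
  using rep_star_gen_gen[OF assms(1-3) \<open>y \<in> H\<close>]
  by (simp add: cinner_zero_right flip: cinner_star_right[of x])

text \<open>Closedness of \<open>R\<close> and continuity of both representations let
  \<open>cuntz_induct\<close> reduce invariance to the generators and their adjoints. For a graph
  \<open>R\<close> this is the intertwining property; for the preimage of a subspace under
  \<open>fst\<close> it is invariance of that subspace.\<close>

lemma rep_pair_invariant:
  assumes \<pi>: "representation (cuntz_algebra N) T \<pi>" and \<rho>: "representation (cuntz_algebra N) H \<rho>"
    and R: "csubspace2 R" "closed R"
    and inv_gen: "\<And>l p. l \<in> {1..N} \<Longrightarrow> p \<in> R \<Longrightarrow>
      (app (\<pi> (cuntz_gen N l)) (fst p), app (\<rho> (cuntz_gen N l)) (snd p)) \<in> R"
    and inv_star: "\<And>l p. l \<in> {1..N} \<Longrightarrow> p \<in> R \<Longrightarrow>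
      (app (star (\<pi> (cuntz_gen N l))) (fst p), app (star (\<rho> (cuntz_gen N l))) (snd p)) \<in> R"
    and a: "a \<in> cuntz_algebra N"
  shows "\<forall>p\<in>R. (app (\<pi> a) (fst p), app (\<rho> a) (snd p)) \<in> R"
proof -
  have R0: "0 \<in> R" and R_add: "\<And>p q. p \<in> R \<Longrightarrow> q \<in> R \<Longrightarrow> p + q \<in> R"
    and R_scaleC: "\<And>c p. p \<in> R \<Longrightarrow> (c *\<^sub>C fst p, c *\<^sub>C snd p) \<in> R"
    using R(1) by (auto simp: csubspace2_def)
  show ?thesis
    using a
  proof (induction rule: cuntz_induct)
    case (gen l)
    then show ?case using inv_gen by blast
  next
    case (star_gen l)
    then show ?case
      using inv_star cuntz_gen_in[OF star_gen]
      by (metis star_hom_star[OF representation_hom[OF \<pi>]] star_hom_star[OF representation_hom[OF \<rho>]])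
  next
    case zero
    have "\<pi> 0 = 0" "\<rho> 0 = 0"
      using star_hom_scaleC[OF representation_hom[OF \<pi>] alg_unit_cuntz_in, of 0]
        star_hom_scaleC[OF representation_hom[OF \<rho>] alg_unit_cuntz_in, of 0]
      by (simp_all add: scaleC_zero_left)
    then show ?case using R0 by (simp add: app_zero_op zero_prod_def)
  next
    case (add a b)
    show ?case
    proof
      fix p assume "p \<in> R"
      then have "(app (\<pi> a) (fst p), app (\<rho> a) (snd p)) + (app (\<pi> b) (fst p), app (\<rho> b) (snd p)) \<in> R"
        using add by (intro R_add) auto
      then show "(app (\<pi> (a + b)) (fst p), app (\<rho> (a + b)) (snd p)) \<in> R"
        using add by (simp add: star_hom_add[OF representation_hom[OF \<pi>]]
            star_hom_add[OF representation_hom[OF \<rho>]] app_plus_op)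
    qed
  next
    case (scaleC c a)
    then show ?case
      using R_scaleC[of "(app (\<pi> a) _, app (\<rho> a) _)" c]
      by (auto simp: star_hom_scaleC[OF representation_hom[OF \<pi>]]
            star_hom_scaleC[OF representation_hom[OF \<rho>]] app_scaleC_op)
  next
    case (mult a b)
    show ?case
    proof
      fix p assume "p \<in> R"
      then have "(app (\<pi> b) (fst p), app (\<rho> b) (snd p)) \<in> R" using mult by blast
      then have "(app (\<pi> a) (app (\<pi> b) (fst p)), app (\<rho> a) (app (\<rho> b) (snd p))) \<in> R"
        using mult by fastforce
      then show "(app (\<pi> (a * b)) (fst p), app (\<rho> (a * b)) (snd p)) \<in> R"
        using mult by (simp add: star_hom_mult[OF representation_hom[OF \<pi>]]
            star_hom_mult[OF representation_hom[OF \<rho>]] app_times_op)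
    qed
  next
    case closed
    have "closed (cuntz_algebra N \<inter> (\<lambda>a. (app (\<pi> a) (fst p), app (\<rho> a) (snd p))) -` R)" for p
      by (intro continuous_closed_preimage continuous_on_Pair representation_continuous[OF _ \<pi>]
          representation_continuous[OF _ \<rho>] cstar_subalgebra_cuntz closed_cuntz R)
    then have "closed (cuntz_algebra N \<inter>
        (\<Inter>p\<in>R. cuntz_algebra N \<inter> (\<lambda>a. (app (\<pi> a) (fst p), app (\<rho> a) (snd p))) -` R))"
      by (intro closed_Int closed_INT closed_cuntz) auto
    also have "\<dots> = {a \<in> cuntz_algebra N. \<forall>p\<in>R. (app (\<pi> a) (fst p), app (\<rho> a) (snd p)) \<in> R}"
      by auto
    finally show ?case .
  qed
qed

text \<open>The closed span of the given pairs is the graph of the intertwining unitary.\<close>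

lemma unitarily_equivalent_gram:
  assumes \<pi>: "representation (cuntz_algebra N) T \<pi>" and \<rho>: "representation (cuntz_algebra N) H \<rho>"
    and gram: "gram_preserving X"
    and T: "T = closed_cspan (fst ` X)" and H: "H = closed_cspan (snd ` X)"
    and inv_gen: "\<And>l p. l \<in> {1..N} \<Longrightarrow> p \<in> X \<Longrightarrow>
      (app (\<pi> (cuntz_gen N l)) (fst p), app (\<rho> (cuntz_gen N l)) (snd p)) \<in> insert 0 X"
    and inv_star: "\<And>l p. l \<in> {1..N} \<Longrightarrow> p \<in> X \<Longrightarrow>
      (app (star (\<pi> (cuntz_gen N l))) (fst p), app (star (\<rho> (cuntz_gen N l))) (snd p)) \<in> insert 0 X"
  shows "unitarily_equivalent (cuntz_algebra N) T \<pi> H \<rho>"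
proof -
  define R where "R = closed_cspan2 X"
  have R: "csubspace2 R" "closed R" "X \<subseteq> R" "gram_preserving R"
    unfolding R_def using gram
    by (auto simp: csubspace2_closed_cspan2 closed_closed_cspan2 closed_cspan2_superset
        gram_preserving_closed_cspan2)
  have R0: "0 \<in> R" and R_add: "\<And>p q. p \<in> R \<Longrightarrow> q \<in> R \<Longrightarrow> p + q \<in> R"
    and R_scaleC: "\<And>c p. p \<in> R \<Longrightarrow> (c *\<^sub>C fst p, c *\<^sub>C snd p) \<in> R"
    using R(1) by (auto simp: csubspace2_def)
  have dom: "fst ` R = T" and rng: "snd ` R = H"
    using fst_image_closed_cspan2[OF gram] snd_image_closed_cspan2[OF gram] by (auto simp: R_def T H)
  \<comment> \<open>Two partners of \<open>u\<close> differ by the second component of a pair whose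
    first component is 0, hence by a vector of norm 0.\<close>
  have sv: "v = w" if "(u, v) \<in> R" "(u, w) \<in> R" for u v w
    using gram_preserving_norm[OF R(4) csubspace2_diff[OF R(1) that]] by simp
  \<comment> \<open>The pairs that two bounded operators send into \<open>R\<close> form a closed
    complex subspace, so testing on \<open>X\<close> suffices.\<close>
  have R_op: "(app S (fst p), app S' (snd p)) \<in> R"
    if "\<And>p. p \<in> X \<Longrightarrow> (app S (fst p), app S' (snd p)) \<in> insert 0 X" "p \<in> R" for S S' p
  proof -
    define f where "f p = (app S (fst p), app S' (snd p))" for p
    have "R \<subseteq> f -` R"
      unfolding R_def
    proof (rule closed_cspan2_minimal; fold R_def)
      show "csubspace2 (f -` R)"
        unfolding csubspace2_def
      proof (intro conjI ballI allI)
        show "0 \<in> f -` R" using R0 by (simp add: f_def app_zero zero_prod_def)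
        show "p + q \<in> f -` R" if "p \<in> f -` R" "q \<in> f -` R" for p q
          using R_add[of "f p" "f q"] that by (simp add: f_def app_add)
        show "(c *\<^sub>C fst p, c *\<^sub>C snd p) \<in> f -` R" if "p \<in> f -` R" for c p
          using R_scaleC[of "f p" c] that by (simp add: f_def app_scaleC)
      qed
      show "closed (f -` R)"
        unfolding f_def
        by (intro closed_vimage R continuous_on_Pair bounded_linear.continuous_on[OF bounded_linear_app]
            continuous_intros)
      show "X \<subseteq> f -` R" using that(1) R(3) R0 by (force simp: f_def)
    qed
    then show ?thesis using \<open>p \<in> R\<close> by (auto simp: f_def)
  qed
  have inv: "\<forall>p\<in>R. (app (\<pi> a) (fst p), app (\<rho> a) (snd p)) \<in> R" if "a \<in> cuntz_algebra N" for a
    by (rule rep_pair_invariant[OF \<pi> \<rho> R(1,2) _ _ that]) (auto intro!: R_op[OF inv_gen] R_op[OF inv_star])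
  have "\<exists>v. (u, v) \<in> R" if "u \<in> T" for u using that unfolding dom[symmetric] by force
  then obtain U where U: "\<And>u. u \<in> T \<Longrightarrow> (u, U u) \<in> R" by metis
  have U_eq: "U u = v" if "(u, v) \<in> R" for u v
    using sv[OF U that] that dom by force
  show ?thesis
    unfolding unitarily_equivalent_def
  proof (intro exI[of _ U] conjI ballI allI)
    have "v \<in> U ` T" if v: "v \<in> H" for v
    proof -
      obtain u where "(u, v) \<in> R" using v unfolding rng[symmetric] by force
      then show ?thesis using U_eq dom by force
    qed
    moreover have "U u \<in> H" if "u \<in> T" for u
      using U[OF that] unfolding rng[symmetric] by force
    ultimately show "U ` T = H" by blast
    show "U (x + y) = U x + U y" if "x \<in> T" "y \<in> T" for x y
      using U_eq R_add[OF U[OF that(1)] U[OF that(2)]] by simp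
    show "U (c *\<^sub>C x) = c *\<^sub>C U x" if "x \<in> T" for c x
      using U_eq R_scaleC[OF U[OF that]] by simp
    show "cinner (U x) (U y) = cinner x y" if "x \<in> T" "y \<in> T" for x y
      using R(4)[unfolded gram_preserving_def, rule_format, OF U[OF that(1)] U[OF that(2)]] by simp
    show "U (app (\<pi> a) x) = app (\<rho> a) (U x)" if "a \<in> cuntz_algebra N" "x \<in> T" for a x
      using U_eq inv[OF that(1), rule_format, OF U[OF that(2)]] by simp
  qed
qed

subsection \<open>Tails of infinite words\<close>

text \<open>Letters act one by one, so the empty word fixes every vector, whereas the image of the
  empty \<open>cuntz_word\<close> is the projection onto \<open>H\<close>.\<close>

definition word_op :: "nat \<Rightarrow> (cuntz_elem \<Rightarrow> 'h::chilbert_space bop) \<Rightarrow> nat list \<Rightarrow> 'h \<Rightarrow> 'h" where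
  "word_op N \<rho> I x = foldr (\<lambda>l. app (\<rho> (cuntz_gen N l))) I x"

lemma word_op_simps [simp]:
  "word_op N \<rho> [] x = x"
  "word_op N \<rho> (l # I) x = app (\<rho> (cuntz_gen N l)) (word_op N \<rho> I x)"
  "word_op N \<rho> (I @ I') x = word_op N \<rho> I (word_op N \<rho> I' x)"
  by (simp_all add: word_op_def)

lemma word_op_in:
  "representation (cuntz_algebra N) H \<rho> \<Longrightarrow> set I \<subseteq> {1..N} \<Longrightarrow> x \<in> H \<Longrightarrow> word_op N \<rho> I x \<in> H"
  by (cases I) (auto simp: representation_in cuntz_gen_in)

lemma cuntz_word_in: "set I \<subseteq> {1..N} \<Longrightarrow> cuntz_word N I \<in> cuntz_algebra N"
  by (induction I) (auto simp: cuntz_word_def alg_unit_cuntz_in intro!: cuntz_mult cuntz_gen_in)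

lemma rep_cuntz_word:
  assumes \<rho>: "representation (cuntz_algebra N) H \<rho>" and "set I \<subseteq> {1..N}" "x \<in> H"
  shows "app (\<rho> (cuntz_word N I)) x = word_op N \<rho> I x"
  using assms(2)
proof (induction I)
  case Nil
  then show ?case by (simp add: cuntz_word_def representation_unit[OF \<rho> \<open>x \<in> H\<close>])
next
  case (Cons l I)
  have "\<rho> (cuntz_word N (l # I)) = \<rho> (cuntz_gen N l) * \<rho> (cuntz_word N I)"
    using Cons.prems cuntz_word_in[of I N] cuntz_gen_in[of l N]
    by (simp add: star_hom_mult[OF representation_hom[OF \<rho>], symmetric] cuntz_word_def)
  then show ?case using Cons by (simp add: app_times_op)
qed

text \<open>The generators are isometries on \<open>H\<close> with mutually orthogonal ranges; equal
  lengths allow the letters to be compared one by one.\<close>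

lemma cinner_word_op:
  assumes \<rho>: "representation (cuntz_algebra N) H \<rho>"
    and "length I = length I'" "set I \<subseteq> {1..N}" "set I' \<subseteq> {1..N}" "x \<in> H" "y \<in> H"
  shows "cinner (word_op N \<rho> I x) (word_op N \<rho> I' y) = (if I = I' then cinner x y else 0)"
  using assms(2-4)
proof (induction I I' rule: list_induct2)
  case (Cons l I l' I')
  then show ?case
    using word_op_in[OF \<rho> _ \<open>x \<in> H\<close>, of I] word_op_in[OF \<rho> _ \<open>y \<in> H\<close>, of I']
    by (auto simp: rep_cinner_gen[OF \<rho>])
qed simp

text \<open>\<open>v n\<close> is what remains of \<open>v 0\<close> after stripping off the first \<open>n\<close> letters of the infinite word \<open>J\<close>.\<close>

definition cuntz_tail ::
    "nat \<Rightarrow> 'h::chilbert_space set \<Rightarrow> (cuntz_elem \<Rightarrow> 'h bop) \<Rightarrow> (nat \<Rightarrow> nat) \<Rightarrow> (nat \<Rightarrow> 'h) \<Rightarrow> bool" where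
  "cuntz_tail N H \<rho> J v \<longleftrightarrow>
     (\<forall>n. J n \<in> {1..N} \<and> v n \<in> H \<and> v n = app (\<rho> (cuntz_gen N (J n))) (v (Suc n)))"

lemma cuntz_tail_letter: "cuntz_tail N H \<rho> J v \<Longrightarrow> J n \<in> {1..N}"
  and cuntz_tail_in: "cuntz_tail N H \<rho> J v \<Longrightarrow> v n \<in> H"
  and cuntz_tail_step: "cuntz_tail N H \<rho> J v \<Longrightarrow> v n = app (\<rho> (cuntz_gen N (J n))) (v (Suc n))"
  unfolding cuntz_tail_def by blast+

lemma cuntz_tail_word:
  assumes "cuntz_tail N H \<rho> J v"
  shows "v n = word_op N \<rho> (map J [n..<n + d]) (v (n + d))"
proof (induction d)
  case (Suc d)
  then show ?case using cuntz_tail_step[OF assms, of "n + d"] by simp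
qed simp

text \<open>Padding the shorter word reduces inner products to words of equal length.\<close>

lemma cinner_tail_words:
  assumes \<rho>: "representation (cuntz_algebra N) H \<rho>"
    and v: "cuntz_tail N H \<rho> J v" and w: "cuntz_tail N H \<rho> J' w"
    and I: "set I \<subseteq> {1..N}" "set I' \<subseteq> {1..N}"
  defines "d \<equiv> length I' - length I" and "d' \<equiv> length I - length I'"
  shows "cinner (word_op N \<rho> I (v m)) (word_op N \<rho> I' (w n)) =
    (if I @ map J [m..<m + d] = I' @ map J' [n..<n + d'] then cinner (v (m + d)) (w (n + d')) else 0)"
proof -
  have "cinner (word_op N \<rho> I (v m)) (word_op N \<rho> I' (w n)) =
      cinner (word_op N \<rho> (I @ map J [m..<m + d]) (v (m + d)))
        (word_op N \<rho> (I' @ map J' [n..<n + d']) (w (n + d')))"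
    using cuntz_tail_word[OF v, of m d] cuntz_tail_word[OF w, of n d'] by simp
  also have "\<dots> = (if I @ map J [m..<m + d] = I' @ map J' [n..<n + d']
      then cinner (v (m + d)) (w (n + d')) else 0)"
    using I cuntz_tail_letter[OF v] cuntz_tail_letter[OF w]
    by (intro cinner_word_op[OF \<rho>])
       (auto simp: d_def d'_def cuntz_tail_in[OF v] cuntz_tail_in[OF w])
  finally show ?thesis .
qed

text \<open>An empty word borrows its first letter from the tail. Thus an adjoint generator strips a
  letter, advances the tail, or gives 0; together with 0, the vectors made of a word and a tail are
  closed under adjoint generators.\<close>

lemma star_gen_tail_word:
  assumes \<rho>: "representation (cuntz_algebra N) H \<rho>" and v: "cuntz_tail N H \<rho> J v"
    and "l \<in> {1..N}" "set I \<subseteq> {1..N}"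
  shows "app (star (\<rho> (cuntz_gen N l))) (word_op N \<rho> I (v n)) =
    (case I of [] \<Rightarrow> if l = J n then v (Suc n) else 0
     | h # I' \<Rightarrow> if l = h then word_op N \<rho> I' (v n) else 0)"
proof (cases I)
  case Nil
  then show ?thesis
    using rep_star_gen_gen[OF \<rho> \<open>l \<in> {1..N}\<close> cuntz_tail_letter[OF v] cuntz_tail_in[OF v], of n "Suc n"]
      cuntz_tail_step[OF v, of n] by simp
next
  case (Cons h I')
  then show ?thesis
    using assms rep_star_gen_gen[OF \<rho> \<open>l \<in> {1..N}\<close>, of h] by (simp add: word_op_in[OF \<rho>] cuntz_tail_in[OF v])
qed

text \<open>The spanning vectors are mapped to spanning vectors or 0 by the generators and their
  adjoints. Their closed span is therefore invariant under the algebra, and it contains the cyclic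
  vector \<open>v 0\<close>.\<close>

lemma cyclic_tail_total:
  assumes \<rho>: "representation (cuntz_algebra N) H \<rho>" and v: "cuntz_tail N H \<rho> J v"
    and cyc: "closure {app (\<rho> a) (v 0) | a. a \<in> cuntz_algebra N} = H"
  shows "H = closed_cspan {word_op N \<rho> I (v n) | I n. set I \<subseteq> {1..N}}" (is "H = closed_cspan ?Y")
proof (rule antisym)
  define W where "W = closed_cspan ?Y"
  have W: "csubspace W" "closed W" "?Y \<subseteq> W"
    unfolding W_def by (rule csubspace_closed_cspan closed_closed_cspan closed_cspan_superset)+
  show "closed_cspan ?Y \<subseteq> H"
    using \<rho> by (intro closed_cspan_minimal)
      (auto simp: representation_csubspace representation_closed word_op_in cuntz_tail_in[OF v])
  have W_op: "W \<subseteq> app S -` W" if "\<And>y. y \<in> ?Y \<Longrightarrow> app S y \<in> W" for S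
    unfolding W_def
  proof (rule closed_cspan_minimal; fold W_def)
    show "csubspace (app S -` W)"
      using W(1) by (auto simp: csubspace_def app_zero app_add app_scaleC)
    show "closed (app S -` W)"
      by (intro closed_vimage W linear_continuous_on bounded_linear_app)
  qed (use that in blast)
  have gen: "app (\<rho> (cuntz_gen N l)) y \<in> W" if "l \<in> {1..N}" "y \<in> W" for l y
  proof -
    have "app (\<rho> (cuntz_gen N l)) y \<in> W" if y: "y \<in> ?Y" for y
    proof -
      obtain I n where "y = word_op N \<rho> I (v n)" "set I \<subseteq> {1..N}" using y by blast
      then have "app (\<rho> (cuntz_gen N l)) y \<in> ?Y"
        using \<open>l \<in> {1..N}\<close> by (intro CollectI exI[of _ "l # I"] exI[of _ n]) auto
      then show ?thesis using W(3) by blast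
    qed
    from W_op[OF this] show ?thesis using \<open>y \<in> W\<close> by blast
  qed
  have star_gen: "app (star (\<rho> (cuntz_gen N l))) y \<in> W" if l: "l \<in> {1..N}" and "y \<in> W" for l y
  proof -
    have "app (star (\<rho> (cuntz_gen N l))) y \<in> W" if y: "y \<in> ?Y" for y
    proof -
      obtain I n where I: "y = word_op N \<rho> I (v n)" "set I \<subseteq> {1..N}" using y by blast
      have "v (Suc n) \<in> ?Y" by (intro CollectI exI[of _ "[]"] exI[of _ "Suc n"]) auto
      moreover have "word_op N \<rho> I' (v n) \<in> ?Y" if "I = h # I'" for h I' using I that by auto
      ultimately have "app (star (\<rho> (cuntz_gen N l))) y \<in> insert 0 ?Y"
        unfolding I(1) star_gen_tail_word[OF \<rho> v l I(2)] by (auto split: list.split)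
      then show ?thesis using W by (auto simp: csubspace_0)
    qed
    from W_op[OF this] show ?thesis using \<open>y \<in> W\<close> by blast
  qed
  have "app (\<rho> a) (v 0) \<in> W" if "a \<in> cuntz_algebra N" for a
  proof -
    have "v 0 \<in> ?Y" by (intro CollectI exI[of _ "[]"] exI[of _ 0]) auto
    \<comment> \<open>Invariance of \<open>W\<close> is obtained as invariance of a relation that
      constrains only first components.\<close>
    then have v0: "(v 0, v 0) \<in> fst -` W" using W(3) by auto
    have "\<forall>p\<in>fst -` W. (app (\<rho> a) (fst p), app (\<rho> a) (snd p)) \<in> fst -` W"
    proof (rule rep_pair_invariant[OF \<rho> \<rho> _ _ _ _ that])
      show "csubspace2 (fst -` W :: ('a \<times> 'a) set)"
        using W(1) by (auto simp: csubspace_def csubspace2_def)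
      show "closed (fst -` W :: ('a \<times> 'a) set)"
        by (intro closed_vimage W continuous_intros)
    qed (auto simp: gen star_gen)
    from bspec[OF this v0] show ?thesis by simp
  qed
  then have "closure {app (\<rho> a) (v 0) | a. a \<in> cuntz_algebra N} \<subseteq> W"
    by (intro closure_minimal W) auto
  then show "H \<subseteq> closed_cspan ?Y" by (simp add: cyc W_def)
qed

text \<open>Finite multiindices are repeated periodically; period 0 stands for an infinite multiindex,
  which is consistent with \<open>n mod 0 = n\<close>.\<close>

fun multiindex_letter :: "multiindex \<Rightarrow> nat \<Rightarrow> nat" where
  "multiindex_letter (FinIdx J) n = J ! (n mod length J)"
| "multiindex_letter (InfIdx J) n = J (Suc n)"

fun multiindex_period :: "multiindex \<Rightarrow> nat" where
  "multiindex_period (FinIdx J) = length J"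
| "multiindex_period (InfIdx J) = 0"

section \<open>Tails in representations of the classes \<open>is_P\<close>\<close>

lemma multiindex_letter_in: "multiindex_over N J \<Longrightarrow> multiindex_letter J n \<in> {1..N}"
  by (cases J) (force dest!: nth_mem[OF mod_less_divisor, of _ n])+

lemma is_P_representation: "is_P N J H \<rho> \<Longrightarrow> representation (cuntz_algebra N) H \<rho>"
  by (cases J) auto

text \<open>Finite and infinite multiindices are reduced to the same data, a tail that starts at the
  cyclic vector and whose Gram matrix is congruence modulo the period, so that later arguments treat
  them together. Totality is cyclicity by \<open>cyclic_tail_total\<close>.\<close>

lemma is_P_tail:
  assumes P: "is_P N J H \<rho>" and J: "multiindex_over N J"
  shows "\<exists>v. cuntz_tail N H \<rho> (multiindex_letter J) v \<and>
    (\<forall>m n. cinner (v m) (v n) = of_bool (m mod multiindex_period J = n mod multiindex_period J)) \<and>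
    H = closed_cspan {word_op N \<rho> I (v n) | I n. set I \<subseteq> {1..N}}"
proof -
  note \<rho> = is_P_representation[OF P]
  have "\<exists>v. cuntz_tail N H \<rho> (multiindex_letter J) v \<and>
      (\<forall>m n. cinner (v m) (v n) = of_bool (m mod multiindex_period J = n mod multiindex_period J)) \<and>
      closure {app (\<rho> a) (v 0) | a. a \<in> cuntz_algebra N} = H"
  proof (cases J)
    case (FinIdx L)
    define k where "k = length L"
    have k: "k > 0" and L: "set L \<subseteq> {1..N}" using J FinIdx by (auto simp: k_def)
    obtain \<Omega> where \<Omega>: "unit_cyclic_vector (cuntz_algebra N) H \<rho> \<Omega>"
      "app (\<rho> (cuntz_word N L)) \<Omega> = \<Omega>"
      "orthonormal_family {1..k} (\<lambda>l. app (\<rho> (cuntz_word N (drop (l - 1) L))) \<Omega>)"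
      using P FinIdx by (auto simp: k_def)
    have \<Omega>H: "\<Omega> \<in> H" using \<Omega>(1) by (simp add: unit_cyclic_vector_def)
    \<comment> \<open>The suffixes of \<open>L\<close> act on \<open>\<Omega>\<close> in cyclic
      order; the wrap-around works because the whole word \<open>L\<close> fixes
      \<open>\<Omega>\<close>.\<close>
    define v where "v n = word_op N \<rho> (drop (n mod k) L) \<Omega>" for n
    have drop_set: "set (drop m L) \<subseteq> {1..N}" for m using L set_drop_subset[of m L] by blast
    have v_word: "v n = app (\<rho> (cuntz_word N (drop (n mod k) L))) \<Omega>" for n
      unfolding v_def by (simp add: rep_cuntz_word[OF \<rho> drop_set \<Omega>H])
    have v0: "v 0 = \<Omega>" using \<Omega>(2) by (simp add: v_word)
    have step: "v n = app (\<rho> (cuntz_gen N (L ! (n mod k)))) (v (Suc n))" for n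
    proof -
      have "drop (n mod k) L = L ! (n mod k) # drop (Suc (n mod k)) L"
        using k by (intro Cons_nth_drop_Suc[symmetric]) (simp add: k_def)
      then have "v n = app (\<rho> (cuntz_gen N (L ! (n mod k)))) (word_op N \<rho> (drop (Suc (n mod k)) L) \<Omega>)"
        by (simp add: v_def)
      also have "word_op N \<rho> (drop (Suc (n mod k)) L) \<Omega> = v (Suc n)"
      proof (cases "Suc (n mod k) = k")
        case True
        then have "v (Suc n) = v 0" by (simp add: v_def mod_Suc)
        then show ?thesis using True v0 by (simp add: k_def)
      next
        case False
        then show ?thesis by (simp add: v_def mod_Suc)
      qed
      finally show ?thesis .
    qed
    have "cuntz_tail N H \<rho> (multiindex_letter J) v"
      unfolding cuntz_tail_def
    proof (intro allI conjI)
      fix n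
      show "multiindex_letter J n \<in> {1..N}" by (rule multiindex_letter_in[OF J])
      show "v n \<in> H" unfolding v_def by (rule word_op_in[OF \<rho> drop_set \<Omega>H])
      show "v n = app (\<rho> (cuntz_gen N (multiindex_letter J n))) (v (Suc n))"
        using step[of n] by (simp add: FinIdx k_def)
    qed
    moreover have "cinner (v m) (v n) = of_bool (m mod k = n mod k)" for m n
    proof -
      \<comment> \<open>The family in \<open>is_P\<close> is numbered from 1: its member
        \<open>l\<close> drops \<open>l - 1\<close> letters.\<close>
      have "Suc (m mod k) \<in> {1..k}" "Suc (n mod k) \<in> {1..k}"
        using k by (auto simp: Suc_le_eq)
      with \<Omega>(3)[unfolded orthonormal_family_def, rule_format, of "Suc (m mod k)" "Suc (n mod k)"]
      show ?thesis by (simp add: v_word)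
    qed
    ultimately show ?thesis
      using \<Omega>(1) by (intro exI[of _ v]) (auto simp: FinIdx k_def v0 unit_cyclic_vector_def)
  next
    case (InfIdx L)
    obtain \<Omega> where \<Omega>: "unit_cyclic_vector (cuntz_algebra N) H \<rho> \<Omega>"
      "orthonormal_family {1..} (\<lambda>n. app (star (\<rho> (cuntz_word N (map L [1..<n+1])))) \<Omega>)"
      using P InfIdx by auto
    have \<Omega>H: "\<Omega> \<in> H" "norm \<Omega> = 1" using \<Omega>(1) by (simp_all add: unit_cyclic_vector_def)
    define v where "v n = app (star (\<rho> (cuntz_word N (map L [1..<n+1])))) \<Omega>" for n
    have L: "L n \<in> {1..N}" if "n \<ge> 1" for n
      using J that unfolding InfIdx multiindex_over.simps by blast
    have words: "set (map L [1..<n+1]) \<subseteq> {1..N}" for n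
      unfolding set_map by (intro image_subsetI L) (simp del: upt_Suc)
    have vH: "v n \<in> H" for n
      unfolding v_def star_hom_star[OF representation_hom[OF \<rho>] cuntz_word_in[OF words], symmetric]
      by (intro representation_in[OF \<rho>] cuntz_star cuntz_word_in words)
    have cinner_v: "cinner (v n) x = cinner \<Omega> (word_op N \<rho> (map L [1..<n+1]) x)" if "x \<in> H" for n x
      by (simp only: v_def cinner_star_left rep_cuntz_word[OF \<rho> words that])
    \<comment> \<open>\<open>cinner_v\<close> evaluates inner products with vectors of
      \<open>H\<close> only, which suffices to identify vectors of \<open>H\<close>.\<close>
    have eq_in_H: "x = y" if "x \<in> H" "y \<in> H" "\<And>z. z \<in> H \<Longrightarrow> cinner x z = cinner y z" for x y
    proof -
      have "x - y \<in> H" using that by (intro csubspace_diff representation_csubspace[OF \<rho>])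
      then have "cinner (x - y) (x - y) = 0" using that(3) by (simp add: cinner_diff_left[of x])
      then show ?thesis by (simp add: cinner_self)
    qed
    have v0: "v 0 = \<Omega>" using \<Omega>H vH by (intro eq_in_H) (simp_all add: cinner_v)
    define s where "s n = \<rho> (cuntz_gen N (L (Suc n)))" for n
    have s_in: "app (s n) x \<in> H" for n x
      unfolding s_def by (intro representation_in[OF \<rho>] cuntz_gen_in L) simp
    have cinner_v_Suc: "cinner (v (Suc n)) x = cinner (v n) (app (s n) x)" if "x \<in> H" for n x
      using that s_in by (simp add: cinner_v s_def)
    have v_Suc: "cinner (v m) (v n) = of_bool (m = n)" if "m \<ge> 1" "n \<ge> 1" for m n
      using \<Omega>(2) that unfolding orthonormal_family_def v_def by (simp del: upt_Suc)
    have v_norm: "cinner (v n) (v n) = 1" for n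
      using v_Suc[of n n] \<Omega>H(2) by (cases "n = 0") (simp_all add: v0 cinner_self)
    have s_isom: "cinner (app (s m) x) (app (s n) y) = (if L (Suc m) = L (Suc n) then cinner x y else 0)"
      if "x \<in> H" "y \<in> H" for m n x y
      unfolding s_def using that L by (intro rep_cinner_gen[OF \<rho>]) auto
    \<comment> \<open>Expanding \<open>cinner d d\<close> gives 1 - 1 - 1 + 1: both vectors are unit
      vectors, and moving the generator across shows that their inner product is that of
      \<open>v (Suc n)\<close> with itself.\<close>
    have step: "v n = app (s n) (v (Suc n))" for n
    proof -
      define d where "d = v n - app (s n) (v (Suc n))"
      have 1: "cinner (v n) (app (s n) (v (Suc n))) = 1"
        using cinner_v_Suc[OF vH, of n "Suc n"] v_norm by simp
      then have 2: "cinner (app (s n) (v (Suc n))) (v n) = 1"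
        using cinner_commute[of "app (s n) (v (Suc n))" "v n"] by simp
      have "cinner d d = 0"
        unfolding d_def cinner_diff_left cinner_diff_right
        using 1 2 v_norm s_isom[OF vH[of "Suc n"] vH[of "Suc n"], of n n] by simp
      then show ?thesis by (simp add: cinner_self d_def)
    qed
    have "cuntz_tail N H \<rho> (multiindex_letter J) v"
      unfolding cuntz_tail_def
    proof (intro allI conjI)
      fix n
      show "multiindex_letter J n \<in> {1..N}" by (rule multiindex_letter_in[OF J])
      show "v n = app (\<rho> (cuntz_gen N (multiindex_letter J n))) (v (Suc n))"
        using step[of n] by (simp add: InfIdx s_def)
    qed (rule vH)
    moreover have "cinner (v m) (v n) = of_bool (m = n)" for m n
    proof (cases "m = n")
      case False
      \<comment> \<open>Orthonormality is given for indices from 1 on; peeling one generator off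
        both vectors raises the indices and so includes \<open>v 0\<close>.\<close>
      have "cinner (v m) (v n) = cinner (app (s m) (v (Suc m))) (app (s n) (v (Suc n)))"
        by (simp flip: step)
      also have "\<dots> = 0" using False by (simp add: s_isom vH v_Suc)
      finally show ?thesis using False by simp
    qed (simp add: v_norm)
    ultimately show ?thesis
      using \<Omega>(1) by (intro exI[of _ v]) (auto simp: InfIdx v0 unit_cyclic_vector_def)
  qed
  then show ?thesis using cyclic_tail_total[OF \<rho>] by blast
qed

subsection \<open>Direct sums of representations\<close>

lemma hsum_eqI: "(\<And>i. coord f i = coord g i) \<Longrightarrow> f = g"
  by (rule coord_inject[THEN iffD1]) (rule ext)

lift_definition hsum_single :: "'i \<Rightarrow> 'h::chilbert_space \<Rightarrow> ('i, 'h) hsum"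
  is "\<lambda>i x j. if j = i then x else 0"
  by (rule finite_nonzero_values_imp_summable_on) (simp add: finite_subset[of _ "{_}"])

lemma cinner_hsum_single: "cinner (hsum_single i x) f = cinner x (coord f i)"
proof -
  have "cinner (hsum_single i x) f = (\<Sum>\<^sub>\<infinity>j. cinner (if j = i then x else 0) (coord f j))"
    by (simp add: cinner_hsum.rep_eq hsum_single.rep_eq)
  also have "\<dots> = (\<Sum>\<^sub>\<infinity>j\<in>{i}. cinner x (coord f j))"
    by (rule infsum_cong_neutral) (auto simp: cinner_zero_left)
  finally show ?thesis by simp
qed

lemma hsum_single_zero: "hsum_single i 0 = 0"
  and hsum_single_add: "hsum_single i (x + y) = hsum_single i x + hsum_single i y"
  and hsum_single_scaleC: "hsum_single i (c *\<^sub>C x) = c *\<^sub>C hsum_single i x"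
  by (rule hsum_eqI; simp add: hsum_single.rep_eq zero_hsum.rep_eq plus_hsum.rep_eq
      scaleC_hsum.rep_eq scaleC_zero_right)+

lemma bounded_linear_hsum_single: "bounded_linear (hsum_single i :: 'h::chilbert_space \<Rightarrow> _)"
proof (rule bounded_linear_intro[where K = 1])
  show "hsum_single i (r *\<^sub>R x) = r *\<^sub>R hsum_single i x" for r and x :: 'h
    using hsum_single_scaleC[of i "of_real r" x] by (simp add: scaleC_of_real)
  show "norm (hsum_single i x) \<le> norm x * 1" for x :: 'h
  proof -
    have "cinner (hsum_single i x) (hsum_single i x) = cinner x x"
      by (simp add: cinner_hsum_single hsum_single.rep_eq)
    then have "(norm (hsum_single i x))\<^sup>2 = (norm x)\<^sup>2" unfolding cinner_self of_real_eq_iff .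
    then show ?thesis by simp
  qed
qed (rule hsum_single_add)

lemma bounded_linear_coord: "bounded_linear (\<lambda>f. coord f i)"
  by (rule bounded_linear_intro[where K = 1])
     (simp_all add: plus_hsum.rep_eq scaleR_hsum.rep_eq norm_coord_le)

lemma csubspace_dsum_space:
  assumes "\<And>i. i \<in> I \<Longrightarrow> csubspace (H i)"
  shows "csubspace (dsum_space I H)"
  using assms
  by (auto simp: dsum_space_def csubspace_def zero_hsum.rep_eq plus_hsum.rep_eq scaleC_hsum.rep_eq
      scaleC_zero_right)

lemma closed_dsum_space:
  assumes "\<And>i. i \<in> I \<Longrightarrow> closed (H i)"
  shows "closed (dsum_space I H)"
proof -
  have "dsum_space I H = (\<Inter>i. (\<lambda>f. coord f i) -` (if i \<in> I then H i else {0}))"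
    by (auto simp: dsum_space_def split: if_splits)
  moreover have "closed \<dots>"
    using assms by (intro closed_INT ballI closed_vimage linear_continuous_on bounded_linear_coord) auto
  ultimately show ?thesis by simp
qed

text \<open>The difference of \<open>f\<close> and its projection to the span is orthogonal to every
  vector of \<open>H i\<close> placed in coordinate \<open>i\<close>, so all its coordinates vanish.
  This replaces an argument with convergent series.\<close>

lemma dsum_space_eq_closed_cspan:
  fixes H :: "'i \<Rightarrow> 'h::chilbert_space set"
  assumes H: "\<And>i. i \<in> I \<Longrightarrow> H i = closed_cspan (Y i)"
  shows "dsum_space I H = closed_cspan {hsum_single i y | i y. i \<in> I \<and> y \<in> Y i}"
    (is "_ = closed_cspan ?Z")
proof (rule antisym)
  define W where "W = closed_cspan ?Z"
  have W: "csubspace W" "closed W" "?Z \<subseteq> W"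
    unfolding W_def by (rule csubspace_closed_cspan closed_closed_cspan closed_cspan_superset)+
  have D: "csubspace (dsum_space I H)" "closed (dsum_space I H)"
    by (auto intro!: csubspace_dsum_space closed_dsum_space
        simp: H csubspace_closed_cspan closed_closed_cspan)
  have single_D: "hsum_single i y \<in> dsum_space I H" if "i \<in> I" "y \<in> H i" for i y
    using that csubspace_closed_cspan[of "Y _"] csubspace_0 H
    by (auto simp: dsum_space_def hsum_single.rep_eq)
  show WD: "closed_cspan ?Z \<subseteq> dsum_space I H"
    using closed_cspan_superset H by (intro closed_cspan_minimal D) (auto intro!: single_D)
  have single_W: "hsum_single i y \<in> W" if "i \<in> I" "y \<in> H i" for i y
  proof -
    have "closed_cspan (Y i) \<subseteq> hsum_single i -` W"
    proof (rule closed_cspan_minimal)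
      show "csubspace (hsum_single i -` W)"
        using W(1) by (auto simp: csubspace_def hsum_single_zero hsum_single_add hsum_single_scaleC)
      show "closed (hsum_single i -` W)"
        by (intro closed_vimage W linear_continuous_on bounded_linear_hsum_single)
    qed (use W(3) that in blast)
    then show ?thesis using that H by blast
  qed
  show "dsum_space I H \<subseteq> closed_cspan ?Z"
  proof
    fix f assume f: "f \<in> dsum_space I H"
    obtain p where p: "p \<in> W" "\<forall>y\<in>W. cinner y (f - p) = 0"
      using orthogonal_decomposition[OF W(1,2)] by blast
    have d: "f - p \<in> dsum_space I H"
      using f p(1) WD by (intro csubspace_diff D) (auto simp: W_def)
    have "coord (f - p) i = 0" for i
    proof (cases "i \<in> I")
      case True
      then have "coord (f - p) i \<in> H i" using d by (auto simp: dsum_space_def)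
      then have "cinner (hsum_single i (coord (f - p) i)) (f - p) = 0"
        using p(2) single_W[OF True] by blast
      then have "cinner (coord (f - p) i) (coord (f - p) i) = 0" unfolding cinner_hsum_single .
      then show ?thesis by (simp add: cinner_self)
    qed (use d in \<open>auto simp: dsum_space_def\<close>)
    then have "f - p = 0" by (intro hsum_eqI) (simp add: zero_hsum.rep_eq)
    then show "f \<in> closed_cspan ?Z" using p(1) by (simp add: W_def)
  qed
qed

text \<open>\<open>dsum_rep\<close> is a definite description; the coordinatewise operator exists
  because \<open>norm (\<rho> i a) \<le> norm a\<close> holds uniformly in \<open>i\<close>.\<close>

lemma coord_dsum_rep:
  fixes \<rho> :: "'i \<Rightarrow> 'a::cstar_algebra \<Rightarrow> 'h::chilbert_space bop"
  assumes A: "cstar_subalgebra A" and \<rho>: "\<And>i. i \<in> I \<Longrightarrow> representation A (H i) (\<rho> i)" and a: "a \<in> A"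
  shows "coord (app (dsum_rep I \<rho> a) f) i = (if i \<in> I then app (\<rho> i a) (coord f i) else 0)"
proof -
  define g where "g f i = (if i \<in> I then app (\<rho> i a) (coord f i) else 0)" for f i
  have g_le: "norm (g f i) \<le> norm a * norm (coord f i)" for f i
  proof (cases "i \<in> I")
    case True
    have "norm (app (\<rho> i a) (coord f i)) \<le> norm (\<rho> i a) * norm (coord f i)" by (rule norm_app)
    also have "\<dots> \<le> norm a * norm (coord f i)"
      by (intro mult_right_mono star_hom_norm_le[OF A representation_hom[OF \<rho>[OF True]] a]) simp
    finally show ?thesis using True by (simp add: g_def)
  qed (simp add: g_def)
  have L2: "L2_set (\<lambda>i. norm (g f i)) F \<le> norm a * norm f" if "finite F" for f F
  proof -
    have "L2_set (\<lambda>i. norm (g f i)) F \<le> L2_set (\<lambda>i. norm a * norm (coord f i)) F"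
      by (intro L2_set_mono g_le) simp
    also have "\<dots> = norm a * L2_set (\<lambda>i. norm (coord f i)) F" by (simp add: L2_set_right_distrib)
    also have "\<dots> \<le> norm a * norm f" by (intro mult_left_mono L2_set_coord_le that) simp
    finally show ?thesis .
  qed
  define G where "G f = Abs_hsum (g f)" for f
  have coord_G: "coord (G f) = g f" for f
    unfolding G_def using l2_finite_bound(1)[OF L2] by (intro Abs_hsum_inverse) simp
  have bl: "bounded_linear G"
  proof (rule bounded_linear_intro[where K = "norm a"])
    show "G (x + y) = G x + G y" for x y
      by (rule hsum_eqI) (simp add: coord_G plus_hsum.rep_eq g_def app_add)
    show "G (r *\<^sub>R x) = r *\<^sub>R G x" for r x
      by (rule hsum_eqI) (simp add: coord_G scaleR_hsum.rep_eq g_def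
          linear_scale[OF bounded_linear.linear[OF bounded_linear_app]])
    show "norm (G x) \<le> norm x * norm a" for x
      using L2[of _ x] by (intro norm_hsum_bound) (simp add: coord_G mult.commute)
  qed
  have GC: "G (c *\<^sub>C x) = c *\<^sub>C G x" for c x
    by (rule hsum_eqI) (simp add: coord_G scaleC_hsum.rep_eq g_def app_scaleC scaleC_zero_right)
  obtain C where C: "app C = G" using ex_bop[OF bl GC] .
  have "\<forall>f i. coord (app (dsum_rep I \<rho> a) f) i = (if i \<in> I then app (\<rho> i a) (coord f i) else 0)"
    unfolding dsum_rep_def
    by (rule theI[where a = C]) (auto simp: C coord_G g_def intro!: app_eqI hsum_eqI)
  then show ?thesis by blast
qed

lemma representation_dsum:
  assumes A: "cstar_subalgebra A" "alg_unit A \<in> A"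
    and \<rho>: "\<And>i. i \<in> I \<Longrightarrow> representation A (H i) (\<rho> i)"
  shows "representation A (dsum_space I H) (dsum_rep I \<rho>)"
proof -
  note crd = coord_dsum_rep[OF A(1) \<rho>]
  have D: "csubspace (dsum_space I H)" "closed (dsum_space I H)"
    by (auto intro!: csubspace_dsum_space closed_dsum_space
        representation_csubspace[OF \<rho>] representation_closed[OF \<rho>])
  have closedA: "\<And>a b. a \<in> A \<Longrightarrow> b \<in> A \<Longrightarrow> a + b \<in> A" "\<And>a c. a \<in> A \<Longrightarrow> c *\<^sub>C a \<in> A"
    using cstar_subalgebra_csubspace[OF A(1)] by (auto simp: csubspace_add csubspace_scaleC)
  have ops: "dsum_rep I \<rho> a \<in> bounded_ops (dsum_space I H)" if a: "a \<in> A" for a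
    unfolding bounded_ops_def
  proof (intro CollectI conjI allI impI)
    show "app (dsum_rep I \<rho> a) f \<in> dsum_space I H" for f
      by (simp add: dsum_space_def crd[OF _ a] representation_in[OF \<rho> a])
    fix f assume f: "\<forall>g\<in>dsum_space I H. cinner g f = 0"
    show "app (dsum_rep I \<rho> a) f = 0"
    proof (rule hsum_eqI)
      fix i
      have "app (\<rho> i a) (coord f i) = 0" if i: "i \<in> I"
      proof -
        have "cinner y (coord f i) = 0" if "y \<in> H i" for y
        proof -
          \<comment> \<open>Vectors supported at \<open>i\<close> show that this coordinate of
            \<open>f\<close> lies in the orthogonal complement of \<open>H i\<close>, where
            \<open>\<rho> i a\<close> vanishes.\<close>
          have "hsum_single i y \<in> dsum_space I H"
            using that i csubspace_0[OF representation_csubspace[OF \<rho>]]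
            by (auto simp: dsum_space_def hsum_single.rep_eq)
          then show ?thesis using f by (simp flip: cinner_hsum_single)
        qed
        then show ?thesis
          using star_hom_in[OF representation_hom[OF \<rho>[OF i]] a] by (auto simp: bounded_ops_def)
      qed
      then show "coord (app (dsum_rep I \<rho> a) f) i = coord 0 i"
        by (simp add: crd[OF _ a] zero_hsum.rep_eq)
    qed
  qed
  have star: "dsum_rep I \<rho> (star a) = star (dsum_rep I \<rho> a)" if a: "a \<in> A" for a
  proof (rule app_eqI, rule cinner_eqI_left)
    fix f g
    have "cinner (app (dsum_rep I \<rho> (star a)) f) g = cinner f (app (dsum_rep I \<rho> a) g)"
      unfolding cinner_hsum.rep_eq using a
      by (intro infsum_cong) (simp add: crd cstar_subalgebra_star[OF A(1)]
          star_hom_star[OF representation_hom[OF \<rho>]] cinner_star_left cinner_zero_left cinner_zero_right)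
    then show "cinner (app (dsum_rep I \<rho> (star a)) f) g = cinner (app (star (dsum_rep I \<rho> a)) f) g"
      by (simp add: cinner_star_left)
  qed
  have unit: "alg_unit (bounded_ops (dsum_space I H)) = dsum_rep I \<rho> (alg_unit A)"
    by (rule alg_unit_bounded_ops_eqI[OF D ops[OF A(2)]], rule hsum_eqI)
       (simp add: crd[OF _ A(2)] dsum_space_def representation_unit[OF \<rho>])
  have "unital_star_hom A (bounded_ops (dsum_space I H)) (dsum_rep I \<rho>)"
    unfolding unital_star_hom_def
  proof (intro conjI ballI allI)
    fix a b assume a: "a \<in> A" and b: "b \<in> A"
    show "dsum_rep I \<rho> (a + b) = dsum_rep I \<rho> a + dsum_rep I \<rho> b"
      using a b by (intro app_eqI hsum_eqI)
        (simp add: crd closedA star_hom_add[OF representation_hom[OF \<rho>]] app_plus_op plus_hsum.rep_eq)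
    show "dsum_rep I \<rho> (a * b) = dsum_rep I \<rho> a * dsum_rep I \<rho> b"
      using a b by (intro app_eqI hsum_eqI)
        (simp add: crd cstar_subalgebra_mult[OF A(1)] star_hom_mult[OF representation_hom[OF \<rho>]] app_times_op)
  next
    fix c a assume a: "a \<in> A"
    then show "dsum_rep I \<rho> (c *\<^sub>C a) = c *\<^sub>C dsum_rep I \<rho> a"
      by (intro app_eqI hsum_eqI)
        (simp add: crd closedA star_hom_scaleC[OF representation_hom[OF \<rho>]] app_scaleC_op
          scaleC_hsum.rep_eq scaleC_zero_right)
  qed (simp_all add: ops star unit)
  then show ?thesis using D by (simp add: representation_def)
qed

lemma dsum_rep_single:
  assumes "cstar_subalgebra A" "\<And>i. i \<in> I \<Longrightarrow> representation A (H i) (\<rho> i)" "a \<in> A" "i \<in> I"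
  shows "app (dsum_rep I \<rho> a) (hsum_single i x) = hsum_single i (app (\<rho> i a) x)"
  using assms(4) by (intro hsum_eqI) (simp add: coord_dsum_rep[OF assms(1-3)] hsum_single.rep_eq app_zero)

text \<open>By \<open>cinner_tail_words\<close>, inner products of words on tails depend only on
  letters and on inner products of tail vectors. So a word on \<open>x i\<close> can be paired with
  the same word on \<open>v i\<close>, placed in coordinate \<open>i\<close>, and
  \<open>unitarily_equivalent_gram\<close> applies.\<close>

lemma unitarily_equivalent_dsum_tails:
  assumes \<pi>: "representation (cuntz_algebra N) T \<pi>"
    and \<rho>: "\<And>i. i \<in> D \<Longrightarrow> representation (cuntz_algebra N) (H i) (\<rho> i)"
    and x: "\<And>i. i \<in> D \<Longrightarrow> cuntz_tail N T \<pi> (J i) (x i)"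
    and v: "\<And>i. i \<in> D \<Longrightarrow> cuntz_tail N (H i) (\<rho> i) (J i) (v i)"
    and gram: "\<And>i p q. i \<in> D \<Longrightarrow> cinner (x i p) (x i q) = cinner (v i p) (v i q)"
    and orth: "\<And>i j p q. i \<in> D \<Longrightarrow> j \<in> D \<Longrightarrow> i \<noteq> j \<Longrightarrow> cinner (x i p) (x j q) = 0"
    and T: "T = closed_cspan {word_op N \<pi> I (x i p) | I i p. i \<in> D \<and> set I \<subseteq> {1..N}}"
    and H: "\<And>i. i \<in> D \<Longrightarrow> H i = closed_cspan {word_op N (\<rho> i) I (v i p) | I p. set I \<subseteq> {1..N}}"
  shows "unitarily_equivalent (cuntz_algebra N) T \<pi> (dsum_space D H) (dsum_rep D \<rho>)"
proof -
  let ?p = "\<lambda>I i p. (word_op N \<pi> I (x i p), hsum_single i (word_op N (\<rho> i) I (v i p)))"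
  define X where "X = {?p I i p | I i p. i \<in> D \<and> set I \<subseteq> {1..N}}"
  have X_in: "?p I i p \<in> X" if "i \<in> D" "set I \<subseteq> {1..N}" for I i p
    using that unfolding X_def by blast
  have X_E: "\<exists>I i p. z = ?p I i p \<and> i \<in> D \<and> set I \<subseteq> {1..N}" if "z \<in> X" for z
    using that unfolding X_def by blast
  have rep_D: "representation (cuntz_algebra N) (dsum_space D H) (dsum_rep D \<rho>)"
    by (rule representation_dsum[OF cstar_subalgebra_cuntz alg_unit_cuntz_in \<rho>])
  have single: "app (dsum_rep D \<rho> a) (hsum_single i y) = hsum_single i (app (\<rho> i a) y)"
    if "i \<in> D" "a \<in> cuntz_algebra N" for i a y
    by (rule dsum_rep_single[OF cstar_subalgebra_cuntz \<rho> that(2,1)])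
  have single_star: "app (star (dsum_rep D \<rho> a)) (hsum_single i y) = hsum_single i (app (star (\<rho> i a)) y)"
    if "i \<in> D" "a \<in> cuntz_algebra N" for i a y
    using single[OF that(1) cuntz_star[OF that(2)], of y]
    by (simp add: star_hom_star[OF representation_hom[OF rep_D] that(2)]
        star_hom_star[OF representation_hom[OF \<rho>[OF that(1)]] that(2)])
  show ?thesis
  proof (rule unitarily_equivalent_gram[OF \<pi> rep_D, of X])
    show "gram_preserving X"
      unfolding gram_preserving_def
    proof (intro ballI)
      fix z z' assume "z \<in> X" "z' \<in> X"
      then obtain I i p I' j q where z: "z = ?p I i p" "i \<in> D" "set I \<subseteq> {1..N}"
        and z': "z' = ?p I' j q" "j \<in> D" "set I' \<subseteq> {1..N}"
        using X_E by metis
      show "cinner (fst z) (fst z') = cinner (snd z) (snd z')"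
      proof (cases "i = j")
        case True
        then show ?thesis
          using z z' by (simp add: cinner_hsum_single hsum_single.rep_eq gram
              cinner_tail_words[OF \<pi> x x] cinner_tail_words[OF \<rho> v v])
      next
        \<comment> \<open>On the right the two vectors sit in different coordinates; on the left
          padding leads to tail vectors with different indices, to which \<open>orth\<close>
          applies.\<close>
        case False
        then show ?thesis
          using z z' by (simp add: cinner_hsum_single hsum_single.rep_eq cinner_zero_right orth
              cinner_tail_words[OF \<pi> x x])
      qed
    qed
    have "fst ` X = {word_op N \<pi> I (x i p) | I i p. i \<in> D \<and> set I \<subseteq> {1..N}}"
      by (force simp: X_def)
    then show "T = closed_cspan (fst ` X)" using T by simp
    have "snd ` X = {hsum_single i y | i y. i \<in> D \<and>
        y \<in> {word_op N (\<rho> i) I (v i p) | I p. set I \<subseteq> {1..N}}}"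
      by (force simp: X_def)
    then show "dsum_space D H = closed_cspan (snd ` X)"
      using dsum_space_eq_closed_cspan[OF H] by simp
  next
    fix l z assume l: "l \<in> {1..N}" and "z \<in> X"
    then obtain I i p where z: "z = ?p I i p" "i \<in> D" "set I \<subseteq> {1..N}" using X_E by metis
    have "(app (\<pi> (cuntz_gen N l)) (fst z), app (dsum_rep D \<rho> (cuntz_gen N l)) (snd z)) = ?p (l # I) i p"
      by (simp add: z single[OF z(2) cuntz_gen_in[OF l]])
    also have "\<dots> \<in> X" using l z by (intro X_in) auto
    finally show "(app (\<pi> (cuntz_gen N l)) (fst z), app (dsum_rep D \<rho> (cuntz_gen N l)) (snd z)) \<in> insert 0 X"
      by blast
    \<comment> \<open>Both tails follow the letters \<open>J i\<close>, so one case distinction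
      governs both components.\<close>
    have star_z: "(app (star (\<pi> (cuntz_gen N l))) (fst z), app (star (dsum_rep D \<rho> (cuntz_gen N l))) (snd z)) =
      (case I of [] \<Rightarrow> if l = J i p then ?p [] i (Suc p) else 0
       | h # I' \<Rightarrow> if l = h then ?p I' i p else 0)"
      unfolding z(1) fst_conv snd_conv single_star[OF z(2) cuntz_gen_in[OF l]]
        star_gen_tail_word[OF \<pi> x[OF z(2)] l z(3)] star_gen_tail_word[OF \<rho>[OF z(2)] v[OF z(2)] l z(3)]
      by (simp add: hsum_single_zero zero_prod_def split: list.split)
    show "(app (star (\<pi> (cuntz_gen N l))) (fst z),
        app (star (dsum_rep D \<rho> (cuntz_gen N l))) (snd z)) \<in> insert 0 X"
    proof (cases I)
      case Nil
      then show ?thesis unfolding star_z using X_in[OF z(2), of "[]"] by simp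
    next
      case (Cons h I')
      then show ?thesis unfolding star_z using X_in[OF z(2), of I'] z(3) by simp
    qed
  qed
qed


subsection \<open>Arithmetic of periods\<close>

text \<open>Over the integers this is divisibility of the difference by a least common multiple;
  modulus 0, meaning equality, is included and serves infinite multiindices.\<close>

lemma mod_lcm_eq_iff: "m mod lcm a b = n mod lcm a b \<longleftrightarrow> m mod a = n mod a \<and> m mod b = n mod b"
  for a b m n :: nat
proof -
  have "[int m = int n] (mod int (lcm a b)) \<longleftrightarrow> [int m = int n] (mod int a) \<and> [int m = int n] (mod int b)"
    unfolding cong_iff_dvd_diff lcm_int_int_eq[symmetric] by (rule lcm_least_iff)
  then show ?thesis unfolding cong_int_iff by (simp add: cong_def)
qed

text \<open>Both congruences survive modulo the gcd, where they leave \<open>k\<close> and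
  \<open>k'\<close> congruent. This yields orthogonality of different summands.\<close>

lemma gcd_shift_unique:
  fixes a b k k' m n :: nat
  assumes "m mod a = n mod a" "(m + k) mod b = (n + k') mod b" "k < gcd a b" "k' < gcd a b"
  shows "k = k'"
proof -
  have mn: "[m = n] (mod gcd a b)"
    by (rule cong_dvd_modulus_nat[of _ _ a]) (simp_all add: cong_def assms(1))
  have "[m + k = n + k'] (mod gcd a b)"
    by (rule cong_dvd_modulus_nat[of _ _ b]) (simp_all add: cong_def assms(2))
  then have "[m + k = m + k'] (mod gcd a b)"
    by (rule cong_trans[OF _ cong_sym[OF cong_add[OF mn cong_refl]]])
  then have "[k = k'] (mod gcd a b)" by (simp only: cong_add_lcancel_nat)
  then show ?thesis using assms(3,4) by (simp add: cong_def)
qed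

text \<open>The Chinese remainder theorem: \<open>k\<close> is the residue of \<open>n - m\<close>
  modulo the gcd, and the remaining multiple of the gcd is congruent to some \<open>a * x\<close>
  modulo \<open>b\<close>. This yields totality of the summands.\<close>

lemma gcd_shift_exists:
  fixes a b m n :: nat
  assumes "b > 0"
  shows "\<exists>k<gcd a b. \<exists>q. q mod a = m mod a \<and> (q + k) mod b = n mod b"
proof -
  \<comment> \<open>Adding \<open>b * m\<close> keeps the residue modulo \<open>b\<close> and makes
    the natural subtraction \<open>n' - m\<close> exact.\<close>
  define n' where "n' = n + b * m"
  define k where "k = (n' - m) mod gcd a b"
  define d where "d = gcd a b * ((n' - m) div gcd a b)"
  have "n' \<ge> m" using assms by (cases b) (auto simp: n'_def)
  moreover have "d + k = n' - m" by (simp add: k_def d_def mult.commute)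
  ultimately have n': "m + d + k = n'" by simp
  obtain x where "[a * x = d] (mod b)" using cong_solve_dvd_nat[of a b d] by (auto simp: d_def)
  then have "[m + a * x + k = m + d + k] (mod b)" by (intro cong_add cong_refl)
  then have "(m + a * x + k) mod b = n mod b" by (simp add: n' cong_def) (simp add: n'_def)
  moreover have "k < gcd a b" using assms by (simp add: k_def)
  ultimately show ?thesis by (intro exI[of _ k] conjI exI[of _ "m + a * x"]) auto
qed


subsection \<open>Shifted and product multiindices\<close>

lemma list_power_nth: "n < m * length J \<Longrightarrow> list_power J m ! n = J ! (n mod length J)"
proof (induction m arbitrary: n)
  case (Suc m)
  then show ?case
    by (auto simp: list_power_def nth_append le_mod_geq not_less)
qed simp

lemma length_list_power: "length (list_power J m) = m * length J"
  by (induction m) (auto simp: list_power_def)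

lemma multiindex_overI:
  assumes "\<And>n. multiindex_letter J n \<in> {1..N}" "J \<noteq> FinIdx []"
  shows "multiindex_over N J"
proof (cases J)
  case (FinIdx L)
  have "set L \<subseteq> {1..N}"
  proof
    fix l assume "l \<in> set L"
    then obtain n where "n < length L" "L ! n = l" by (auto simp: in_set_conv_nth)
    then show "l \<in> {1..N}" using assms(1)[of n] FinIdx by simp
  qed
  then show ?thesis using FinIdx assms(2) by simp
next
  case (InfIdx L)
  have "L n \<in> {1..N}" if "n \<ge> 1" for n
    using assms(1)[of "n - 1"] InfIdx that by simp
  then show ?thesis unfolding InfIdx multiindex_over.simps by blast
qed

text \<open>Shifts are numbered from 1, so shift \<open>k + 1\<close> rotates by
  \<open>k\<close>.\<close>

lemma multiindex_letter_shift_finite: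
  assumes "k < length L"
  shows "multiindex_letter (multiindex_shift (FinIdx L) (int k + 1)) n = multiindex_letter (FinIdx L) (n + k)"
proof -
  have lt: "n mod length L < length L" using assms by (intro mod_less_divisor) linarith
  have "drop k L @ take k L = rotate k L" using assms by (simp add: rotate_drop_take)
  then show ?thesis
    using nth_rotate[OF lt, of k] assms by (simp add: add.commute mod_simps)
qed

lemma multiindex_period_shift: "multiindex_period (multiindex_shift L i) = multiindex_period L"
  by (cases L) auto

lemma is_infinite_shift: "is_infinite (multiindex_shift L i) = is_infinite L"
  by (cases L) auto

lemma multiindex_shift_nonempty: "L \<noteq> FinIdx [] \<Longrightarrow> multiindex_shift L i \<noteq> FinIdx []"
  by (cases L) auto

text \<open>Passing to letters and periods makes the three cases of the product uniform, since an
  lcm with 0 is 0. The first assumption rules out the combination for which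
  \<open>multiindex_star\<close> is undefined.\<close>

lemma multiindex_star_letter:
  assumes "is_infinite L \<longrightarrow> is_infinite K" "K \<noteq> FinIdx []" "L \<noteq> FinIdx []"
  shows "multiindex_letter (multiindex_star M K L) n = M * (multiindex_letter K n - 1) + multiindex_letter L n"
    and "multiindex_period (multiindex_star M K L) = lcm (multiindex_period K) (multiindex_period L)"
    and "multiindex_star M K L \<noteq> FinIdx []"
proof -
  have "multiindex_letter (multiindex_star M K L) n = M * (multiindex_letter K n - 1) + multiindex_letter L n
    \<and> multiindex_period (multiindex_star M K L) = lcm (multiindex_period K) (multiindex_period L)
    \<and> multiindex_star M K L \<noteq> FinIdx []"
  proof (cases K)
    case K: (FinIdx k)
    obtain l where L: "L = FinIdx l" using assms K by (cases L) auto
    define C where "C = lcm (length k) (length l)"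
    have C: "C > 0" "length k dvd C" "length l dvd C" using assms K L by (auto simp: C_def lcm_pos_nat)
    have len: "length (list_dot M (list_power k (C div length k)) (list_power l (C div length l))) = C"
      using C by (simp add: list_dot_def length_list_power)
    have "n mod C < C" using C by simp
    then have "list_dot M (list_power k (C div length k)) (list_power l (C div length l)) ! (n mod C) =
        M * (k ! (n mod length k) - 1) + l ! (n mod length l)"
      using C by (simp add: list_dot_def length_list_power list_power_nth mod_mod_cancel)
    then show ?thesis using len C K L by (auto simp: Let_def simp flip: C_def)
  next
    case (InfIdx k)
    then show ?thesis by (cases L) (auto simp: seq_dot_def periodic_def)
  qed
  then show "multiindex_letter (multiindex_star M K L) n = M * (multiindex_letter K n - 1) + multiindex_letter L n"
    and "multiindex_period (multiindex_star M K L) = lcm (multiindex_period K) (multiindex_period L)"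
    and "multiindex_star M K L \<noteq> FinIdx []" by blast+
qed

text \<open>The equality case of Cauchy-Schwarz; it turns entries 1 of a Gram matrix into equal
  vectors.\<close>

lemma cinner_unit_eq:
  assumes "cinner x x = 1" "cinner y y = 1" "cinner x y = 1"
  shows "x = (y :: 'h::chilbert_space)"
proof -
  have "cinner (x - y) (x - y) = 0"
    unfolding cinner_diff_left cinner_diff_right using assms cinner_commute[of y x] by simp
  then show ?thesis by (simp add: cinner_self)
qed

text \<open>Index pairs matter only modulo the periods, and common shifts move along one tail, so
  each \<open>u i\<close> represents one class of pairs. The third conclusion will make the summands
  orthogonal; the fourth says that no pair is missed.\<close>

lemma shifted_tails:
  assumes \<rho>: "representation (cuntz_algebra M) H \<rho>" and M: "M \<ge> 1"
    and w: "cuntz_tail M H \<rho> (multiindex_letter L) w"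
    and gram: "\<And>m n. cinner (w m) (w n) = of_bool (m mod multiindex_period L = n mod multiindex_period L)"
    and L: "L \<noteq> FinIdx []" "is_infinite L \<longrightarrow> is_infinite K"
  obtains u :: "int \<Rightarrow> nat \<Rightarrow> 'h::chilbert_space" where
    "\<forall>i\<in>decomposition_index K L. cuntz_tail M H \<rho> (multiindex_letter (multiindex_shift L i)) (u i)"
    and "\<forall>i\<in>decomposition_index K L. \<forall>m n.
      cinner (u i m) (u i n) = of_bool (m mod multiindex_period L = n mod multiindex_period L)"
    and "\<forall>i\<in>decomposition_index K L. \<forall>j\<in>decomposition_index K L. \<forall>m n. i \<noteq> j \<longrightarrow>
      m mod multiindex_period K = n mod multiindex_period K \<longrightarrow> cinner (u i m) (u j n) = 0"
    and "\<forall>m n. \<exists>i\<in>decomposition_index K L. \<exists>q.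
      q mod multiindex_period K = m mod multiindex_period K \<and> u i q = w n"
proof (cases L)
  case (FinIdx l)
  define a b where "a = multiindex_period K" and "b = length l"
  have b: "b > 0" using FinIdx L by (simp add: b_def)
  \<comment> \<open>An infinite \<open>K\<close> has \<open>a = 0\<close>, and
    \<open>gcd 0 b = b\<close>, so two cases of the decomposition merge.\<close>
  have D: "decomposition_index K L = {1..int (gcd a b)}"
    by (cases K) (simp_all add: FinIdx a_def b_def)
  have bp: "multiindex_period L = b" by (simp add: FinIdx b_def)
  have g_le: "gcd a b \<le> b" using b by (simp add: gcd_le2_nat)
  define u where "u i n = w (n + nat (i - 1))" for i n
  show thesis
  proof (rule that[of u]; (unfold D bp a_def[symmetric])?; intro ballI allI impI)
    fix i assume "i \<in> {1..int (gcd a b)}"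
    then obtain k where k: "i = int k + 1" "k < gcd a b"
      by (intro that[of "nat (i - 1)"]) auto
    have letter: "multiindex_letter (multiindex_shift L i) n = multiindex_letter L (n + k)" for n
      using multiindex_letter_shift_finite[of k l n] k g_le by (simp add: FinIdx b_def)
    have u_i: "u i n = w (n + k)" for n by (simp add: u_def k)
    show "cuntz_tail M H \<rho> (multiindex_letter (multiindex_shift L i)) (u i)"
      unfolding cuntz_tail_def letter u_i add_Suc using w[unfolded cuntz_tail_def] by blast
  next
    fix i m n
    show "cinner (u i m) (u i n) = of_bool (m mod b = n mod b)"
      unfolding u_def gram bp using cong_add_rcancel_nat[of m "nat (i - 1)" n b]
      by (simp add: cong_def)
  next
    fix i j m n
    assume i: "i \<in> {1..int (gcd a b)}" and j: "j \<in> {1..int (gcd a b)}" and "i \<noteq> j"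
      and "m mod a = n mod a"
    moreover have "nat (i - 1) < gcd a b" "nat (j - 1) < gcd a b" using i j by auto
    ultimately have "(m + nat (i - 1)) mod b \<noteq> (n + nat (j - 1)) mod b"
      using gcd_shift_unique[of m a n "nat (i - 1)" b "nat (j - 1)"] by auto
    then show "cinner (u i m) (u j n) = 0" by (simp add: u_def gram bp)
  next
    fix m n
    obtain k q where k: "k < gcd a b" "q mod a = m mod a" "(q + k) mod b = n mod b"
      using gcd_shift_exists[OF b, of a m n] by blast
    \<comment> \<open>Both are unit vectors, and \<open>q + k\<close> is congruent to
      \<open>n\<close> modulo \<open>b\<close>, so their inner product is 1.\<close>
    have "u (int k + 1) q = w n"
      unfolding u_def by (rule cinner_unit_eq) (simp_all add: gram bp k)
    then show "\<exists>i\<in>{1..int (gcd a b)}. \<exists>q. q mod a = m mod a \<and> u i q = w n"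
      using k by (intro bexI[of _ "int k + 1"] exI[of _ q]) auto
  qed
next
  case (InfIdx l)
  then obtain k where K: "K = InfIdx k" using L by (cases K) auto
  have one: "set (replicate p 1) \<subseteq> {1..M}" for p using M by auto
  have wH: "w n \<in> H" for n by (rule cuntz_tail_in[OF w])
  \<comment> \<open>This is \<open>w\<close> at index \<open>n + i\<close>; a negative index is
    realized by that many generators with letter 1 in front of \<open>w 0\<close>, matching the
    default letter of \<open>multiindex_shift\<close>.\<close>
  define u where "u i n = word_op M \<rho> (replicate (nat (- (int n + i))) 1) (w (nat (int n + i)))" for i n
  have u_eq: "cinner (u i n) (u i n) = 1" for i n
    unfolding u_def using cinner_word_op[OF \<rho> refl one one wH wH] gram by simp
  have u_neq: "cinner (u i m) (u j n) = 0" if "int m + i \<noteq> int n + j" for i j m n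
  proof -
    \<comment> \<open>Tail index minus prefix length is \<open>m + i\<close> on one side and
      \<open>n + j\<close> on the other. Padding to equal length preserves the gap between these
      numbers, so the padded tail indices differ.\<close>
    have "nat (int m + i) + (nat (- (int n + j)) - nat (- (int m + i))) \<noteq>
        nat (int n + j) + (nat (- (int m + i)) - nat (- (int n + j)))"
      using that by linarith
    then show ?thesis
      unfolding u_def cinner_tail_words[OF \<rho> w w one one] by (simp add: gram InfIdx)
  qed
  show thesis
  proof (rule that[of u]; intro ballI allI impI)
    fix i
    show "cuntz_tail M H \<rho> (multiindex_letter (multiindex_shift L i)) (u i)"
      unfolding cuntz_tail_def
    proof (intro allI conjI)
      fix n
      show "u i n \<in> H" unfolding u_def by (rule word_op_in[OF \<rho> one wH])
      have "multiindex_letter (multiindex_shift L i) n \<in> {1..M} \<and>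
        u i n = app (\<rho> (cuntz_gen M (multiindex_letter (multiindex_shift L i) n))) (u i (Suc n))"
      proof (cases "int n + i \<ge> 0")
        case True
        then have "multiindex_letter (multiindex_shift L i) n = multiindex_letter L (nat (int n + i))"
          by (simp add: InfIdx algebra_simps Suc_nat_eq_nat_zadd1)
        moreover have "u i (Suc n) = w (Suc (nat (int n + i)))" "u i n = w (nat (int n + i))"
          using True by (simp_all add: u_def Suc_nat_eq_nat_zadd1 algebra_simps)
        ultimately show ?thesis
          using cuntz_tail_letter[OF w] cuntz_tail_step[OF w] by metis
      next
        case False
        then have "multiindex_letter (multiindex_shift L i) n = 1"
          by (simp add: InfIdx)
        moreover have "nat (- (int n + i)) = Suc (nat (- (int (Suc n) + i)))"
          "nat (int n + i) = 0" "nat (int (Suc n) + i) = 0" using False by linarith+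
        ultimately show ?thesis using M by (simp only: u_def replicate_Suc word_op_simps) simp
      qed
      then show "multiindex_letter (multiindex_shift L i) n \<in> {1..M}"
        "u i n = app (\<rho> (cuntz_gen M (multiindex_letter (multiindex_shift L i) n))) (u i (Suc n))"
        by blast+
    qed
  next
    fix i m n
    show "cinner (u i m) (u i n) = of_bool (m mod multiindex_period L = n mod multiindex_period L)"
      using u_eq u_neq by (cases "m = n") (simp_all add: InfIdx)
  next
    fix i j :: int and m n assume "i \<noteq> j" "m mod multiindex_period K = n mod multiindex_period K"
    then show "cinner (u i m) (u j n) = 0" by (intro u_neq) (simp add: K)
  next
    fix m n
    \<comment> \<open>Over the integers every difference of positions occurs as a shift.\<close>
    have "u (int n - int m) m = w n" by (simp add: u_def)
    then show "\<exists>i\<in>decomposition_index K L. \<exists>q.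
      q mod multiindex_period K = m mod multiindex_period K \<and> u i q = w n"
      by (auto simp: InfIdx K)
  qed
qed

subsection \<open>The tensor product representation\<close>

lemma representation_comp:
  assumes \<phi>: "unital_star_hom A B \<phi>" and \<pi>: "representation B T \<pi>"
  shows "representation A T (\<pi> \<circ> \<phi>)"
  using assms unfolding representation_def unital_star_hom_def by simp

lemma hilbert_tensorD:
  assumes "hilbert_tensor H\<^sub>1 H\<^sub>2 T t"
  shows hilbert_tensor_add_left: "x \<in> H\<^sub>1 \<Longrightarrow> x' \<in> H\<^sub>1 \<Longrightarrow> y \<in> H\<^sub>2 \<Longrightarrow> t (x + x') y = t x y + t x' y"
    and hilbert_tensor_add_right: "x \<in> H\<^sub>1 \<Longrightarrow> y \<in> H\<^sub>2 \<Longrightarrow> y' \<in> H\<^sub>2 \<Longrightarrow> t x (y + y') = t x y + t x y'"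
    and hilbert_tensor_scaleC_left: "x \<in> H\<^sub>1 \<Longrightarrow> y \<in> H\<^sub>2 \<Longrightarrow> t (c *\<^sub>C x) y = c *\<^sub>C t x y"
    and hilbert_tensor_scaleC_right: "x \<in> H\<^sub>1 \<Longrightarrow> y \<in> H\<^sub>2 \<Longrightarrow> t x (c *\<^sub>C y) = c *\<^sub>C t x y"
    and hilbert_tensor_cinner: "x \<in> H\<^sub>1 \<Longrightarrow> x' \<in> H\<^sub>1 \<Longrightarrow> y \<in> H\<^sub>2 \<Longrightarrow> y' \<in> H\<^sub>2 \<Longrightarrow>
      cinner (t x y) (t x' y') = cinner x x' * cinner y y'"
    and hilbert_tensor_span: "T = closed_cspan {t x y | x y. x \<in> H\<^sub>1 \<and> y \<in> H\<^sub>2}"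
  using assms unfolding hilbert_tensor_def by blast+

lemma hilbert_tensor_in:
  assumes "hilbert_tensor H\<^sub>1 H\<^sub>2 T t" "x \<in> H\<^sub>1" "y \<in> H\<^sub>2"
  shows "t x y \<in> T"
  unfolding hilbert_tensor_span[OF assms(1)] using assms(2,3)
  by (intro subsetD[OF closed_cspan_superset]) blast

lemma hilbert_tensor_norm:
  assumes "hilbert_tensor H\<^sub>1 H\<^sub>2 T t" "x \<in> H\<^sub>1" "y \<in> H\<^sub>2"
  shows "norm (t x y) = norm x * norm y"
proof -
  have "complex_of_real ((norm (t x y))\<^sup>2) = complex_of_real ((norm x * norm y)\<^sup>2)"
    using hilbert_tensor_cinner[OF assms(1,2,2,3,3)]
    unfolding cinner_self by (simp add: power_mult_distrib)
  then have "(norm (t x y))\<^sup>2 = (norm x * norm y)\<^sup>2" unfolding of_real_eq_iff .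
  then show ?thesis by simp
qed

text \<open>The map is linear and bounded on \<open>H\<close> only, as is \<open>t\<close> in each
  variable, so the preimage of \<open>W\<close> is taken relative to \<open>H\<close>.\<close>

lemma closed_cspan_preimage:
  fixes f :: "'a::cbanach \<Rightarrow> 'b::cbanach"
  assumes H: "csubspace H" "closed H" and W: "csubspace W" "closed W"
    and add: "\<And>x y. x \<in> H \<Longrightarrow> y \<in> H \<Longrightarrow> f (x + y) = f x + f y"
    and scale: "\<And>c x. x \<in> H \<Longrightarrow> f (c *\<^sub>C x) = c *\<^sub>C f x"
    and bound: "\<And>x. x \<in> H \<Longrightarrow> norm (f x) \<le> B * norm x"
    and Y: "H = closed_cspan Y" "\<And>y. y \<in> Y \<Longrightarrow> f y \<in> W" and x: "x \<in> H"
  shows "f x \<in> W"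
proof -
  have "(max B 0)-lipschitz_on H f"
  proof (rule lipschitz_onI)
    fix x y assume xy: "x \<in> H" "y \<in> H"
    then have d: "x - y \<in> H" by (rule csubspace_diff[OF H(1)])
    then have "f x - f y = f (x - y)" using add[OF d xy(2)] by simp
    moreover have "norm (f (x - y)) \<le> max B 0 * norm (x - y)"
      using bound[OF d] mult_right_mono[of B "max B 0" "norm (x - y)"] by simp
    ultimately show "dist (f x) (f y) \<le> max B 0 * dist x y" by (simp add: dist_norm)
  qed simp
  then have cont: "continuous_on H f" by (rule lipschitz_on_continuous_on)
  have "closed_cspan Y \<subseteq> H \<inter> f -` W"
  proof (rule closed_cspan_minimal)
    have "f 0 = 0" using scale[OF x, of 0] by (simp add: scaleC_zero_left)
    then show "csubspace (H \<inter> f -` W)"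
      using H(1) W(1) by (auto simp: csubspace_def add scale)
    show "closed (H \<inter> f -` W)" by (rule continuous_closed_preimage[OF cont H(2) W(2)])
    show "Y \<subseteq> H \<inter> f -` W" using closed_cspan_superset[of Y] Y by auto
  qed
  then show ?thesis using x Y(1) by blast
qed

lemma product_letter_in:
  fixes i j N M :: nat
  assumes "i \<in> {1..N}" "j \<in> {1..M}"
  shows "M * (i - 1) + j \<in> {1..N * M}"
proof -
  have "M * (i - 1) + j \<le> M * (i - 1) + M" using assms by simp
  also have "\<dots> = M * i" using assms by (cases i) auto
  also have "\<dots> \<le> N * M" using assms by (simp add: mult.commute)
  finally show ?thesis using assms by simp
qed

lemma list_dot_in:
  "length I = length I' \<Longrightarrow> set I \<subseteq> {1..N} \<Longrightarrow> set I' \<subseteq> {1..M} \<Longrightarrow> set (list_dot M I I') \<subseteq> {1..N * M}"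
proof (induction I I' rule: list_induct2)
  case (Cons i I j I')
  then show ?case using product_letter_in[of i N j M] by (simp add: list_dot_def)
qed (simp add: list_dot_def)

section \<open>Words and tails in the tensor product\<close>

context
  fixes N M :: nat and \<phi> :: "cuntz_elem \<Rightarrow> cuntz_tensor_elem"
    and H\<^sub>1 :: "'h1::chilbert_space set" and \<pi>\<^sub>1 :: "cuntz_elem \<Rightarrow> 'h1 bop"
    and H\<^sub>2 :: "'h2::chilbert_space set" and \<pi>\<^sub>2 :: "cuntz_elem \<Rightarrow> 'h2 bop"
    and T :: "'t::chilbert_space set" and t :: "'h1 \<Rightarrow> 'h2 \<Rightarrow> 't"
    and \<pi> :: "cuntz_tensor_elem \<Rightarrow> 't bop"
  assumes \<phi>: "cuntz_embedding N M \<phi>"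
    and \<pi>\<^sub>1: "representation (cuntz_algebra N) H\<^sub>1 \<pi>\<^sub>1"
    and \<pi>\<^sub>2: "representation (cuntz_algebra M) H\<^sub>2 \<pi>\<^sub>2"
    and \<pi>: "tensor_rep (cuntz_algebra N) (cuntz_algebra M) H\<^sub>1 \<pi>\<^sub>1 H\<^sub>2 \<pi>\<^sub>2 T t \<pi>"
begin

lemma tensor_hilbert: "hilbert_tensor H\<^sub>1 H\<^sub>2 T t"
  using \<pi> by (simp add: tensor_rep_def)

lemma representation_embedding: "representation (cuntz_algebra (N * M)) T (\<pi> \<circ> \<phi>)"
  using \<phi> \<pi> representation_comp unfolding cuntz_embedding_def tensor_rep_def by blast

lemma tensor_gen:
  assumes "i \<in> {1..N}" "j \<in> {1..M}" "x \<in> H\<^sub>1" "y \<in> H\<^sub>2"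
  shows "app ((\<pi> \<circ> \<phi>) (cuntz_gen (N * M) (M * (i - 1) + j))) (t x y) =
    t (app (\<pi>\<^sub>1 (cuntz_gen N i)) x) (app (\<pi>\<^sub>2 (cuntz_gen M j)) y)"
proof -
  have "\<phi> (cuntz_gen (N * M) (M * (i - 1) + j)) = field_tensor (cuntz_gen N i) (cuntz_gen M j)"
    using \<phi> assms unfolding cuntz_embedding_def by blast
  moreover have "app (\<pi> (field_tensor (cuntz_gen N i) (cuntz_gen M j))) (t x y) =
    t (app (\<pi>\<^sub>1 (cuntz_gen N i)) x) (app (\<pi>\<^sub>2 (cuntz_gen M j)) y)"
    using \<pi> assms cuntz_gen_in unfolding tensor_rep_def by blast
  ultimately show ?thesis by simp
qed

lemma tensor_word:
  assumes "length I = length I'" "set I \<subseteq> {1..N}" "set I' \<subseteq> {1..M}" "x \<in> H\<^sub>1" "y \<in> H\<^sub>2"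
  shows "word_op (N * M) (\<pi> \<circ> \<phi>) (list_dot M I I') (t x y) = t (word_op N \<pi>\<^sub>1 I x) (word_op M \<pi>\<^sub>2 I' y)"
  using assms(1-3)
proof (induction I I' rule: list_induct2)
  case (Cons i I j I')
  then have ij: "i \<in> {1..N}" "j \<in> {1..M}" and sets: "set I \<subseteq> {1..N}" "set I' \<subseteq> {1..M}" by auto
  have "list_dot M (i # I) (j # I') = (M * (i - 1) + j) # list_dot M I I'" by (simp add: list_dot_def)
  then show ?case
    by (simp only: word_op_simps Cons.IH[OF sets] tensor_gen[OF ij word_op_in[OF \<pi>\<^sub>1 sets(1) \<open>x \<in> H\<^sub>1\<close>]
          word_op_in[OF \<pi>\<^sub>2 sets(2) \<open>y \<in> H\<^sub>2\<close>]])
qed (simp add: list_dot_def)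

lemma tensor_tail:
  assumes v: "cuntz_tail N H\<^sub>1 \<pi>\<^sub>1 K v" and w: "cuntz_tail M H\<^sub>2 \<pi>\<^sub>2 L w"
  shows "cuntz_tail (N * M) T (\<pi> \<circ> \<phi>) (\<lambda>n. M * (K n - 1) + L n) (\<lambda>n. t (v n) (w n))"
  unfolding cuntz_tail_def
proof (intro allI conjI)
  fix n
  note vn = cuntz_tail_letter[OF v, of n] cuntz_tail_in[OF v] cuntz_tail_step[OF v, of n]
    and wn = cuntz_tail_letter[OF w, of n] cuntz_tail_in[OF w] cuntz_tail_step[OF w, of n]
  show "M * (K n - 1) + L n \<in> {1..N * M}" by (rule product_letter_in[OF vn(1) wn(1)])
  show "t (v n) (w n) \<in> T" by (rule hilbert_tensor_in[OF tensor_hilbert vn(2) wn(2)])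
  show "t (v n) (w n) = app ((\<pi> \<circ> \<phi>) (cuntz_gen (N * M) (M * (K n - 1) + L n))) (t (v (Suc n)) (w (Suc n)))"
    unfolding tensor_gen[OF vn(1) wn(1) vn(2) wn(2)] using vn(3) wn(3) by simp
qed

text \<open>Tensors of word vectors are handled first, by padding both words to a common length so
  that \<open>tensor_word\<close> combines them; continuity in each variable then reaches all simple
  tensors.\<close>

lemma tensor_total:
  assumes v: "cuntz_tail N H\<^sub>1 \<pi>\<^sub>1 K v" and w: "cuntz_tail M H\<^sub>2 \<pi>\<^sub>2 L w"
    and H\<^sub>1: "H\<^sub>1 = closed_cspan {word_op N \<pi>\<^sub>1 I (v n) | I n. set I \<subseteq> {1..N}}" (is "_ = closed_cspan ?Y\<^sub>1")
    and H\<^sub>2: "H\<^sub>2 = closed_cspan {word_op M \<pi>\<^sub>2 I (w n) | I n. set I \<subseteq> {1..M}}" (is "_ = closed_cspan ?Y\<^sub>2")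
    and W: "csubspace W" "closed W"
    and words: "\<And>I m n. set I \<subseteq> {1..N * M} \<Longrightarrow> word_op (N * M) (\<pi> \<circ> \<phi>) I (t (v m) (w n)) \<in> W"
  shows "T \<subseteq> W"
proof -
  have sub1: "csubspace H\<^sub>1" "closed H\<^sub>1" and sub2: "csubspace H\<^sub>2" "closed H\<^sub>2"
    using \<pi>\<^sub>1 \<pi>\<^sub>2 by (auto simp: representation_def)
  have Y: "t x y \<in> W" if x: "x \<in> ?Y\<^sub>1" and y: "y \<in> ?Y\<^sub>2" for x y
  proof -
    obtain I m where I: "x = word_op N \<pi>\<^sub>1 I (v m)" "set I \<subseteq> {1..N}" using x by blast
    obtain I' n where I': "y = word_op M \<pi>\<^sub>2 I' (w n)" "set I' \<subseteq> {1..M}" using y by blast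
    define d d' where "d = length I' - length I" and "d' = length I - length I'"
    \<comment> \<open>The shorter word takes its missing letters from its own tail.\<close>
    define P P' where "P = I @ map K [m..<m + d]" and "P' = I' @ map L [n..<n + d']"
    have P: "set P \<subseteq> {1..N}"
      unfolding P_def set_append set_map by (intro Un_least I(2) image_subsetI cuntz_tail_letter[OF v])
    have P': "set P' \<subseteq> {1..M}"
      unfolding P'_def set_append set_map by (intro Un_least I'(2) image_subsetI cuntz_tail_letter[OF w])
    have len: "length P = length P'" by (simp add: P_def P'_def d_def d'_def)
    have "x = word_op N \<pi>\<^sub>1 P (v (m + d))" "y = word_op M \<pi>\<^sub>2 P' (w (n + d'))"
      unfolding P_def P'_def word_op_simps I(1) I'(1)
      by (simp_all flip: cuntz_tail_word[OF v] cuntz_tail_word[OF w])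
    then have "t x y = word_op (N * M) (\<pi> \<circ> \<phi>) (list_dot M P P') (t (v (m + d)) (w (n + d')))"
      using tensor_word[OF len P P' cuntz_tail_in[OF v] cuntz_tail_in[OF w]] by simp
    then show ?thesis using words[OF list_dot_in[OF len P P']] by simp
  qed
  have Y2: "?Y\<^sub>2 \<subseteq> H\<^sub>2" using closed_cspan_superset[of ?Y\<^sub>2] by (simp only: H\<^sub>2[symmetric])
  have 1: "t x y \<in> W" if x: "x \<in> H\<^sub>1" and y: "y \<in> ?Y\<^sub>2" for x y
  proof -
    have yH: "y \<in> H\<^sub>2" using Y2 y by (rule subsetD)
    show ?thesis
    proof (rule closed_cspan_preimage[where f = "\<lambda>x. t x y" and B = "norm y", OF sub1 W _ _ _ H\<^sub>1 _ x])
      show "norm (t x y) \<le> norm y * norm x" if "x \<in> H\<^sub>1" for x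
        using hilbert_tensor_norm[OF tensor_hilbert that yH] by (simp add: mult.commute)
      show "t x y \<in> W" if "x \<in> ?Y\<^sub>1" for x by (rule Y[OF that y])
    qed (use yH in \<open>auto intro!: hilbert_tensor_add_left[OF tensor_hilbert]
        hilbert_tensor_scaleC_left[OF tensor_hilbert]\<close>)
  qed
  have 2: "t x y \<in> W" if x: "x \<in> H\<^sub>1" and y: "y \<in> H\<^sub>2" for x y
  proof (rule closed_cspan_preimage[where f = "\<lambda>y. t x y" and B = "norm x", OF sub2 W _ _ _ H\<^sub>2 _ y])
    show "norm (t x y) \<le> norm x * norm y" if "y \<in> H\<^sub>2" for y
      using hilbert_tensor_norm[OF tensor_hilbert x that] by simp
    show "t x y \<in> W" if "y \<in> ?Y\<^sub>2" for y by (rule 1[OF x that])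
  qed (use x in \<open>auto intro!: hilbert_tensor_add_right[OF tensor_hilbert]
      hilbert_tensor_scaleC_right[OF tensor_hilbert]\<close>)
  have "T = closed_cspan {t x y | x y. x \<in> H\<^sub>1 \<and> y \<in> H\<^sub>2}"
    by (rule hilbert_tensor_span[OF tensor_hilbert])
  also have "\<dots> \<subseteq> W" using 2 by (intro closed_cspan_minimal W) blast
  finally show ?thesis .
qed

end

section \<open>Decomposition of the tensor product representation\<close>

theorem theorem1p6:
  fixes N M :: nat and K L :: multiindex
    and \<phi> :: "cuntz_elem \<Rightarrow> cuntz_tensor_elem"
    and H\<^sub>1 :: "'h1::chilbert_space set" and \<pi>\<^sub>1 :: "cuntz_elem \<Rightarrow> 'h1 bop"
    and H\<^sub>2 :: "'h2::chilbert_space set" and \<pi>\<^sub>2 :: "cuntz_elem \<Rightarrow> 'h2 bop"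
    and T :: "'t::chilbert_space set" and t :: "'h1 \<Rightarrow> 'h2 \<Rightarrow> 't"
    and \<pi> :: "cuntz_tensor_elem \<Rightarrow> 't bop"
    and H :: "int \<Rightarrow> 'h::chilbert_space set" and \<rho> :: "int \<Rightarrow> cuntz_elem \<Rightarrow> 'h bop"
  assumes "2 \<le> N" and "2 \<le> M"
    and "cuntz_embedding N M \<phi>"
    and "multiindex_over N K" and "multiindex_over M L"
    and "is_infinite L \<longrightarrow> is_infinite K"
    and "is_P N K H\<^sub>1 \<pi>\<^sub>1" and "is_P M L H\<^sub>2 \<pi>\<^sub>2"
    and "tensor_rep (cuntz_algebra N) (cuntz_algebra M) H\<^sub>1 \<pi>\<^sub>1 H\<^sub>2 \<pi>\<^sub>2 T t \<pi>"
    and "\<forall>i\<in>decomposition_index K L. is_P (N * M) (multiindex_star M K (multiindex_shift L i)) (H i) (\<rho> i)"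
  shows "unitarily_equivalent (cuntz_algebra (N * M)) T (\<pi> \<circ> \<phi>)
    (dsum_space (decomposition_index K L) H) (dsum_rep (decomposition_index K L) \<rho>)"
proof -
  let ?D = "decomposition_index K L" and ?S = "\<pi> \<circ> \<phi>"
  let ?J = "\<lambda>i. multiindex_star M K (multiindex_shift L i)"
  note \<pi>\<^sub>1 = is_P_representation[OF assms(7)] and \<pi>\<^sub>2 = is_P_representation[OF assms(8)]
  note tensor = assms(3) \<pi>\<^sub>1 \<pi>\<^sub>2 assms(9)
  note S = representation_embedding[OF tensor] and ht = tensor_hilbert[OF tensor]
  have K: "K \<noteq> FinIdx []" and L: "L \<noteq> FinIdx []" using assms(4,5) by auto
  obtain v where v: "cuntz_tail N H\<^sub>1 \<pi>\<^sub>1 (multiindex_letter K) v"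
    "\<And>m n. cinner (v m) (v n) = of_bool (m mod multiindex_period K = n mod multiindex_period K)"
    "H\<^sub>1 = closed_cspan {word_op N \<pi>\<^sub>1 I (v n) | I n. set I \<subseteq> {1..N}}"
    using is_P_tail[OF assms(7,4)] by blast
  obtain w where w: "cuntz_tail M H\<^sub>2 \<pi>\<^sub>2 (multiindex_letter L) w"
    "\<And>m n. cinner (w m) (w n) = of_bool (m mod multiindex_period L = n mod multiindex_period L)"
    "H\<^sub>2 = closed_cspan {word_op M \<pi>\<^sub>2 I (w n) | I n. set I \<subseteq> {1..M}}"
    using is_P_tail[OF assms(8,5)] by blast
  have M: "M \<ge> 1" using assms(2) by simp
  obtain u :: "int \<Rightarrow> nat \<Rightarrow> 'h2" where
    uu: "\<forall>i\<in>?D. cuntz_tail M H\<^sub>2 \<pi>\<^sub>2 (multiindex_letter (multiindex_shift L i)) (u i)"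
    "\<forall>i\<in>?D. \<forall>m n. cinner (u i m) (u i n) = of_bool (m mod multiindex_period L = n mod multiindex_period L)"
    "\<forall>i\<in>?D. \<forall>j\<in>?D. \<forall>m n. i \<noteq> j \<longrightarrow>
      m mod multiindex_period K = n mod multiindex_period K \<longrightarrow> cinner (u i m) (u j n) = 0"
    "\<forall>m n. \<exists>i\<in>?D. \<exists>q. q mod multiindex_period K = m mod multiindex_period K \<and> u i q = w n"
    using shifted_tails[OF \<pi>\<^sub>2 M w(1,2) L assms(6)] .
  note u = bspec[OF uu(1)] and u_gram = uu(2)[rule_format] and u_orth = uu(3)[rule_format]
    and u_cover = uu(4)[rule_format]
  define x where "x i n = t (v n) (u i n)" for i n
  have vH: "v n \<in> H\<^sub>1" for n by (rule cuntz_tail_in[OF v(1)])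
  have uH: "u i n \<in> H\<^sub>2" if "i \<in> ?D" for i n by (rule cuntz_tail_in[OF u[OF that]])
  have cinner_x: "cinner (x i m) (x j n) = cinner (v m) (v n) * cinner (u i m) (u j n)"
    if "i \<in> ?D" "j \<in> ?D" for i j m n
    unfolding x_def using that by (intro hilbert_tensor_cinner[OF ht] vH uH)
  have shift: "is_infinite (multiindex_shift L i) \<longrightarrow> is_infinite K" "multiindex_shift L i \<noteq> FinIdx []" for i
    using assms(6) L by (simp_all add: is_infinite_shift multiindex_shift_nonempty)
  have letter: "multiindex_letter (?J i) = (\<lambda>n. M * (multiindex_letter K n - 1) +
      multiindex_letter (multiindex_shift L i) n)" for i
    by (rule ext) (rule multiindex_star_letter(1)[OF shift(1) K shift(2)])
  have period: "multiindex_period (?J i) = lcm (multiindex_period K) (multiindex_period L)" for i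
    by (simp add: multiindex_star_letter(2)[OF shift(1) K shift(2)] multiindex_period_shift)
  have x: "cuntz_tail (N * M) T ?S (multiindex_letter (?J i)) (x i)" if "i \<in> ?D" for i
    unfolding letter x_def by (rule tensor_tail[OF tensor v(1) u[OF that]])
  \<comment> \<open>All properties of the tail of summand \<open>i\<close> are bundled, so that one
    choice provides the whole family \<open>z\<close>.\<close>
  define Q where "Q i z \<longleftrightarrow> cuntz_tail (N * M) (H i) (\<rho> i) (multiindex_letter (?J i)) z \<and>
      (\<forall>m n. cinner (z m) (z n) = of_bool (m mod multiindex_period (?J i) = n mod multiindex_period (?J i))) \<and>
      H i = closed_cspan {word_op (N * M) (\<rho> i) I (z n) | I n. set I \<subseteq> {1..N * M}}" for i z
  have "\<exists>z. Q i z" if i: "i \<in> ?D" for i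
  proof -
    have "multiindex_over (N * M) (?J i)"
      using cuntz_tail_letter[OF x[OF i]] multiindex_star_letter(3)[OF shift(1) K shift(2)]
      by (rule multiindex_overI)
    from is_P_tail[OF bspec[OF assms(10) i] this] show ?thesis unfolding Q_def .
  qed
  then obtain z where zz: "\<And>i. i \<in> ?D \<Longrightarrow> Q i (z i)" by metis
  note z = zz[unfolded Q_def, THEN conjunct1]
    and z_gram = zz[unfolded Q_def, THEN conjunct2, THEN conjunct1, rule_format]
    and z_total = zz[unfolded Q_def, THEN conjunct2, THEN conjunct2]
  let ?X = "{word_op (N * M) ?S I (x i n) | I i n. i \<in> ?D \<and> set I \<subseteq> {1..N * M}}"
  have T: "T = closed_cspan ?X"
  proof (rule antisym)
    show "closed_cspan ?X \<subseteq> T"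
      using representation_csubspace[OF S] representation_closed[OF S]
      by (rule closed_cspan_minimal) (auto intro!: word_op_in[OF S] cuntz_tail_in[OF x])
    show "T \<subseteq> closed_cspan ?X"
    proof (rule tensor_total[OF tensor v(1) w(1) v(3) w(3) csubspace_closed_cspan closed_closed_cspan])
      fix I m n assume I: "set I \<subseteq> {1..N * M}"
      obtain i q where i: "i \<in> ?D" "q mod multiindex_period K = m mod multiindex_period K" "u i q = w n"
        using u_cover by blast
      \<comment> \<open>Since \<open>q\<close> and \<open>m\<close> agree modulo the period of
        \<open>K\<close>, replacing \<open>m\<close> by \<open>q\<close> does not change the first
        factor.\<close>
      have "v q = v m" by (rule cinner_unit_eq) (simp_all add: v(2) i(2))
      then have "t (v m) (w n) = x i q" by (simp add: x_def i(3))
      then have "word_op (N * M) ?S I (t (v m) (w n)) \<in> ?X" using I i(1) by auto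
      then show "word_op (N * M) ?S I (t (v m) (w n)) \<in> closed_cspan ?X"
        by (rule subsetD[OF closed_cspan_superset])
    qed
  qed
  show ?thesis
  proof (rule unitarily_equivalent_dsum_tails[OF S _ x z _ _ T z_total])
    show "representation (cuntz_algebra (N * M)) (H i) (\<rho> i)" if "i \<in> ?D" for i
      using assms(10) that is_P_representation by blast
    \<comment> \<open>The product of the indicators of congruence modulo both periods is the
      indicator modulo their lcm.\<close>
    show "cinner (x i p) (x i q) = cinner (z i p) (z i q)" if "i \<in> ?D" for i p q
      using that by (simp add: cinner_x v(2) u_gram z_gram period mod_lcm_eq_iff)
    \<comment> \<open>Either the first factors are orthogonal, or \<open>p\<close> and
      \<open>q\<close> agree modulo the period of \<open>K\<close> and \<open>u_orth\<close> applies
      to the second factors.\<close>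
    show "cinner (x i p) (x j q) = 0" if "i \<in> ?D" "j \<in> ?D" "i \<noteq> j" for i j p q
      using that u_orth[OF that, of p q] by (auto simp: cinner_x v(2))
  qed
qed

end
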